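(* Let $R\subset S$ be an FCP extension of commutative rings. There exists a least $T\in[R,S]$ such that $T\subseteq S$ is integral. This least element is called the co-integral closure of $R\subset S$ and is denoted by $\underline R$. Moreover, $\underline R=\bigcap\{U\in[R,S]\mid U\subseteq S \text{ is integral}\}$, and $\widetilde R\subseteq\underline R$, where $\widetilde R$ is the Prüfer hull of $R$ in $S$.
   Context: All rings are commutative and unital; a ring extension $R\subseteq S$ means $R$ is a unital subring of $S$. $\subset$ denotes proper inclusion. $[R,S]$ is the set of all $R$-subalgebras of $S$, ordered by inclusion. The extension $R\subseteq S$ has FCP (is an FCP extension) if each chain in $[R,S]$ is finite. An extension $R\subseteq S$ is called Prüfer if $R\subseteq T$ is a flat epimorphism (of commutative rings) for each $T\in[R,S]$. The Prüfer hull $\widetilde R$ of $R\subseteq S$ is the greatest $T\in[R,S]$ such that $R\subseteq T$ is Prüfer (it always exists). *)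

theory Defs
  imports "HOL-Algebra.Algebra"
begin

text \<open>
  An extension of commutative rings is given by a \<^const>\<open>cring\<close> \<open>S\<close> and a set \<open>R\<close> with
  \<^term>\<open>subring R S\<close>; a subring \<open>T\<close> of \<open>S\<close>, regarded as a ring, is \<open>S\<lparr>carrier := T\<rparr>\<close>.
\<close>

definition intermediate_rings :: "'a set \<Rightarrow> ('a, 'b) ring_scheme \<Rightarrow> 'a set set"
  where "intermediate_rings R S = {T. subring T S \<and> R \<subseteq> T}"

definition FCP :: "'a set \<Rightarrow> ('a, 'b) ring_scheme \<Rightarrow> bool"
  where "FCP R S \<longleftrightarrow> (\<forall>C. subset.chain (intermediate_rings R S) C \<longrightarrow> finite C)"

text \<open>
  \<^const>\<open>ring.eval\<close> takes the coefficient list with the leading coefficient first, so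
  \<open>\<one> # p\<close> is an arbitrary monic polynomial over \<open>R\<close>.
\<close>

definition integral_over :: "'a set \<Rightarrow> ('a, 'b) ring_scheme \<Rightarrow> 'a \<Rightarrow> bool"
  where "integral_over R S x \<longleftrightarrow>
    (\<exists>p. set p \<subseteq> R \<and> ring.eval S (\<one>\<^bsub>S\<^esub> # p) x = \<zero>\<^bsub>S\<^esub>)"

definition integral_ext :: "'a set \<Rightarrow> ('a, 'b) ring_scheme \<Rightarrow> bool"
  where "integral_ext R S \<longleftrightarrow> (\<forall>x \<in> carrier S. integral_over R S x)"


subsection \<open>Tensor products and flatness\<close>

definition tensor_relators ::
    "('r, 'c) ring_scheme \<Rightarrow> ('r, 'm, 'd) module_scheme \<Rightarrow> ('r, 'n, 'e) module_scheme
      \<Rightarrow> ('m \<times> 'n \<Rightarrow>\<^sub>0 int) set"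
  where "tensor_relators R M N =
    {frag_of (x \<oplus>\<^bsub>M\<^esub> x', y) - frag_of (x, y) - frag_of (x', y) |x x' y.
       x \<in> carrier M \<and> x' \<in> carrier M \<and> y \<in> carrier N} \<union>
    {frag_of (x, y \<oplus>\<^bsub>N\<^esub> y') - frag_of (x, y) - frag_of (x, y') |x y y'.
       x \<in> carrier M \<and> y \<in> carrier N \<and> y' \<in> carrier N} \<union>
    {frag_of (a \<odot>\<^bsub>M\<^esub> x, y) - frag_of (x, a \<odot>\<^bsub>N\<^esub> y) |a x y.
       a \<in> carrier R \<and> x \<in> carrier M \<and> y \<in> carrier N}"

definition tensor_kernel ::
    "('r, 'c) ring_scheme \<Rightarrow> ('r, 'm, 'd) module_scheme \<Rightarrow> ('r, 'n, 'e) module_scheme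
      \<Rightarrow> ('m \<times> 'n \<Rightarrow>\<^sub>0 int) set"
  where "tensor_kernel R M N =
    generate (free_Abelian_group (carrier M \<times> carrier N)) (tensor_relators R M N)"

text \<open>The underlying abelian group of \<open>M \<otimes>\<^sub>R N\<close>; this is all that flatness refers to.\<close>

definition tensor_product ::
    "('r, 'c) ring_scheme \<Rightarrow> ('r, 'm, 'd) module_scheme \<Rightarrow> ('r, 'n, 'e) module_scheme
      \<Rightarrow> ('m \<times> 'n \<Rightarrow>\<^sub>0 int) set monoid"
  where "tensor_product R M N =
    free_Abelian_group (carrier M \<times> carrier N) Mod tensor_kernel R M N"

definition module_homs ::
    "('r, 'c) ring_scheme \<Rightarrow> ('r, 'm, 'd) module_scheme \<Rightarrow> ('r, 'n, 'e) module_scheme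
      \<Rightarrow> ('m \<Rightarrow> 'n) set"
  where "module_homs R M N = {f \<in> carrier M \<rightarrow> carrier N.
    (\<forall>x \<in> carrier M. \<forall>y \<in> carrier M. f (x \<oplus>\<^bsub>M\<^esub> y) = f x \<oplus>\<^bsub>N\<^esub> f y) \<and>
    (\<forall>a \<in> carrier R. \<forall>x \<in> carrier M. f (a \<odot>\<^bsub>M\<^esub> x) = a \<odot>\<^bsub>N\<^esub> f x)}"

text \<open>
  \<open>tensor_map R N T f\<close> is the map \<open>f \<otimes> id : M \<otimes>\<^sub>R T \<rightarrow> N \<otimes>\<^sub>R T\<close> induced by \<open>f : M \<rightarrow> N\<close>.
  It acts on classes modulo \<^const>\<open>tensor_kernel\<close>; if \<open>f\<close> is linear, all the cosets in the union
  coincide (\<open>tensor_map_coset\<close> below).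
\<close>

definition frag_map_left :: "('m \<Rightarrow> 'n) \<Rightarrow> ('m \<times> 't \<Rightarrow>\<^sub>0 int) \<Rightarrow> ('n \<times> 't \<Rightarrow>\<^sub>0 int)"
  where "frag_map_left f = frag_extend (\<lambda>(x, t). frag_of (f x, t))"

definition tensor_map ::
    "('r, 'c) ring_scheme \<Rightarrow> ('r, 'n, 'd) module_scheme \<Rightarrow> ('r, 't, 'e) module_scheme
      \<Rightarrow> ('m \<Rightarrow> 'n) \<Rightarrow> ('m \<times> 't \<Rightarrow>\<^sub>0 int) set \<Rightarrow> ('n \<times> 't \<Rightarrow>\<^sub>0 int) set"
  where "tensor_map R N T f Z =
    (\<Union>x \<in> Z. r_coset (free_Abelian_group (carrier N \<times> carrier T))
       (tensor_kernel R N T) (frag_map_left f x))"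

text \<open>
  \<open>T\<close> is flat over \<open>R\<close> if tensoring with \<open>T\<close> preserves injectivity of linear maps. A definition
  cannot quantify over all types of module elements, so the test modules have elements in
  \<open>'r list\<close>. Up to isomorphism these include all submodules of finitely generated \<open>R\<close>-modules,
  and this implies the condition for modules over an arbitrary type: see \<open>flat_module_inj\<close>.
\<close>

definition flat_module :: "('r, 'c) ring_scheme \<Rightarrow> ('r, 't, 'e) module_scheme \<Rightarrow> bool"
  where "flat_module R T \<longleftrightarrow> module R T \<and>
    (\<forall>(M :: ('r, 'r list) module) (N :: ('r, 'r list) module) f.
       module R M \<longrightarrow> module R N \<longrightarrow> f \<in> module_homs R M N \<longrightarrow> inj_on f (carrier M) \<longrightarrow>
       inj_on (tensor_map R N T f) (carrier (tensor_product R M T)))"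


subsection \<open>Flat epimorphisms, Pruefer extensions, hull and co-integral closure\<close>

text \<open>
  Epimorphism in the category of commutative rings, for an inclusion \<open>R \<subseteq> S\<close>. The subring of
  \<open>C\<close> generated by the images of two homomorphisms \<open>f\<close>, \<open>g\<close> on \<open>S\<close> consists of the finite
  sums of products \<open>f x * g y\<close>, so it is no larger than \<open>('a \<times> 'a) list\<close>; hence targets \<open>C\<close> of
  this type suffice to test against targets of arbitrary type: see \<open>epi_ext_eq\<close>.
\<close>

definition epi_ext :: "'a set \<Rightarrow> ('a, 'b) ring_scheme \<Rightarrow> bool"
  where "epi_ext R S \<longleftrightarrow>
    (\<forall>(C :: ('a \<times> 'a) list ring) f g.
       cring C \<longrightarrow> f \<in> ring_hom S C \<longrightarrow> g \<in> ring_hom S C \<longrightarrow>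
       (\<forall>x \<in> R. f x = g x) \<longrightarrow> (\<forall>x \<in> carrier S. f x = g x))"

definition ring_module :: "('a, 'b) ring_scheme \<Rightarrow> ('a, 'a) module"
  where "ring_module S =
    \<lparr>carrier = carrier S, monoid.mult = monoid.mult S, one = \<one>\<^bsub>S\<^esub>,
     ring.zero = \<zero>\<^bsub>S\<^esub>, add = add S, smult = monoid.mult S\<rparr>"

definition flat_epi_ext :: "'a set \<Rightarrow> ('a, 'b) ring_scheme \<Rightarrow> bool"
  where "flat_epi_ext R S \<longleftrightarrow> flat_module (S\<lparr>carrier := R\<rparr>) (ring_module S) \<and> epi_ext R S"

definition pruefer_ext :: "'a set \<Rightarrow> ('a, 'b) ring_scheme \<Rightarrow> bool"
  where "pruefer_ext R S \<longleftrightarrow>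
    (\<forall>T \<in> intermediate_rings R S. flat_epi_ext R (S\<lparr>carrier := T\<rparr>))"

definition pruefer_hull :: "'a set \<Rightarrow> ('a, 'b) ring_scheme \<Rightarrow> 'a set"
  where "pruefer_hull R S =
    (GREATEST T. T \<in> intermediate_rings R S \<and> pruefer_ext R (S\<lparr>carrier := T\<rparr>))"

definition co_integral_closure :: "'a set \<Rightarrow> ('a, 'b) ring_scheme \<Rightarrow> 'a set"
  where "co_integral_closure R S =
    (LEAST T. T \<in> intermediate_rings R S \<and> integral_ext T S)"


subsection \<open>Independence of the type of the test objects\<close>

lemma tensor_relators_cases [consumes 1, case_names add_left add_right smult]:
  assumes "h \<in> tensor_relators R M N"
  obtains x x' y where "h = frag_of (x \<oplus>\<^bsub>M\<^esub> x', y) - frag_of (x, y) - frag_of (x', y)"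
      "x \<in> carrier M" "x' \<in> carrier M" "y \<in> carrier N"
    | x y y' where "h = frag_of (x, y \<oplus>\<^bsub>N\<^esub> y') - frag_of (x, y) - frag_of (x, y')"
      "x \<in> carrier M" "y \<in> carrier N" "y' \<in> carrier N"
    | a x y where "h = frag_of (a \<odot>\<^bsub>M\<^esub> x, y) - frag_of (x, a \<odot>\<^bsub>N\<^esub> y)"
      "a \<in> carrier R" "x \<in> carrier M" "y \<in> carrier N"
  using assms unfolding tensor_relators_def by blast

lemma tensor_relatorsI:
  "x \<in> carrier M \<Longrightarrow> x' \<in> carrier M \<Longrightarrow> y \<in> carrier N \<Longrightarrow>
    frag_of (x \<oplus>\<^bsub>M\<^esub> x', y) - frag_of (x, y) - frag_of (x', y) \<in> tensor_relators R M N"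
  "x \<in> carrier M \<Longrightarrow> y \<in> carrier N \<Longrightarrow> y' \<in> carrier N \<Longrightarrow>
    frag_of (x, y \<oplus>\<^bsub>N\<^esub> y') - frag_of (x, y) - frag_of (x, y') \<in> tensor_relators R M N"
  "a \<in> carrier R \<Longrightarrow> x \<in> carrier M \<Longrightarrow> y \<in> carrier N \<Longrightarrow>
    frag_of (a \<odot>\<^bsub>M\<^esub> x, y) - frag_of (x, a \<odot>\<^bsub>N\<^esub> y) \<in> tensor_relators R M N"
  unfolding tensor_relators_def by blast+

lemma tensor_relators_keys:
  fixes M :: "('r, 'm, 'd) module_scheme" and N :: "('r, 'n, 'e) module_scheme"
  assumes "module R M" "module R N" "h \<in> tensor_relators R M N"
  shows "Poly_Mapping.keys h \<subseteq> carrier M \<times> carrier N"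
proof -
  interpret M: module R M by fact
  interpret N: module R N by fact
  have sub: "Poly_Mapping.keys (a - b) \<subseteq> C" if "Poly_Mapping.keys a \<subseteq> C" "Poly_Mapping.keys b \<subseteq> C"
    for a b :: "'m \<times> 'n \<Rightarrow>\<^sub>0 int" and C
    using that keys_diff[of a b] by (meson Un_least order_trans)
  from assms(3) show ?thesis
  proof (cases rule: tensor_relators_cases)
    case add_left
    show ?thesis unfolding add_left(1) by (rule sub, rule sub) (use add_left in simp_all)
  next
    case add_right
    show ?thesis unfolding add_right(1) by (rule sub, rule sub) (use add_right in simp_all)
  next
    case smult
    show ?thesis unfolding smult(1) by (rule sub) (use smult in simp_all)
  qed
qed

lemma tensor_kernel_subgroup:
  assumes "module R M" "module R N"
  shows "subgroup (tensor_kernel R M N) (free_Abelian_group (carrier M \<times> carrier N))"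
  unfolding tensor_kernel_def
  by (rule group.generate_is_subgroup) (use tensor_relators_keys[OF assms] in auto)

lemma tensor_kernel_closed:
  assumes "module R M" "module R N"
  shows "0 \<in> tensor_kernel R M N"
    and "h \<in> tensor_relators R M N \<Longrightarrow> h \<in> tensor_kernel R M N"
    and "a \<in> tensor_kernel R M N \<Longrightarrow> Poly_Mapping.keys a \<subseteq> carrier M \<times> carrier N"
    and "a \<in> tensor_kernel R M N \<Longrightarrow> - a \<in> tensor_kernel R M N"
    and "a \<in> tensor_kernel R M N \<Longrightarrow> b \<in> tensor_kernel R M N \<Longrightarrow> a + b \<in> tensor_kernel R M N"
    and "a \<in> tensor_kernel R M N \<Longrightarrow> b \<in> tensor_kernel R M N \<Longrightarrow> a - b \<in> tensor_kernel R M N"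
proof -
  let ?K = "tensor_kernel R M N"
  note sg = tensor_kernel_subgroup[OF assms]
  show z: "0 \<in> ?K" using subgroup.one_closed[OF sg] by simp
  show "h \<in> tensor_relators R M N \<Longrightarrow> h \<in> ?K"
    unfolding tensor_kernel_def by (rule generate.incl)
  show keys: "Poly_Mapping.keys a \<subseteq> carrier M \<times> carrier N" if "a \<in> ?K" for a
    using subgroup.mem_carrier[OF sg that] by simp
  show neg: "- a \<in> ?K" if "a \<in> ?K" for a
    using subgroup.m_inv_closed[OF sg that] keys[OF that] by simp
  show add: "a + b \<in> ?K" if "a \<in> ?K" "b \<in> ?K" for a b
    using subgroup.m_closed[OF sg that] by simp
  show "a - b \<in> ?K" if "a \<in> ?K" "b \<in> ?K"
    using add[OF that(1) neg[OF that(2)]] by simp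
qed

lemma tensor_kernel_induct [consumes 3, case_names zero rel neg add]:
  assumes "module R M" "module R N" "k \<in> tensor_kernel R M N"
    and "P 0" "\<And>h. h \<in> tensor_relators R M N \<Longrightarrow> P h"
    and "\<And>h. h \<in> tensor_relators R M N \<Longrightarrow> P (- h)"
    and "\<And>a b. P a \<Longrightarrow> P b \<Longrightarrow> P (a + b)"
  shows "P k"
  using assms(3) unfolding tensor_kernel_def
proof (induction rule: generate.induct)
  case (inv h)
  then show ?case using assms(6)[OF inv] tensor_relators_keys[OF assms(1,2) inv] by simp
qed (use assms in auto)

lemma frag_map_left_simps [simp]:
  "frag_map_left f 0 = 0"
  "frag_map_left f (frag_of (x, t)) = frag_of (f x, t)"
  "frag_map_left f (a + b) = frag_map_left f a + frag_map_left f b"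
  "frag_map_left f (- a) = - frag_map_left f a"
  "frag_map_left f (a - b) = frag_map_left f a - frag_map_left f b"
  by (simp_all add: frag_map_left_def frag_extend_add frag_extend_minus frag_extend_diff)

lemma frag_map_left_comp: "frag_map_left g (frag_map_left f x) = frag_map_left (g \<circ> f) x"
  by (rule frag_induction[of x UNIV]) (auto simp: frag_map_left_def[symmetric])

lemma frag_map_left_cong:
  "(\<And>m t. (m, t) \<in> Poly_Mapping.keys x \<Longrightarrow> f m = g m) \<Longrightarrow> frag_map_left f x = frag_map_left g x"
  unfolding frag_map_left_def by (rule frag_extend_eq) auto

lemma frag_map_left_id:
  assumes "\<And>m t. (m, t) \<in> Poly_Mapping.keys x \<Longrightarrow> f m = m"
  shows "frag_map_left f x = x"
proof -
  have "frag_map_left f x = frag_extend frag_of x"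
    unfolding frag_map_left_def by (rule frag_extend_eq) (use assms in auto)
  then show ?thesis by (simp flip: frag_expansion)
qed

lemma keys_frag_map_left:
  "Poly_Mapping.keys (frag_map_left f x) \<subseteq> (\<lambda>(m, t). (f m, t)) ` Poly_Mapping.keys x"
  unfolding frag_map_left_def using keys_frag_extend[of "\<lambda>(m, t). frag_of (f m, t)" x] by force

lemma module_homsD:
  assumes "f \<in> module_homs R M N"
  shows "x \<in> carrier M \<Longrightarrow> f x \<in> carrier N"
    and "x \<in> carrier M \<Longrightarrow> y \<in> carrier M \<Longrightarrow> f (x \<oplus>\<^bsub>M\<^esub> y) = f x \<oplus>\<^bsub>N\<^esub> f y"
    and "a \<in> carrier R \<Longrightarrow> x \<in> carrier M \<Longrightarrow> f (a \<odot>\<^bsub>M\<^esub> x) = a \<odot>\<^bsub>N\<^esub> f x"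
  using assms unfolding module_homs_def by auto

lemma module_homs_comp:
  "f \<in> module_homs R M N \<Longrightarrow> g \<in> module_homs R N P \<Longrightarrow> g \<circ> f \<in> module_homs R M P"
  unfolding module_homs_def by (auto simp: Pi_iff)

lemma frag_map_left_kernel:
  assumes "module R M" "module R N" "module R T" "f \<in> module_homs R M N"
    and "k \<in> tensor_kernel R M T"
  shows "frag_map_left f k \<in> tensor_kernel R N T"
proof -
  have rel: "frag_map_left f h \<in> tensor_relators R N T" if "h \<in> tensor_relators R M T" for h
    using that
  proof (cases rule: tensor_relators_cases)
    case (add_left x x' y)
    then show ?thesis
      using tensor_relatorsI(1)[of "f x" N "f x'" y T R] by (simp add: module_homsD[OF assms(4)])
  next
    case (add_right x y y')
    then show ?thesis
      using tensor_relatorsI(2)[of "f x" N y T y' R] by (simp add: module_homsD[OF assms(4)])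
  next
    case (smult a x y)
    then show ?thesis
      using tensor_relatorsI(3)[of a R "f x" N y T] by (simp add: module_homsD[OF assms(4)])
  qed
  note cl = tensor_kernel_closed[OF assms(2,3)]
  show ?thesis using assms(1,3,5)
    by (induction rule: tensor_kernel_induct) (use rel cl in auto)
qed

lemma tensor_map_coset:
  assumes "module R M" "module R N" "module R T" "f \<in> module_homs R M N"
    and x: "Poly_Mapping.keys x \<subseteq> carrier M \<times> carrier T"
  shows "tensor_map R N T f
      (r_coset (free_Abelian_group (carrier M \<times> carrier T)) (tensor_kernel R M T) x) =
    r_coset (free_Abelian_group (carrier N \<times> carrier T)) (tensor_kernel R N T) (frag_map_left f x)"
proof -
  note clM = tensor_kernel_closed[OF assms(1,3)]
  note clN = tensor_kernel_closed[OF assms(2,3)]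
  have *: "frag_map_left f k \<in> tensor_kernel R N T" if "k \<in> tensor_kernel R M T" for k
    by (rule frag_map_left_kernel[OF assms(1-4) that])
  show ?thesis
    unfolding tensor_map_def r_coset_def
    apply (auto simp flip: add.assoc)
     apply (metis * clN(5))
    using clM(1) by force
qed

lemma tensor_map_inj_iff:
  assumes "module R M" "module R N" "module R T" "f \<in> module_homs R M N"
  shows "inj_on (tensor_map R N T f) (carrier (tensor_product R M T)) \<longleftrightarrow>
    (\<forall>x. Poly_Mapping.keys x \<subseteq> carrier M \<times> carrier T \<longrightarrow>
      frag_map_left f x \<in> tensor_kernel R N T \<longrightarrow> x \<in> tensor_kernel R M T)"
    (is "?L \<longleftrightarrow> ?R")
proof -
  let ?FM = "free_Abelian_group (carrier M \<times> carrier T)"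
  let ?FN = "free_Abelian_group (carrier N \<times> carrier T)"
  let ?KM = "tensor_kernel R M T" and ?KN = "tensor_kernel R N T"
  note clM = tensor_kernel_closed[OF assms(1,3)]
  note clN = tensor_kernel_closed[OF assms(2,3)]
  have eqM: "r_coset ?FM ?KM x = r_coset ?FM ?KM y \<longleftrightarrow> x - y \<in> ?KM" for x y
  proof
    assume "r_coset ?FM ?KM x = r_coset ?FM ?KM y"
    moreover have "x \<in> r_coset ?FM ?KM x" unfolding r_coset_def using clM(1) by force
    ultimately show "x - y \<in> ?KM" unfolding r_coset_def by auto
  next
    assume *: "x - y \<in> ?KM"
    have "\<exists>h\<in>?KM. k + x = h + y" if "k \<in> ?KM" for k
      using clM(5)[OF that *] by (intro bexI[of _ "k + (x - y)"]) auto
    moreover have "\<exists>h\<in>?KM. k + y = h + x" if "k \<in> ?KM" for k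
      using clM(6)[OF that *] by (intro bexI[of _ "k - (x - y)"]) auto
    ultimately show "r_coset ?FM ?KM x = r_coset ?FM ?KM y" unfolding r_coset_def by auto
  qed
  have eqN: "r_coset ?FN ?KN x = r_coset ?FN ?KN y \<longleftrightarrow> x - y \<in> ?KN" for x y
  proof
    assume "r_coset ?FN ?KN x = r_coset ?FN ?KN y"
    moreover have "x \<in> r_coset ?FN ?KN x" unfolding r_coset_def using clN(1) by force
    ultimately show "x - y \<in> ?KN" unfolding r_coset_def by auto
  next
    assume *: "x - y \<in> ?KN"
    have "\<exists>h\<in>?KN. k + x = h + y" if "k \<in> ?KN" for k
      using clN(5)[OF that *] by (intro bexI[of _ "k + (x - y)"]) auto
    moreover have "\<exists>h\<in>?KN. k + y = h + x" if "k \<in> ?KN" for k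
      using clN(6)[OF that *] by (intro bexI[of _ "k - (x - y)"]) auto
    ultimately show "r_coset ?FN ?KN x = r_coset ?FN ?KN y" unfolding r_coset_def by auto
  qed
  note tm = tensor_map_coset[OF assms]
  have car: "carrier (tensor_product R M T) =
      r_coset ?FM ?KM ` {x. Poly_Mapping.keys x \<subseteq> carrier M \<times> carrier T}"
    unfolding tensor_product_def FactGroup_def RCOSETS_def by auto
  show ?thesis
  proof
    assume L: ?L
    show ?R
    proof (intro allI impI)
      fix x assume x: "Poly_Mapping.keys x \<subseteq> carrier M \<times> carrier T"
        and fx: "frag_map_left f x \<in> ?KN"
      have "tensor_map R N T f (r_coset ?FM ?KM x) = tensor_map R N T f (r_coset ?FM ?KM 0)"
        using fx by (simp add: tm x eqN)
      then have "r_coset ?FM ?KM x = r_coset ?FM ?KM 0"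
        using L x by (auto simp: car inj_on_def)
      then show "x \<in> ?KM" by (simp add: eqM)
    qed
  next
    assume R: ?R
    show ?L unfolding car
    proof (rule inj_onI, clarify)
      fix x y assume x: "Poly_Mapping.keys x \<subseteq> carrier M \<times> carrier T"
        and y: "Poly_Mapping.keys y \<subseteq> carrier M \<times> carrier T"
        and eq: "tensor_map R N T f (r_coset ?FM ?KM x) = tensor_map R N T f (r_coset ?FM ?KM y)"
      have "frag_map_left f (x - y) \<in> ?KN"
        using eq by (simp add: tm x y eqN)
      moreover have "Poly_Mapping.keys (x - y) \<subseteq> carrier M \<times> carrier T"
        using x y keys_diff[of x y] by blast
      ultimately show "r_coset ?FM ?KM x = r_coset ?FM ?KM y"
        using R by (auto simp: eqM)
    qed
  qed
qed

lemma tensor_kernel_finite_support: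
  assumes N: "module R N" and T: "module R T" and k: "k \<in> tensor_kernel R N T"
  shows "\<exists>A. finite A \<and> A \<subseteq> carrier N \<and>
    (\<forall>H. submodule H R N \<longrightarrow> A \<subseteq> H \<longrightarrow> k \<in> tensor_kernel R (N\<lparr>carrier := H\<rparr>) T)"
  using N T k
proof (induction rule: tensor_kernel_induct)
  case zero
  show ?case
    using tensor_kernel_closed(1)[OF submodule.submodule_is_module[OF _ N] T] by blast
next
  have support: "\<exists>A. finite A \<and> A \<subseteq> carrier N \<and>
      (\<forall>H. submodule H R N \<longrightarrow> A \<subseteq> H \<longrightarrow> h \<in> tensor_relators R (N\<lparr>carrier := H\<rparr>) T)"
    if "h \<in> tensor_relators R N T" for h
  proof -
    let ?N = "\<lambda>H. N\<lparr>carrier := H\<rparr>"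
    from that show ?thesis
    proof (cases rule: tensor_relators_cases)
      case (add_left x x' y)
      then show ?thesis
        using tensor_relatorsI(1)[of x "?N _" x' y T R] by (intro exI[of _ "{x, x'}"]) simp
    next
      case (add_right x y y')
      then show ?thesis
        using tensor_relatorsI(2)[of x "?N _" y T y' R] by (intro exI[of _ "{x}"]) simp
    next
      case (smult a x y)
      then show ?thesis
        using tensor_relatorsI(3)[of a R x "?N _" y T] by (intro exI[of _ "{x}"]) simp
    qed
  qed
  {
    case (rel h)
    then show ?case
      using support[OF rel]
        tensor_kernel_closed(2)[OF submodule.submodule_is_module[OF _ N] T] by meson
  next
    case (neg h)
    then show ?case
      using support[OF neg]
        tensor_kernel_closed(2,4)[OF submodule.submodule_is_module[OF _ N] T] by meson
  }
next
  case (add a b)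
  then obtain A B where A: "finite A" "A \<subseteq> carrier N"
      "\<And>H. submodule H R N \<Longrightarrow> A \<subseteq> H \<Longrightarrow> a \<in> tensor_kernel R (N\<lparr>carrier := H\<rparr>) T"
    and B: "finite B" "B \<subseteq> carrier N"
      "\<And>H. submodule H R N \<Longrightarrow> B \<subseteq> H \<Longrightarrow> b \<in> tensor_kernel R (N\<lparr>carrier := H\<rparr>) T"
    by blast
  show ?case
    using A B tensor_kernel_closed(5)[OF submodule.submodule_is_module[OF _ N] T]
    by (intro exI[of _ "A \<union> B"]) auto
qed

lemma finite_submodule_encoding:
  fixes R :: "('r, 'c) ring_scheme" and N :: "('r, 'n, 'd) module_scheme"
  assumes N: "module R N" and "finite A" "A \<subseteq> carrier N"
  shows "\<exists>H. submodule H R N \<and> A \<subseteq> H \<and> (\<exists>e :: 'n \<Rightarrow> 'r list. inj_on e H)"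
  using assms(2,3)
proof (induction rule: finite_induct)
  case empty
  interpret module R N by fact
  have "submodule {\<zero>\<^bsub>N\<^esub>} R N" by (rule submoduleI) auto
  then show ?case by (intro exI[of _ "{\<zero>\<^bsub>N\<^esub>}"]) auto
next
  case (insert a A)
  interpret module R N by fact
  from insert obtain H and e :: "'n \<Rightarrow> 'r list"
    where H: "submodule H R N" "A \<subseteq> H" "inj_on e H" and a: "a \<in> carrier N" by auto
  note HE = submoduleE[OF H(1)]
  have Hc: "x \<in> H \<Longrightarrow> x \<in> carrier N" for x using HE(1) by auto
  have H0: "\<zero>\<^bsub>N\<^esub> \<in> H"
    using submodule.axioms(1)[OF H(1)] subgroup.one_closed by fastforce
  define H' where "H' = {r \<odot>\<^bsub>N\<^esub> a \<oplus>\<^bsub>N\<^esub> n |r n. r \<in> carrier R \<and> n \<in> H}"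
  have "submodule H' R N"
  proof (rule submoduleI)
    show "H' \<subseteq> carrier N" unfolding H'_def using a Hc by auto
    show "\<zero>\<^bsub>N\<^esub> \<in> H'"
      unfolding H'_def using a H0 by (auto intro!: exI[of _ "\<zero>\<^bsub>R\<^esub>"] exI[of _ "\<zero>\<^bsub>N\<^esub>"])
    show sm: "r \<odot>\<^bsub>N\<^esub> x \<in> H'" if "r \<in> carrier R" "x \<in> H'" for r x
    proof -
      from that obtain s n where s: "s \<in> carrier R" "n \<in> H" "x = s \<odot>\<^bsub>N\<^esub> a \<oplus>\<^bsub>N\<^esub> n"
        unfolding H'_def by auto
      have "r \<odot>\<^bsub>N\<^esub> x = (r \<otimes>\<^bsub>R\<^esub> s) \<odot>\<^bsub>N\<^esub> a \<oplus>\<^bsub>N\<^esub> r \<odot>\<^bsub>N\<^esub> n"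
        using s that a Hc by (simp add: smult_r_distr smult_assoc1)
      then show ?thesis unfolding H'_def using s that HE(4) by blast
    qed
    show "\<ominus>\<^bsub>N\<^esub> x \<in> H'" if "x \<in> H'" for x
    proof -
      have "x \<in> carrier N" using that a Hc unfolding H'_def by auto
      then have "\<ominus>\<^bsub>N\<^esub> x = (\<ominus>\<^bsub>R\<^esub> \<one>\<^bsub>R\<^esub>) \<odot>\<^bsub>N\<^esub> x" by (simp add: smult_l_minus)
      then show ?thesis using sm[OF _ that] by simp
    qed
    show "x \<oplus>\<^bsub>N\<^esub> y \<in> H'" if "x \<in> H'" "y \<in> H'" for x y
    proof -
      from that obtain s n s' n' where s: "s \<in> carrier R" "n \<in> H" "x = s \<odot>\<^bsub>N\<^esub> a \<oplus>\<^bsub>N\<^esub> n"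
        and s': "s' \<in> carrier R" "n' \<in> H" "y = s' \<odot>\<^bsub>N\<^esub> a \<oplus>\<^bsub>N\<^esub> n'"
        unfolding H'_def by auto
      have "x \<oplus>\<^bsub>N\<^esub> y = (s \<oplus>\<^bsub>R\<^esub> s') \<odot>\<^bsub>N\<^esub> a \<oplus>\<^bsub>N\<^esub> (n \<oplus>\<^bsub>N\<^esub> n')"
        using s s' a Hc by (simp add: smult_l_distr M.a_ac)
      then show ?thesis unfolding H'_def using s s' HE(5) by blast
    qed
  qed
  moreover have "insert a A \<subseteq> H'"
  proof -
    have "a = \<one>\<^bsub>R\<^esub> \<odot>\<^bsub>N\<^esub> a \<oplus>\<^bsub>N\<^esub> \<zero>\<^bsub>N\<^esub>" using a by simp
    then have "a \<in> H'" unfolding H'_def using H0 by blast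
    moreover have "x \<in> H'" if "x \<in> A" for x
    proof -
      have "x \<in> H" using that H(2) by auto
      moreover from this have "x = \<zero>\<^bsub>R\<^esub> \<odot>\<^bsub>N\<^esub> a \<oplus>\<^bsub>N\<^esub> x" using a Hc by simp
      ultimately show ?thesis unfolding H'_def by blast
    qed
    ultimately show ?thesis by auto
  qed
  moreover have "\<exists>e :: 'n \<Rightarrow> 'r list. inj_on e H'"
  proof -
    have "\<forall>x. \<exists>p. x \<in> H' \<longrightarrow> fst p \<in> carrier R \<and> snd p \<in> H \<and> x = fst p \<odot>\<^bsub>N\<^esub> a \<oplus>\<^bsub>N\<^esub> snd p"
      unfolding H'_def by auto
    then obtain p where p: "\<And>x. x \<in> H' \<Longrightarrow>
        fst (p x) \<in> carrier R \<and> snd (p x) \<in> H \<and> x = fst (p x) \<odot>\<^bsub>N\<^esub> a \<oplus>\<^bsub>N\<^esub> snd (p x)"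
      by metis
    have "inj_on (\<lambda>x. fst (p x) # e (snd (p x))) H'"
    proof (rule inj_onI)
      fix x y assume "x \<in> H'" "y \<in> H'" "fst (p x) # e (snd (p x)) = fst (p y) # e (snd (p y))"
      then show "x = y" using p[of x] p[of y] inj_onD[OF H(3), of "snd (p x)" "snd (p y)"] by auto
    qed
    then show ?thesis by blast
  qed
  ultimately show ?case by blast
qed

definition image_module :: "('m \<Rightarrow> 'n) \<Rightarrow> ('r, 'm, 'd) module_scheme \<Rightarrow> ('r, 'n) module"
  where "image_module e M =
    (let d = inv_into (carrier M) e in
      \<lparr>carrier = e ` carrier M, monoid.mult = undefined, one = undefined,
       ring.zero = e \<zero>\<^bsub>M\<^esub>, add = (\<lambda>u v. e (d u \<oplus>\<^bsub>M\<^esub> d v)), smult = (\<lambda>a u. e (a \<odot>\<^bsub>M\<^esub> d u))\<rparr>)"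

lemma image_module:
  assumes M: "module R M" and e: "inj_on e (carrier M)"
  shows "module R (image_module e M)"
    and "e \<in> module_homs R M (image_module e M)"
    and "inv_into (carrier M) e \<in> module_homs R (image_module e M) M"
proof -
  interpret module R M by fact
  have d: "inv_into (carrier M) e (e x) = x" if "x \<in> carrier M" for x
    using that e by simp
  show "module R (image_module e M)"
  proof (rule moduleI)
    show "cring R" by (rule R.is_cring)
    show "abelian_group (image_module e M)"
    proof (rule abelian_groupI)
      fix u assume "u \<in> carrier (image_module e M)"
      then obtain x where "x \<in> carrier M" "u = e x" by (auto simp: image_module_def Let_def)
      then show "\<exists>v\<in>carrier (image_module e M).
          v \<oplus>\<^bsub>image_module e M\<^esub> u = \<zero>\<^bsub>image_module e M\<^esub>"
        by (intro bexI[of _ "e (\<ominus>\<^bsub>M\<^esub> x)"]) (auto simp: image_module_def Let_def d M.l_neg)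
    qed (auto simp: image_module_def Let_def d M.a_ac)
  qed (auto simp: image_module_def Let_def d smult_l_distr smult_r_distr smult_assoc1)
  show "e \<in> module_homs R M (image_module e M)"
    "inv_into (carrier M) e \<in> module_homs R (image_module e M) M"
    by (auto simp: module_homs_def image_module_def Let_def d)
qed

theorem flat_module_inj:
  fixes M :: "('r, 'm, 'd) module_scheme" and N :: "('r, 'n, 'e) module_scheme"
  assumes flat: "flat_module R T" and M: "module R M" and N: "module R N"
    and f: "f \<in> module_homs R M N" and inj: "inj_on f (carrier M)"
  shows "inj_on (tensor_map R N T f) (carrier (tensor_product R M T))"
proof -
  have T: "module R T" using flat unfolding flat_module_def by simp
  interpret M: module R M by fact
  interpret N: module R N by fact
  show ?thesis
    unfolding tensor_map_inj_iff[OF M N T f]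
  proof (intro allI impI)
    fix x assume x: "Poly_Mapping.keys x \<subseteq> carrier M \<times> carrier T"
      and fx: "frag_map_left f x \<in> tensor_kernel R N T"
    obtain A where A: "finite A" "A \<subseteq> carrier N"
        "\<And>H. submodule H R N \<Longrightarrow> A \<subseteq> H \<Longrightarrow> frag_map_left f x \<in> tensor_kernel R (N\<lparr>carrier := H\<rparr>) T"
      using tensor_kernel_finite_support[OF N T fx] by blast
    define B where "B = A \<union> f ` fst ` Poly_Mapping.keys x"
    have "finite B" "B \<subseteq> carrier N"
      using A x module_homsD(1)[OF f] unfolding B_def by (auto simp: subset_iff)
    then obtain H and e :: "'n \<Rightarrow> 'r list"
      where H: "submodule H R N" "B \<subseteq> H" "inj_on e H"
      using finite_submodule_encoding[OF N] by blast
    note HE = N.submoduleE[OF H(1)]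
    define G where "G = H \<inter> f ` carrier M"
    have fneg: "\<ominus>\<^bsub>N\<^esub> f m = f (\<ominus>\<^bsub>M\<^esub> m)" if "m \<in> carrier M" for m
    proof -
      have "\<ominus>\<^bsub>N\<^esub> f m = (\<ominus>\<^bsub>R\<^esub> \<one>\<^bsub>R\<^esub>) \<odot>\<^bsub>N\<^esub> f m"
        using that module_homsD(1)[OF f] by (simp add: N.smult_l_minus)
      also have "\<dots> = f ((\<ominus>\<^bsub>R\<^esub> \<one>\<^bsub>R\<^esub>) \<odot>\<^bsub>M\<^esub> m)"
        using that module_homsD(3)[OF f] by simp
      finally show ?thesis using that by (simp add: M.smult_l_minus)
    qed
    have G: "submodule G R N"
    proof (rule N.submoduleI)
      show "G \<subseteq> carrier N" using HE(1) unfolding G_def by auto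
      show neg: "\<ominus>\<^bsub>N\<^esub> a \<in> G" if "a \<in> G" for a
        using that HE(3) fneg unfolding G_def by auto
      show add: "a \<oplus>\<^bsub>N\<^esub> b \<in> G" if "a \<in> G" "b \<in> G" for a b
        using that HE(5) unfolding G_def by (auto simp flip: module_homsD(2)[OF f])
      show sm: "r \<odot>\<^bsub>N\<^esub> a \<in> G" if "r \<in> carrier R" "a \<in> G" for r a
        using that HE(4) unfolding G_def by (auto simp flip: module_homsD(3)[OF f])
      have z: "\<zero>\<^bsub>N\<^esub> = f \<zero>\<^bsub>M\<^esub>"
        using module_homsD(3)[OF f, of "\<zero>\<^bsub>R\<^esub>" "\<zero>\<^bsub>M\<^esub>"] module_homsD(1)[OF f] by simp
      have "\<zero>\<^bsub>N\<^esub> \<in> H" using submodule.axioms(1)[OF H(1)] subgroup.one_closed by fastforce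
      then show "\<zero>\<^bsub>N\<^esub> \<in> G" unfolding G_def using z by blast
    qed
    let ?P = "N\<lparr>carrier := H\<rparr>" and ?Q = "N\<lparr>carrier := G\<rparr>"
    have P: "module R ?P" and Q: "module R ?Q"
      using submodule.submodule_is_module[OF H(1) N] submodule.submodule_is_module[OF G N] by auto
    have eP: "inj_on e (carrier ?P)" and eQ: "inj_on e (carrier ?Q)"
      using H(3) by (auto simp: G_def intro: inj_on_subset)
    let ?P' = "image_module e ?P" and ?Q' = "image_module e ?Q"
    note P' = image_module[OF P eP] and Q' = image_module[OF Q eQ]
    define d where "d = inv_into (carrier ?Q) e"
    have d: "d (e n) = n" if "n \<in> G" for n
      unfolding d_def using eQ that by simp
    have incl: "id \<in> module_homs R ?Q ?P" by (auto simp: module_homs_def G_def)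
    have j: "e \<circ> (id \<circ> d) \<in> module_homs R ?Q' ?P'"
      unfolding d_def by (intro module_homs_comp[OF _ P'(2)] module_homs_comp[OF _ incl] Q'(3))
    have carQ': "carrier ?Q' = e ` G" by (simp add: image_module_def Let_def)
    have "inj_on (e \<circ> (id \<circ> d)) (carrier ?Q')"
      unfolding carQ' by (rule inj_onI) (auto simp: d)
    then have "inj_on (tensor_map R ?P' T (e \<circ> (id \<circ> d))) (carrier (tensor_product R ?Q' T))"
      using flat P'(1) Q'(1) j unfolding flat_module_def by blast
    then have ker: "z \<in> tensor_kernel R ?Q' T"
      if "Poly_Mapping.keys z \<subseteq> carrier ?Q' \<times> carrier T"
        "frag_map_left (e \<circ> (id \<circ> d)) z \<in> tensor_kernel R ?P' T" for z
      unfolding tensor_map_inj_iff[OF Q'(1) P'(1) T j] using that by blast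
    have fG: "f m \<in> G" if "(m, t) \<in> Poly_Mapping.keys x" for m t
      using that H(2) x unfolding G_def B_def by force
    define z where "z = frag_map_left (e \<circ> f) x"
    have "Poly_Mapping.keys z \<subseteq> carrier ?Q' \<times> carrier T"
      using keys_frag_map_left[of "e \<circ> f" x] fG x unfolding z_def carQ' by fastforce
    moreover have "frag_map_left (e \<circ> (id \<circ> d)) z = frag_map_left e (frag_map_left f x)"
      unfolding z_def frag_map_left_comp by (rule frag_map_left_cong) (simp add: d fG)
    moreover have "frag_map_left e (frag_map_left f x) \<in> tensor_kernel R ?P' T"
      using H(2) by (intro frag_map_left_kernel[OF P P'(1) T P'(2)] A(3) H(1)) (auto simp: B_def)
    ultimately have z: "z \<in> tensor_kernel R ?Q' T" using ker by simp
    define g where "g = inv_into (carrier M) f"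
    have g: "g (f m) = m" if "m \<in> carrier M" for m unfolding g_def using inj that by simp
    have "g \<in> module_homs R ?Q M"
      unfolding module_homs_def
      by (auto simp: G_def g simp flip: module_homsD(2,3)[OF f])
    then have "g \<circ> d \<in> module_homs R ?Q' M"
      unfolding d_def by (rule module_homs_comp[OF Q'(3)])
    then have "frag_map_left (g \<circ> d) z \<in> tensor_kernel R M T"
      using frag_map_left_kernel[OF Q'(1) M T _ z] by blast
    moreover have "frag_map_left (g \<circ> d) z = x"
      unfolding z_def frag_map_left_comp
    proof (rule frag_map_left_id)
      fix m t assume "(m, t) \<in> Poly_Mapping.keys x"
      then show "((g \<circ> d) \<circ> (e \<circ> f)) m = m" using x by (auto simp: d[OF fG] g)
    qed
    ultimately show "x \<in> tensor_kernel R M T" by simp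
  qed
qed

theorem epi_ext_eq:
  fixes S :: "('a, 'b) ring_scheme" and C :: "('c, 'd) ring_scheme"
  assumes "cring S" and epi: "epi_ext R S" and C: "cring C"
    and f: "f \<in> ring_hom S C" and g: "g \<in> ring_hom S C"
    and eq: "\<And>x. x \<in> R \<Longrightarrow> f x = g x" and x: "x \<in> carrier S"
  shows "f x = g x"
proof -
  interpret S: cring S by fact
  interpret C: cring C by fact
  have fc: "f a \<in> carrier C" "g a \<in> carrier C" if "a \<in> carrier S" for a
    using f g that by (auto intro: ring_hom_closed)
  define L where "L = lists (carrier S \<times> carrier S)"
  define h where "h = (\<lambda>us. foldr (\<lambda>(a, b) c. f a \<otimes>\<^bsub>C\<^esub> g b \<oplus>\<^bsub>C\<^esub> c) us \<zero>\<^bsub>C\<^esub>)"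
  have h_simps: "h [] = \<zero>\<^bsub>C\<^esub>" "h ((a, b) # us) = f a \<otimes>\<^bsub>C\<^esub> g b \<oplus>\<^bsub>C\<^esub> h us" for a b us
    by (auto simp: h_def)
  have hc: "h us \<in> carrier C" if "us \<in> L" for us
    using that unfolding L_def by (induction us rule: lists.induct) (auto simp: h_simps fc)
  define A where "A = h ` L"
  have A0: "\<zero>\<^bsub>C\<^esub> \<in> A" unfolding A_def L_def by (rule image_eqI[of _ _ "[]"]) (auto simp: h_simps)
  have Aone: "f a \<otimes>\<^bsub>C\<^esub> g b \<in> A" if "a \<in> carrier S" "b \<in> carrier S" for a b
    unfolding A_def L_def using that
    by (intro image_eqI[of _ _ "[(a, b)]"]) (auto simp: h_simps fc)
  have Aadd: "u \<oplus>\<^bsub>C\<^esub> v \<in> A" if "u \<in> A" "v \<in> A" for u v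
  proof -
    have "h us \<oplus>\<^bsub>C\<^esub> v \<in> A" if "us \<in> L" for us
      using that unfolding L_def
    proof (induction us rule: lists.induct)
      case Nil
      then show ?case using \<open>v \<in> A\<close> hc by (auto simp: h_simps A_def)
    next
      case (Cons p us)
      obtain a b where p: "p = (a, b)" "a \<in> carrier S" "b \<in> carrier S" using Cons by auto
      obtain ws where ws: "ws \<in> L" "h us \<oplus>\<^bsub>C\<^esub> v = h ws" using Cons by (auto simp: A_def)
      have us: "h us \<in> carrier C" using Cons hc by (simp add: L_def)
      have v: "v \<in> carrier C" using \<open>v \<in> A\<close> hc by (auto simp: A_def)
      have "h (p # us) \<oplus>\<^bsub>C\<^esub> v = f a \<otimes>\<^bsub>C\<^esub> g b \<oplus>\<^bsub>C\<^esub> (h us \<oplus>\<^bsub>C\<^esub> v)"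
        using p us v fc by (simp add: h_simps C.a_assoc)
      also have "\<dots> = h (p # ws)" by (simp add: p(1) h_simps ws(2))
      finally have "h (p # us) \<oplus>\<^bsub>C\<^esub> v = h (p # ws)" .
      moreover have "p # ws \<in> L" using p ws by (auto simp: L_def)
      ultimately show ?case by (auto simp: A_def)
    qed
    then show ?thesis using that by (auto simp: A_def)
  qed
  have Ac: "u \<in> carrier C" if "u \<in> A" for u using that hc by (auto simp: A_def)
  have Amul1: "f a \<otimes>\<^bsub>C\<^esub> g b \<otimes>\<^bsub>C\<^esub> u \<in> A" if "u \<in> A" and ab: "a \<in> carrier S" "b \<in> carrier S" for u a b
  proof -
    have "f a \<otimes>\<^bsub>C\<^esub> g b \<otimes>\<^bsub>C\<^esub> h us \<in> A" if "us \<in> L" for us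
      using that unfolding L_def
    proof (induction us rule: lists.induct)
      case Nil
      then show ?case using A0 ab fc by (simp add: h_simps)
    next
      case (Cons p us)
      obtain a' b' where p: "p = (a', b')" "a' \<in> carrier S" "b' \<in> carrier S" using Cons by auto
      have us: "h us \<in> carrier C" using Cons hc by (simp add: L_def)
      have "f a \<otimes>\<^bsub>C\<^esub> g b \<otimes>\<^bsub>C\<^esub> h (p # us) =
          f (a \<otimes>\<^bsub>S\<^esub> a') \<otimes>\<^bsub>C\<^esub> g (b \<otimes>\<^bsub>S\<^esub> b') \<oplus>\<^bsub>C\<^esub> f a \<otimes>\<^bsub>C\<^esub> g b \<otimes>\<^bsub>C\<^esub> h us"
        using p ab fc us ring_hom_mult[OF f] ring_hom_mult[OF g]
        by (simp add: h_simps C.r_distr C.m_ac)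
      then show ?case using Aadd[OF Aone Cons.IH] p ab by simp
    qed
    then show ?thesis using that by (auto simp: A_def)
  qed
  have sub: "subring A C"
  proof (rule C.subringI)
    show "A \<subseteq> carrier C" using Ac by auto
    show "\<one>\<^bsub>C\<^esub> \<in> A" using Aone[of "\<one>\<^bsub>S\<^esub>" "\<one>\<^bsub>S\<^esub>"] ring_hom_one[OF f] ring_hom_one[OF g] by simp
    show "u \<oplus>\<^bsub>C\<^esub> v \<in> A" if "u \<in> A" "v \<in> A" for u v by (rule Aadd[OF that])
    show mul: "u \<otimes>\<^bsub>C\<^esub> v \<in> A" if "u \<in> A" "v \<in> A" for u v
    proof -
      have "h us \<otimes>\<^bsub>C\<^esub> v \<in> A" if "us \<in> L" for us
        using that unfolding L_def
      proof (induction us rule: lists.induct)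
        case Nil
        then show ?case using A0 \<open>v \<in> A\<close> Ac by (simp add: h_simps)
      next
        case (Cons p us)
        obtain a b where p: "p = (a, b)" "a \<in> carrier S" "b \<in> carrier S" using Cons by auto
        have us: "h us \<in> carrier C" using Cons hc by (simp add: L_def)
        have "h (p # us) \<otimes>\<^bsub>C\<^esub> v = f a \<otimes>\<^bsub>C\<^esub> g b \<otimes>\<^bsub>C\<^esub> v \<oplus>\<^bsub>C\<^esub> h us \<otimes>\<^bsub>C\<^esub> v"
          using p fc us Ac[OF \<open>v \<in> A\<close>] by (simp add: h_simps C.l_distr)
        then show ?case using Aadd[OF Amul1[OF \<open>v \<in> A\<close>] Cons.IH] p by simp
      qed
      then show ?thesis using that by (auto simp: A_def)
    qed
    show "\<ominus>\<^bsub>C\<^esub> u \<in> A" if "u \<in> A" for u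
    proof -
      interpret F: ring_hom_cring S C f by unfold_locales (rule f)
      have "f (\<ominus>\<^bsub>S\<^esub> \<one>\<^bsub>S\<^esub>) \<otimes>\<^bsub>C\<^esub> g \<one>\<^bsub>S\<^esub> \<otimes>\<^bsub>C\<^esub> u = \<ominus>\<^bsub>C\<^esub> u"
        using Ac[OF that] ring_hom_one[OF g] by (simp add: C.l_minus)
      then show ?thesis using Amul1[OF that, of "\<ominus>\<^bsub>S\<^esub> \<one>\<^bsub>S\<^esub>" "\<one>\<^bsub>S\<^esub>"] by simp
    qed
  qed
  let ?B = "C\<lparr>carrier := A\<rparr>"
  have B: "cring ?B"
    using C.subcring_iff[of A] C.subcringI'[OF sub] Ac by auto
  define e where "e = inv_into L h"
  have e: "inj_on e (carrier ?B)"
    unfolding e_def A_def by (simp add: inj_on_inv_into)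
  let ?D = "image_ring e ?B"
  have iso: "e \<in> ring_iso ?B ?D" by (rule inj_imp_image_ring_iso[OF e])
  have D: "cring ?D"
    using cring.ring_iso_imp_img_cring[OF B iso]
    by (simp add: image_ring_def image_group_def monoid.defs)
  have fA: "f a \<in> A" "g a \<in> A" if "a \<in> carrier S" for a
    using Aone[of a "\<one>\<^bsub>S\<^esub>"] Aone[of "\<one>\<^bsub>S\<^esub>" a] that fc ring_hom_one[OF f] ring_hom_one[OF g] by auto
  have f': "f \<in> ring_hom S ?B" and g': "g \<in> ring_hom S ?B"
    using f g fA by (auto simp: ring_hom_def)
  have eh: "e \<in> ring_hom ?B ?D" using iso by (simp add: ring_iso_def)
  have "\<forall>y \<in> R. (e \<circ> f) y = (e \<circ> g) y" using eq by simp
  then have "(e \<circ> f) x = (e \<circ> g) x"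
    using epi[unfolded epi_ext_def, rule_format, OF D ring_hom_trans[OF f' eh] ring_hom_trans[OF g' eh] _ x]
    by blast
  then show ?thesis using inj_onD[OF e] fA[OF x] by simp
qed

end

theory Submission
  imports Defs
begin

text \<open>
  \<^emph>\<open>Least element.\<close> By FCP there is a minimal \<open>T\<close> with \<open>T \<subseteq> S\<close> integral, so it suffices that
  integrality of \<open>U \<subseteq> S\<close> and \<open>V \<subseteq> S\<close> implies that of \<open>W = U \<inter> V \<subseteq> S\<close>. For \<open>x \<in> U\<close> the descending
  chains \<open>T + x\<^sup>n T[t]\<close> become stationary; with Nakayama's lemma this yields \<open>x\<^sup>N (1 - x q) S \<subseteq> U\<close> for
  some \<open>N\<close> and \<open>q\<close>. Hence modulo the conductor of \<open>W\<close> in \<open>S\<close> some power of each \<open>x \<in> W\<close> has a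
  quasi-inverse, and this quasi-inverse, being integral over \<open>U\<close> and over \<open>V\<close>, lies in \<open>W\<close>. So
  modulo its conductor \<open>W\<close> is zero-dimensional. The chain \<open>W + t\<^sup>n W[t]\<close> shows that every \<open>t \<in> S\<close> is
  a root of a polynomial over \<open>W\<close> with a unit coefficient, and over a zero-dimensional ring this
  forces \<open>t\<close> to be integral.

  \<^emph>\<open>Pruefer hull.\<close> If \<open>R \<subseteq> T\<close> is Pruefer, \<open>R \<subseteq> U\<close> and \<open>t \<in> T\<close> is integral over \<open>U\<close>, then \<open>U \<subseteq> U[t]\<close> is
  a finite epimorphism, hence an equality. This gives \<open>T \<subseteq> U\<close> whenever \<open>U \<subseteq> S\<close> is integral, and for
  \<open>U = R\<close> that \<open>R\<close> is integrally closed in \<open>T\<close>. Conversely, under FCP, if \<open>R\<close> is integrally closed in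
  \<open>T\<close>, the denominators \<open>(R : t)\<close> of each \<open>t \<in> T\<close> generate the unit ideal of \<open>R[t]\<close>, and so \<open>R \<subseteq> T\<close> is
  Pruefer. Being integrally closed passes from \<open>R \<subseteq> T\<close> and \<open>R \<subseteq> T'\<close> to their compositum, which
  together with FCP provides the greatest Pruefer subextension.
\<close>

section \<open>Elements of bounded degree in a simple extension\<close>

context cring
begin

lemma subring_mem: "subring K R \<Longrightarrow> a \<in> K \<Longrightarrow> a \<in> carrier R"
  using subringE(1) by auto

lemma subring_Int:
  assumes "subring U R" "subring V R"
  shows "subring (U \<inter> V) R"
  using subringE[OF assms(1)] subringE[OF assms(2)] by (intro subringI) auto

text \<open>The \<open>K\<close>-module generated by \<open>1, t, ..., t^(m-1)\<close>: lists of
  length \<open>m\<close> give degrees less than \<open>m\<close>, so \<open>m = 0\<close> yields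
  the zero module.\<close>

definition poly_span :: "'a set \<Rightarrow> 'a \<Rightarrow> nat \<Rightarrow> 'a set"
  where "poly_span K t m = {eval p t |p. set p \<subseteq> K \<and> length p = m}"

lemma poly_span_0 [simp]: "poly_span K t 0 = {\<zero>}"
  by (auto simp: poly_span_def)

lemma poly_span_Suc:
  "poly_span K t (Suc m) = {a \<otimes> t [^] m \<oplus> n |a n. a \<in> K \<and> n \<in> poly_span K t m}"
proof -
  have "\<exists>a n. eval p t = a \<otimes> t [^] m \<oplus> n \<and> a \<in> K \<and> n \<in> poly_span K t m"
    if "set p \<subseteq> K" "length p = Suc m" for p
    using that by (cases p) (auto simp: poly_span_def)
  moreover have "\<exists>q. a \<otimes> t [^] m \<oplus> eval p t = eval q t \<and> set q \<subseteq> K \<and> length q = Suc m"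
    if "a \<in> K" "set p \<subseteq> K" "length p = m" for a p
    using that by (intro exI[of _ "a # p"]) auto
  ultimately show ?thesis unfolding poly_span_def by (safe; blast)
qed

lemma poly_span_SucI: "a \<in> K \<Longrightarrow> n \<in> poly_span K t m \<Longrightarrow> a \<otimes> t [^] m \<oplus> n \<in> poly_span K t (Suc m)"
  by (auto simp: poly_span_Suc)

lemma poly_span_SucE:
  assumes "y \<in> poly_span K t (Suc m)"
  obtains a n where "a \<in> K" "n \<in> poly_span K t m" "y = a \<otimes> t [^] m \<oplus> n"
  using assms by (auto simp: poly_span_Suc)

context
  fixes K t assumes K: "subring K R" and t: "t \<in> carrier R"
begin

lemma poly_span_carrier: "y \<in> poly_span K t m \<Longrightarrow> y \<in> carrier R"
  using subringE(1)[OF K] t by (auto simp: poly_span_def intro!: eval_in_carrier)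

lemma poly_span_zero: "\<zero> \<in> poly_span K t m"
proof (induction m)
  case (Suc m)
  have "\<zero> = \<zero> \<otimes> t [^] m \<oplus> \<zero>" using t by simp
  then show ?case using poly_span_SucI Suc subringE(2)[OF K] by metis
qed simp

lemma poly_span_add:
  "y \<in> poly_span K t m \<Longrightarrow> z \<in> poly_span K t m \<Longrightarrow> y \<oplus> z \<in> poly_span K t m"
proof (induction m arbitrary: y z)
  case (Suc m)
  obtain a n b k where y: "a \<in> K" "n \<in> poly_span K t m" "y = a \<otimes> t [^] m \<oplus> n"
    and z: "b \<in> K" "k \<in> poly_span K t m" "z = b \<otimes> t [^] m \<oplus> k"
    using Suc.prems by (auto elim!: poly_span_SucE)
  have "a \<in> carrier R" "b \<in> carrier R" "n \<in> carrier R" "k \<in> carrier R" "t [^] m \<in> carrier R"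
    using y z t poly_span_carrier subring_mem[OF K] by auto
  then have "y \<oplus> z = (a \<oplus> b) \<otimes> t [^] m \<oplus> (n \<oplus> k)" unfolding y z by algebra
  then show ?case using poly_span_SucI Suc.IH y z subringE(7)[OF K] by metis
qed simp

lemma poly_span_smult:
  "c \<in> K \<Longrightarrow> y \<in> poly_span K t m \<Longrightarrow> c \<otimes> y \<in> poly_span K t m"
proof (induction m arbitrary: y)
  case (Suc m)
  obtain a n where y: "a \<in> K" "n \<in> poly_span K t m" "y = a \<otimes> t [^] m \<oplus> n"
    using Suc.prems by (auto elim!: poly_span_SucE)
  have "a \<in> carrier R" "c \<in> carrier R" "n \<in> carrier R" "t [^] m \<in> carrier R"
    using y Suc.prems t poly_span_carrier subring_mem[OF K] by auto
  then have "c \<otimes> y = (c \<otimes> a) \<otimes> t [^] m \<oplus> (c \<otimes> n)" unfolding y by algebra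
  then show ?case using poly_span_SucI Suc y subringE(6)[OF K] by metis
qed (simp add: subring_mem[OF K])

lemma poly_span_neg: "y \<in> poly_span K t m \<Longrightarrow> \<ominus> y \<in> poly_span K t m"
  using poly_span_smult[of "\<ominus> \<one>" y m] poly_span_carrier[of y m] subringE(3,5)[OF K]
  by (simp add: l_minus)

lemma poly_span_minus:
  "y \<in> poly_span K t m \<Longrightarrow> z \<in> poly_span K t m \<Longrightarrow> y \<ominus> z \<in> poly_span K t m"
  unfolding minus_eq by (intro poly_span_add poly_span_neg)

lemma poly_span_mono: "m \<le> n \<Longrightarrow> poly_span K t m \<subseteq> poly_span K t n"
proof (induction rule: dec_induct)
  case (step n)
  have "y \<in> poly_span K t (Suc n)" if "y \<in> poly_span K t n" for y
    using poly_span_SucI[OF subringE(2)[OF K] that] poly_span_carrier[OF that] t by simp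
  then show ?case using step by auto
qed simp

lemma poly_span_times_gen: "y \<in> poly_span K t m \<Longrightarrow> t \<otimes> y \<in> poly_span K t (Suc m)"
proof (induction m arbitrary: y)
  case 0
  then show ?case using poly_span_zero[of 1] t by simp
next
  case (Suc m)
  obtain a n where y: "a \<in> K" "n \<in> poly_span K t m" "y = a \<otimes> t [^] m \<oplus> n"
    using Suc.prems by (auto elim!: poly_span_SucE)
  have "a \<in> carrier R" "n \<in> carrier R" "t [^] m \<in> carrier R"
    using y t poly_span_carrier subring_mem[OF K] by auto
  then have "t \<otimes> y = a \<otimes> (t [^] m \<otimes> t) \<oplus> t \<otimes> n" unfolding y using t by algebra
  then show ?case using poly_span_SucI[OF y(1) Suc.IH[OF y(2)]] by simp
qed

lemma poly_span_times_pow: "y \<in> poly_span K t m \<Longrightarrow> t [^] (k::nat) \<otimes> y \<in> poly_span K t (k + m)"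
proof (induction k)
  case (Suc k)
  have "t [^] Suc k \<otimes> y = t \<otimes> (t [^] k \<otimes> y)"
    using t poly_span_carrier[OF Suc.prems] by (simp add: m_ac)
  then show ?case using poly_span_times_gen[OF Suc.IH[OF Suc.prems]] by simp
qed (use poly_span_carrier in simp)

text \<open>Degrees less than \<open>m\<close> and at most \<open>k\<close> add up to less than
  \<open>m + k\<close>; the form \<open>Suc k\<close> of the second bound makes this exact without
  truncated subtraction.\<close>

lemma poly_span_mult:
  "y \<in> poly_span K t m \<Longrightarrow> z \<in> poly_span K t (Suc k) \<Longrightarrow> y \<otimes> z \<in> poly_span K t (m + k)"
proof (induction m arbitrary: y)
  case 0
  then show ?case using poly_span_zero poly_span_carrier[of z] by simp
next
  case (Suc m)
  obtain a n where y: "a \<in> K" "n \<in> poly_span K t m" "y = a \<otimes> t [^] m \<oplus> n"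
    using Suc.prems by (auto elim!: poly_span_SucE)
  have "a \<in> carrier R" "n \<in> carrier R" "t [^] m \<in> carrier R" "z \<in> carrier R"
    using y t Suc.prems poly_span_carrier subring_mem[OF K] by auto
  then have "y \<otimes> z = a \<otimes> (t [^] m \<otimes> z) \<oplus> n \<otimes> z" unfolding y by algebra
  moreover have "a \<otimes> (t [^] m \<otimes> z) \<in> poly_span K t (Suc m + k)"
    using poly_span_smult[OF y(1) poly_span_times_pow[OF Suc.prems(2)]] by simp
  moreover have "n \<otimes> z \<in> poly_span K t (Suc m + k)"
    using Suc.IH[OF y(2) Suc.prems(2)] poly_span_mono[of "m + k" "Suc m + k"] by auto
  ultimately show ?case using poly_span_add by simp
qed

lemma poly_span_1: "poly_span K t 1 = K"
  using subring_mem[OF K] by (force simp: poly_span_Suc)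

lemma poly_span_pow: "t [^] (m::nat) \<in> poly_span K t (Suc m)"
  using poly_span_SucI[OF subringE(3)[OF K] poly_span_zero, of m] t by simp

text \<open>Gives every element of \<open>K[t]\<close> a degree bound, so that closure under the
  ring operations can be read off from the spans.\<close>

lemma simple_extension_eq_poly_span: "simple_extension K t = (\<Union>m. poly_span K t m)"
proof -
  have "y \<in> (\<Union>m. poly_span K t m)" if "y \<in> simple_extension K t" for y
    using that
  proof (induction rule: simple_extension.induct)
    case zero
    show ?case using poly_span_zero by blast
  next
    case (lin y a)
    then obtain m where m: "y \<in> poly_span K t m" by auto
    have "t \<otimes> y \<in> poly_span K t (Suc m)" by (rule poly_span_times_gen[OF m])
    moreover have "a \<in> poly_span K t (Suc m)"
      using lin(2) poly_span_1 poly_span_mono[of 1 "Suc m"] by auto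
    ultimately have "t \<otimes> y \<oplus> a \<in> poly_span K t (Suc m)" by (rule poly_span_add)
    then show ?case using t poly_span_carrier[OF m] by (auto simp: m_comm)
  qed
  moreover have "y \<in> simple_extension K t" if "y \<in> poly_span K t m" for y m
  proof -
    obtain p where "set p \<subseteq> K" "y = eval p t" using \<open>y \<in> poly_span K t m\<close> by (auto simp: poly_span_def)
    then show ?thesis
    proof (induction p arbitrary: y rule: rev_induct)
      \<comment> \<open>Coefficient lists start with the leading one, so the Horner step
        \<open>y \<otimes> t \<oplus> a\<close> of \<open>simple_extension\<close> appends
        \<open>a\<close> at the end.\<close>
      case (snoc a p)
      have p: "set p \<subseteq> carrier R" "a \<in> carrier R" using snoc.prems subring_mem[OF K] by auto
      have "eval (p @ [a]) t = eval p t \<otimes> t \<oplus> a"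
        using eval_append_aux[OF p t] by simp
      then show ?case using snoc simple_extension.lin[of "eval p t" K t a] by auto
    qed auto
  qed
  ultimately show ?thesis by auto
qed

lemma simple_extension_subring: "subring (simple_extension K t) R"
proof (rule subringI)
  note eq = simple_extension_eq_poly_span
  have lift: "\<exists>m. y \<in> poly_span K t (Suc m) \<and> z \<in> poly_span K t (Suc m)"
    if yz: "y \<in> simple_extension K t" "z \<in> simple_extension K t" for y z
  proof -
    obtain m n where "y \<in> poly_span K t m" "z \<in> poly_span K t n" using yz by (auto simp: eq)
    then have "y \<in> poly_span K t (Suc (m + n))" "z \<in> poly_span K t (Suc (m + n))"
      using poly_span_mono[of m "Suc (m + n)"] poly_span_mono[of n "Suc (m + n)"] by auto
    then show ?thesis by blast
  qed
  show "simple_extension K t \<subseteq> carrier R" using poly_span_carrier by (auto simp: eq)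
  show "\<one> \<in> simple_extension K t" using subringE(3)[OF K] poly_span_1 by (auto simp: eq)
  show "\<ominus> y \<in> simple_extension K t" if "y \<in> simple_extension K t" for y
    using that poly_span_neg by (auto simp: eq)
  show "y \<otimes> z \<in> simple_extension K t" "y \<oplus> z \<in> simple_extension K t"
    if "y \<in> simple_extension K t" "z \<in> simple_extension K t" for y z
    using lift[OF that] unfolding eq by (blast intro: poly_span_mult poly_span_add)+
qed

text \<open>A monic equation \<open>\<one> # p\<close> with \<open>length p = m\<close> says
  \<open>t^m = - eval p t\<close>; integrality thus becomes a membership in a span.\<close>

lemma integral_over_iff_poly_span:
  "integral_over K R t \<longleftrightarrow> (\<exists>m. t [^] (m::nat) \<in> poly_span K t m)"
proof
  assume "integral_over K R t"
  then obtain p where p: "set p \<subseteq> K" "t [^] length p \<oplus> eval p t = \<zero>"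
    using t by (auto simp: integral_over_def)
  have e: "eval p t \<in> poly_span K t (length p)" using p by (auto simp: poly_span_def)
  have "t [^] length p = \<ominus> eval p t"
    using p(2) t poly_span_carrier[OF e] by (simp add: sum_zero_eq_neg)
  then show "\<exists>m. t [^] (m::nat) \<in> poly_span K t m" using poly_span_neg[OF e] by metis
next
  assume "\<exists>m. t [^] (m::nat) \<in> poly_span K t m"
  then obtain m :: nat where "t [^] m \<in> poly_span K t m" ..
  then have "\<ominus> (t [^] m) \<in> poly_span K t m" by (rule poly_span_neg)
  then obtain p where "set p \<subseteq> K" "length p = m" "\<ominus> (t [^] m) = eval p t"
    by (auto simp: poly_span_def)
  then show "integral_over K R t"
    unfolding integral_over_def using t by (intro exI[of _ p]) (auto simp: r_neg simp flip: \<open>_ = eval p t\<close>)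
qed

text \<open>The monic equation rewrites \<open>t^m\<close> by lower powers, so the span is already
  stable under multiplication by \<open>t\<close>.\<close>

lemma simple_extension_integral:
  assumes m: "t [^] (m::nat) \<in> poly_span K t m"
  shows "simple_extension K t = poly_span K t m"
proof -
  have sub: "poly_span K t (Suc m) \<subseteq> poly_span K t m"
    using poly_span_smult[OF _ m] poly_span_add by (auto elim!: poly_span_SucE)
  have "y \<in> poly_span K t m" if "y \<in> simple_extension K t" for y
    using that
  proof (induction rule: simple_extension.induct)
    case (lin y a)
    have "t \<otimes> y \<in> poly_span K t m" using poly_span_times_gen[OF lin(3)] sub by auto
    moreover have "a \<in> poly_span K t m"
      using lin(2) poly_span_1 poly_span_mono[of 1 "Suc m"] sub by auto
    ultimately have "t \<otimes> y \<oplus> a \<in> poly_span K t m" by (rule poly_span_add)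
    then show ?case using t poly_span_carrier[OF lin(3)] by (auto simp: m_comm)
  qed (rule poly_span_zero)
  then show ?thesis using simple_extension_eq_poly_span by auto
qed

end

end

section \<open>Finite chains and Nakayama's lemma\<close>

lemma chain_subset_carrier: "subset.chain \<A> C \<Longrightarrow> \<A> \<subseteq> \<B> \<Longrightarrow> subset.chain \<B> C"
  by (simp add: subset.chain_def subset_iff)

lemma finite_chain_Union:
  assumes "subset.chain \<A> C" "finite C" "C \<noteq> {}"
  shows "\<Union>C \<in> \<A>"
proof -
  obtain M where M: "M \<in> C" "\<forall>Y\<in>C. M \<subseteq> Y \<longrightarrow> M = Y"
    using finite_has_maximal[OF assms(2,3)] by auto
  have "Y \<subseteq> M" if "Y \<in> C" for Y
    using subset.chain_total[OF assms(1) that M(1)] M(2) that by blast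
  then have "\<Union>C = M" using M(1) by blast
  then show ?thesis using M(1) assms(1) by (auto simp: subset.chain_def)
qed

lemma FCP_mono: "FCP R S \<Longrightarrow> R \<subseteq> T \<Longrightarrow> FCP T S"
  unfolding FCP_def
  by (intro allI impI) (auto simp: intermediate_rings_def elim!: allE impE chain_subset_carrier)

text \<open>Zorn's lemma applies because a nonempty chain is finite and therefore contains its
  union.\<close>

lemma FCP_maximal:
  assumes "FCP R S" "\<A> \<subseteq> intermediate_rings R S" "\<A> \<noteq> {}"
  shows "\<exists>M\<in>\<A>. \<forall>Y\<in>\<A>. M \<subseteq> Y \<longrightarrow> Y = M"
proof (rule subset_Zorn_nonempty[OF assms(3)])
  fix C assume C: "C \<noteq> {}" "subset.chain \<A> C"
  then have "finite C"
    using assms(1) chain_subset_carrier[OF C(2) assms(2)] unfolding FCP_def by blast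
  then show "\<Union>C \<in> \<A>" using finite_chain_Union C by blast
qed

lemma FCP_minimal:
  assumes "FCP R S" "\<A> \<subseteq> intermediate_rings R S" "\<A> \<noteq> {}"
  shows "\<exists>M\<in>\<A>. \<forall>Y\<in>\<A>. Y \<subseteq> M \<longrightarrow> Y = M"
proof -
  \<comment> \<open>Complementation reverses inclusion: a maximal complement, obtained by Zorn's
    lemma, belongs to a minimal ring.\<close>
  have "\<exists>M\<in>uminus ` \<A>. \<forall>Y\<in>uminus ` \<A>. M \<subseteq> Y \<longrightarrow> Y = M"
  proof (rule subset_Zorn_nonempty)
    fix C assume C: "C \<noteq> {}" "subset.chain (uminus ` \<A>) C"
    then have "uminus ` C \<subseteq> \<A>" by (auto simp: subset.chain_def)
    moreover have "Y \<subseteq> Z \<or> Z \<subseteq> Y" if "Y \<in> uminus ` C" "Z \<in> uminus ` C" for Y Z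
      using that subset.chain_total[OF C(2)] by auto
    ultimately have "subset.chain \<A> (uminus ` C)"
      unfolding subset_chain_def by blast
    then have "finite (uminus ` C)"
      using assms(1) chain_subset_carrier[OF _ assms(2)] unfolding FCP_def by blast
    then have "finite C" by (rule finite_imageD) (auto intro: inj_onI)
    then show "\<Union>C \<in> uminus ` \<A>" using finite_chain_Union C by blast
  qed (use assms(3) in auto)
  then obtain M where "M \<in> \<A>" "\<forall>Y\<in>\<A>. - M \<subseteq> - Y \<longrightarrow> - Y = - M" by auto
  then show ?thesis by auto
qed

text \<open>The terms form a chain, so two of them coincide, and monotonicity squeezes the terms in
  between.\<close>

lemma FCP_decreasing:
  fixes A :: "nat \<Rightarrow> 'a set"
  assumes "FCP R S" "\<And>n. A n \<in> intermediate_rings R S" "\<And>n. A (Suc n) \<subseteq> A n"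
  shows "\<exists>n. A (Suc n) = A n"
proof -
  have anti: "A n \<subseteq> A m" if "m \<le> n" for m n
    using lift_Suc_antimono_le[of A, OF assms(3) that] .
  then have "subset.chain (intermediate_rings R S) (range A)"
    unfolding subset_chain_def using assms(2) nat_le_linear by blast
  then have "finite (range A)" using assms(1) unfolding FCP_def by blast
  then have "\<not> inj A" using finite_imageD infinite_UNIV_nat by blast
  then obtain m n where "m < n" "A m = A n" unfolding inj_def by (metis linorder_neqE_nat)
  then have "A (Suc m) = A m" using anti[of "Suc m" n] assms(3)[of m] by auto
  then show ?thesis ..
qed

section \<open>Descending chains of subrings, and Nakayama's lemma for spans\<close>

context cring
begin

text \<open>\<open>c B\<close> is an ideal of \<open>B\<close> and \<open>K \<subseteq> B\<close>,
  so \<open>K + c B\<close> is closed under products. Such rings form the descending chains to which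
  FCP is applied.\<close>

lemma subring_plus_multiples:
  assumes K: "subring K R" and B: "subring B R" and "K \<subseteq> B" and c: "c \<in> B"
  shows "subring {a \<oplus> c \<otimes> y |a y. a \<in> K \<and> y \<in> B} R" (is "subring ?A R")
proof (rule subringI)
  note K' = subring_mem[OF K] and B' = subring_mem[OF B] and cc = subring_mem[OF B c]
  note KE = subringE[OF K] and BE = subringE[OF B]
  show "?A \<subseteq> carrier R" using K' B' cc by auto
  have "\<one> = \<one> \<oplus> c \<otimes> \<zero>" using cc by simp
  then show "\<one> \<in> ?A" using KE(3) BE(2) by blast
  show "\<ominus> u \<in> ?A" if uA: "u \<in> ?A" for u
  proof -
    obtain a y where u: "u = a \<oplus> c \<otimes> y" "a \<in> K" "y \<in> B" using uA by blast
    have "\<ominus> u = \<ominus> a \<oplus> c \<otimes> (\<ominus> y)" unfolding u using K'[OF u(2)] B'[OF u(3)] cc by algebra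
    then show ?thesis using KE(5)[OF u(2)] BE(5)[OF u(3)] by blast
  qed
  fix u v assume "u \<in> ?A" "v \<in> ?A"
  then obtain a y b z where u: "u = a \<oplus> c \<otimes> y" "a \<in> K" "y \<in> B"
    and v: "v = b \<oplus> c \<otimes> z" "b \<in> K" "z \<in> B" by blast
  note cs = K'[OF u(2)] B'[OF u(3)] K'[OF v(2)] B'[OF v(3)] cc
  have "u \<oplus> v = (a \<oplus> b) \<oplus> c \<otimes> (y \<oplus> z)" unfolding u v using cs by algebra
  then show "u \<oplus> v \<in> ?A" using KE(7)[OF u(2) v(2)] BE(7)[OF u(3) v(3)] by blast
  have "u \<otimes> v = (a \<otimes> b) \<oplus> c \<otimes> (a \<otimes> z \<oplus> b \<otimes> y \<oplus> c \<otimes> y \<otimes> z)"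
    unfolding u v using cs by (simp add: l_distr r_distr m_ac a_ac)
  moreover have "a \<in> B" "b \<in> B" using u v \<open>K \<subseteq> B\<close> by auto
  then have "a \<otimes> z \<oplus> b \<otimes> y \<oplus> c \<otimes> y \<otimes> z \<in> B" using u v c BE(6,7) by simp
  ultimately show "u \<otimes> v \<in> ?A" using KE(6)[OF u(2) v(2)] by blast
qed

lemma subring_pow: "subring K R \<Longrightarrow> x \<in> K \<Longrightarrow> x [^] (n::nat) \<in> K"
  by (induction n) (simp_all add: subringE(3,6))

text \<open>Two consecutive members of the chain \<open>K + t^(n+1) K[t]\<close> coincide, so
  \<open>t^(n+1) = a + t^(n+2) y\<close> for some \<open>n\<close>. This is a relation with a unit
  coefficient, which need not be the leading one.\<close>

lemma FCP_relation:
  assumes K: "subring K R" and FCP: "FCP K R" and t: "t \<in> carrier R"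
  shows "\<exists>f. set f \<subseteq> K \<and> \<ominus> \<one> \<in> set f \<and> eval f t = \<zero>"
proof -
  let ?B = "simple_extension K t"
  \<comment> \<open>The exponents start at 1: \<open>K + K[t]\<close> and \<open>K + t K[t]\<close>
    are both \<open>K[t]\<close>, and their equality would carry no information.\<close>
  define A where "A = (\<lambda>n::nat. {a \<oplus> t [^] Suc n \<otimes> y |a y. a \<in> K \<and> y \<in> ?B})"
  note B = simple_extension_subring[OF K t] and KB = simple_extension_incl[OF subringE(1)[OF K] t]
  note tB = simple_extension_mem[OF K t]
  note KE = subringE[OF K] and BE = subringE[OF B]
  have AI: "a \<oplus> t [^] Suc n \<otimes> y \<in> A n" if "a \<in> K" "y \<in> ?B" for a y n
    unfolding A_def using that by blast
  have AE: "\<exists>a\<in>K. \<exists>y\<in>?B. u = a \<oplus> t [^] Suc n \<otimes> y" if "u \<in> A n" for u n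
    using that unfolding A_def by blast
  have "K \<subseteq> A n" for n
  proof
    fix a assume a: "a \<in> K"
    show "a \<in> A n" using AI[OF a BE(2), of n] t subring_mem[OF K a] by simp
  qed
  moreover have "subring (A n) R" for n
    unfolding A_def by (rule subring_plus_multiples[OF K B KB subring_pow[OF B tB]])
  ultimately have "A n \<in> intermediate_rings K R" for n
    unfolding intermediate_rings_def by simp
  moreover have "A (Suc n) \<subseteq> A n" for n
  proof
    fix u assume "u \<in> A (Suc n)"
    then obtain a y where u: "u = a \<oplus> t [^] Suc (Suc n) \<otimes> y" "a \<in> K" "y \<in> ?B" using AE by blast
    have "u = a \<oplus> t [^] Suc n \<otimes> (t \<otimes> y)"
      unfolding u using t subring_mem[OF B u(3)] by (simp add: m_assoc)
    then show "u \<in> A n" using AI[OF u(2) BE(6)[OF tB u(3)]] by simp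
  qed
  ultimately obtain n where n: "A (Suc n) = A n" using FCP_decreasing[OF FCP, of A] by blast
  have "t [^] Suc n \<in> A n" using AI[OF KE(2) BE(3), of n] t by simp
  then have "t [^] Suc n \<in> A (Suc n)" unfolding n .
  then obtain a y where y: "t [^] Suc n = a \<oplus> t [^] Suc (Suc n) \<otimes> y" "a \<in> K" "y \<in> ?B"
    using AE by blast
  obtain p where p: "set p \<subseteq> K" "y = eval p t"
    using y(3) unfolding simple_extension_eq_poly_span[OF K t] poly_span_def by blast
  \<comment> \<open>\<open>p @ ?q\<close> lists the coefficients of
    \<open>y t^(n+2) - t^(n+1) + a\<close>, the zeros filling the degrees between
    \<open>n + 1\<close> and 0.\<close>
  let ?q = "\<ominus> \<one> # replicate n \<zero> @ [a]"
  note a = subring_mem[OF K y(2)] and yc = subring_mem[OF B y(3)]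
  have qK: "set ?q \<subseteq> K" using KE(2) KE(5)[OF KE(3)] y(2) by (simp add: set_replicate_conv_if)
  have "eval (replicate n \<zero> @ [a]) t = a" using eval_replicate[of "[a]" t n] a t by simp
  then have q: "eval ?q t = \<ominus> (t [^] Suc n) \<oplus> a" using t by (simp add: l_minus)
  have len: "length ?q = Suc (Suc n)" by simp
  have pc: "set p \<subseteq> carrier R" and qc: "set ?q \<subseteq> carrier R" using p qK KE(1) by blast+
  have eq: "eval (p @ ?q) t = y \<otimes> t [^] Suc (Suc n) \<oplus> (\<ominus> (t [^] Suc n) \<oplus> a)"
    unfolding eval_append[OF pc qc t] q len p(2) ..
  have "y \<otimes> v \<oplus> (\<ominus> (a \<oplus> v \<otimes> y) \<oplus> a) = \<zero>" if "v \<in> carrier R" for v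
    using that a yc by algebra
  from this[of "t [^] Suc (Suc n)"] have "eval (p @ ?q) t = \<zero>"
    unfolding eq y(1) using t by (meson nat_pow_closed)
  then show ?thesis using p(1) qK by (intro exI[of _ "p @ ?q"]) simp
qed

text \<open>Nakayama's lemma for the \<open>K\<close>-module \<open>(c B + K) / K\<close> and the principal ideal \<open>x K\<close>,
  where \<open>B = poly_span K t d\<close>.\<close>

lemma nakayama_poly_span:
  assumes K: "subring K R" and t: "t \<in> carrier R" and c: "c \<in> K" and x: "x \<in> K"
    and step: "\<And>b. b \<in> poly_span K t d \<Longrightarrow>
      \<exists>u\<in>K. \<exists>b'\<in>poly_span K t d. c \<otimes> b = u \<oplus> x \<otimes> c \<otimes> b'"
  shows "\<exists>a\<in>K. \<forall>b\<in>poly_span K t d. (\<one> \<ominus> x \<otimes> a) \<otimes> (c \<otimes> b) \<in> K"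
proof -
  note KE = subringE[OF K] and K' = subring_mem[OF K] and S' = poly_span_carrier[OF K t]
  \<comment> \<open>Descending induction on \<open>m\<close> removes
    \<open>t^(d-1), ..., t, 1\<close> from the generators: factors congruent to
    \<open>\<one>\<close> modulo \<open>x\<close> push \<open>c B\<close> into
    \<open>K + c (poly_span K t m)\<close>, and \<open>m = 0\<close> is the claim.\<close>
  let ?P = "\<lambda>m. \<exists>a\<in>K. \<forall>b\<in>poly_span K t d. \<exists>u\<in>K. \<exists>p\<in>poly_span K t m.
      (\<one> \<ominus> x \<otimes> a) \<otimes> (c \<otimes> b) = u \<oplus> c \<otimes> p"
  have "?P 0"
  proof (rule inc_induct[of 0 d ?P])
    show "\<exists>a\<in>K. \<forall>b\<in>poly_span K t d. \<exists>u\<in>K. \<exists>p\<in>poly_span K t d.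
      (\<one> \<ominus> x \<otimes> a) \<otimes> (c \<otimes> b) = u \<oplus> c \<otimes> p"
    proof (rule bexI[OF _ KE(2)], rule ballI)
      fix b assume b: "b \<in> poly_span K t d"
      have "(\<one> \<ominus> x \<otimes> \<zero>) \<otimes> (c \<otimes> b) = \<zero> \<oplus> c \<otimes> b" using K'[OF x] K'[OF c] S'[OF b] by algebra
      then show "\<exists>u\<in>K. \<exists>p\<in>poly_span K t d. (\<one> \<ominus> x \<otimes> \<zero>) \<otimes> (c \<otimes> b) = u \<oplus> c \<otimes> p"
        using KE(2) b by blast
    qed
  next
    fix m assume "m < d" and "\<exists>a\<in>K. \<forall>b\<in>poly_span K t d. \<exists>u\<in>K. \<exists>p\<in>poly_span K t (Suc m).
      (\<one> \<ominus> x \<otimes> a) \<otimes> (c \<otimes> b) = u \<oplus> c \<otimes> p"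
    then obtain a where a: "a \<in> K" and *: "\<And>b. b \<in> poly_span K t d \<Longrightarrow>
      \<exists>u\<in>K. \<exists>p\<in>poly_span K t (Suc m). (\<one> \<ominus> x \<otimes> a) \<otimes> (c \<otimes> b) = u \<oplus> c \<otimes> p" by blast
    have **: "\<exists>u\<in>K. \<exists>e\<in>K. \<exists>p\<in>poly_span K t m.
      (\<one> \<ominus> x \<otimes> a) \<otimes> (c \<otimes> b) = u \<oplus> c \<otimes> (e \<otimes> t [^] m \<oplus> p)" if "b \<in> poly_span K t d" for b
      using *[OF that] by (auto elim!: poly_span_SucE)
    have t_pow: "t [^] m \<in> poly_span K t d"
      using poly_span_pow[OF K t] poly_span_mono[OF K t, of "Suc m" d] \<open>m < d\<close> by auto
    \<comment> \<open>The hypothesis for the top generator \<open>t^m\<close>, followed by the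
      induction hypothesis for the resulting \<open>b'\<close>, brings back \<open>t^m\<close> with
      coefficient \<open>x c e\<close>; collecting it on the left gives the new factor
      \<open>g = f - x e\<close>.\<close>
    obtain u b' where u: "u \<in> K" "b' \<in> poly_span K t d" "c \<otimes> t [^] m = u \<oplus> x \<otimes> c \<otimes> b'"
      using step[OF t_pow] by blast
    obtain v e p where v: "v \<in> K" "e \<in> K" "p \<in> poly_span K t m"
      "(\<one> \<ominus> x \<otimes> a) \<otimes> (c \<otimes> b') = v \<oplus> c \<otimes> (e \<otimes> t [^] m \<oplus> p)"
      using **[OF u(2)] by blast
    define f where "f = \<one> \<ominus> x \<otimes> a"
    define g where "g = \<one> \<ominus> x \<otimes> (a \<oplus> e)"
    define w where "w = f \<otimes> u \<oplus> x \<otimes> v"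
    have fK: "f \<in> K" unfolding f_def a_minus_def using a x by (intro KE)
    have gK: "g \<in> K" unfolding g_def a_minus_def using a x v(2) by (intro KE)
    have w: "w \<in> K" unfolding w_def using x u(1) v(1) fK by (intro KE)
    note cs = K'[OF x] K'[OF c] K'[OF a] K'[OF u(1)] S'[OF u(2)] K'[OF v(1)] K'[OF v(2)] S'[OF v(3)]
      S'[OF t_pow] K'[OF fK] K'[OF gK] K'[OF w]
    have g_f: "g = f \<ominus> x \<otimes> e" unfolding f_def g_def using cs(1,3,7) by algebra
    have gen: "g \<otimes> (c \<otimes> t [^] m) = w \<oplus> c \<otimes> (x \<otimes> p)"
    proof -
      have "f \<otimes> (c \<otimes> t [^] m) = f \<otimes> u \<oplus> x \<otimes> (f \<otimes> (c \<otimes> b'))"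
        unfolding u(3) using cs by (simp add: r_distr m_ac)
      also have "\<dots> = w \<oplus> x \<otimes> (c \<otimes> (e \<otimes> t [^] m \<oplus> p))"
        unfolding v(4)[folded f_def] w_def using cs by (simp add: r_distr m_ac a_ac)
      finally have *: "f \<otimes> (c \<otimes> t [^] m) = w \<oplus> x \<otimes> (c \<otimes> (e \<otimes> t [^] m \<oplus> p))" .
      have "g \<otimes> (c \<otimes> t [^] m) = f \<otimes> (c \<otimes> t [^] m) \<ominus> x \<otimes> (c \<otimes> (e \<otimes> t [^] m))"
        unfolding g_f a_minus_def using cs by (simp add: l_distr r_distr l_minus r_minus m_ac)
      also have "\<dots> = w \<oplus> c \<otimes> (x \<otimes> p)" unfolding * using cs(1,2,7,8,9,12) by algebra
      finally show ?thesis .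
    qed
    \<comment> \<open>\<open>a'\<close> is chosen so that
      \<open>\<one> \<ominus> x \<otimes> a' = g \<otimes> f\<close>: the factor \<open>f\<close>
      reduces any \<open>b\<close> to powers up to \<open>t^m\<close>, and \<open>g\<close> then
      eliminates \<open>t^m\<close>.\<close>
    define a' where "a' = a \<oplus> f \<otimes> (a \<oplus> e)"
    have a': "a' \<in> K" unfolding a'_def using a fK v(2) by (intro KE)
    have gf: "\<one> \<ominus> x \<otimes> a' = g \<otimes> f" unfolding a'_def g_def f_def using cs(1,3,7) by algebra
    show "\<exists>a\<in>K. \<forall>b\<in>poly_span K t d. \<exists>u\<in>K. \<exists>p\<in>poly_span K t m.
      (\<one> \<ominus> x \<otimes> a) \<otimes> (c \<otimes> b) = u \<oplus> c \<otimes> p"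
    proof (rule bexI[OF _ a'], rule ballI)
      fix b assume b: "b \<in> poly_span K t d"
      obtain v' e' p' where v': "v' \<in> K" "e' \<in> K" "p' \<in> poly_span K t m"
        "f \<otimes> (c \<otimes> b) = v' \<oplus> c \<otimes> (e' \<otimes> t [^] m \<oplus> p')"
        using **[OF b] unfolding f_def by blast
      note cs' = cs K'[OF v'(1)] K'[OF v'(2)] S'[OF v'(3)] S'[OF b]
      have "(\<one> \<ominus> x \<otimes> a') \<otimes> (c \<otimes> b) = g \<otimes> (f \<otimes> (c \<otimes> b))"
        unfolding gf using cs' by (simp add: m_assoc)
      also have "\<dots> = g \<otimes> v' \<oplus> e' \<otimes> (g \<otimes> (c \<otimes> t [^] m)) \<oplus> c \<otimes> (g \<otimes> p')"
        unfolding v'(4) using cs' by (simp add: r_distr m_ac a_ac)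
      also have "\<dots> = (g \<otimes> v' \<oplus> e' \<otimes> w) \<oplus> c \<otimes> ((e' \<otimes> x) \<otimes> p \<oplus> g \<otimes> p')"
        unfolding gen using cs' by (simp add: r_distr m_ac a_ac)
      finally have "(\<one> \<ominus> x \<otimes> a') \<otimes> (c \<otimes> b) =
        (g \<otimes> v' \<oplus> e' \<otimes> w) \<oplus> c \<otimes> ((e' \<otimes> x) \<otimes> p \<oplus> g \<otimes> p')" .
      moreover have "g \<otimes> v' \<oplus> e' \<otimes> w \<in> K" using gK w v'(1,2) by (intro KE)
      moreover have "(e' \<otimes> x) \<otimes> p \<oplus> g \<otimes> p' \<in> poly_span K t m"
        using gK v'(2,3) v(3) x by (intro poly_span_add[OF K t] poly_span_smult[OF K t] KE)
      ultimately show "\<exists>u\<in>K. \<exists>p\<in>poly_span K t m. (\<one> \<ominus> x \<otimes> a') \<otimes> (c \<otimes> b) = u \<oplus> c \<otimes> p"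
        by blast
    qed
  qed simp
  then show ?thesis using K' c by fastforce
qed

end

section \<open>Intersections of subrings over which a ring is integral\<close>

lemma integral_over_mono: "integral_over R S x \<Longrightarrow> R \<subseteq> T \<Longrightarrow> integral_over T S x"
  unfolding integral_over_def by (meson subset_trans)

section \<open>Conductors, quasi-inverses and zero-dimensional base rings\<close>

context cring
begin

text \<open>The subrings \<open>T\<close> that a multiple of a power of \<open>x\<close> moves into \<open>U\<close> have a maximal element; by
  Nakayama's lemma, a maximal one absorbs every further integral element.\<close>

lemma FCP_integral_conductor:
  assumes U: "subring U R" and FCP: "FCP U R" and int: "integral_ext U R" and x: "x \<in> U"
  shows "\<exists>N::nat. \<exists>q\<in>carrier R. \<forall>s\<in>carrier R. x [^] N \<otimes> (\<one> \<ominus> x \<otimes> q) \<otimes> s \<in> U"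
proof -
  define Q where "Q = (\<lambda>T. \<exists>N::nat. \<exists>q\<in>carrier R. \<forall>s\<in>T. x [^] N \<otimes> (\<one> \<ominus> x \<otimes> q) \<otimes> s \<in> U)"
  let ?A = "{T \<in> intermediate_rings U R. Q T}"
  note xc = subring_mem[OF U x]
  have "\<forall>s\<in>U. x [^] (0::nat) \<otimes> (\<one> \<ominus> x \<otimes> \<zero>) \<otimes> s \<in> U"
    using subring_mem[OF U] xc by (simp add: a_minus_def)
  then have "Q U" unfolding Q_def using zero_closed by (intro exI[of _ "0::nat"] bexI)
  then have "U \<in> ?A" using U by (simp add: intermediate_rings_def)
  then obtain T where T': "T \<in> ?A" and max': "\<forall>B\<in>?A. T \<subseteq> B \<longrightarrow> B = T"
    using FCP_maximal[OF FCP, of ?A] by auto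
  have T: "subring T R" "U \<subseteq> T" and QT: "Q T" using T' by (auto simp: intermediate_rings_def)
  have max: "B = T" if "subring B R" "T \<subseteq> B" "Q B" for B
    using max' that T(2) by (auto simp: intermediate_rings_def)
  have "t \<in> T" if t: "t \<in> carrier R" for t
  proof -
    let ?B = "simple_extension T t"
    note B = simple_extension_subring[OF T(1) t]
      and TB = simple_extension_incl[OF subringE(1)[OF T(1)] t]
      and tB = simple_extension_mem[OF T(1) t]
    note BE = subringE[OF B] and TE = subringE[OF T(1)]
    have xT: "x \<in> T" using x T by auto
    then have xB: "x \<in> ?B" using TB by auto
    \<comment> \<open>This chain supplies an \<open>n\<close> with
      \<open>x^n T[t] \<subseteq> T + x x^n T[t]\<close>, the hypothesis of Nakayama's lemma for
      \<open>c = x^n\<close>.\<close>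
    define A where "A = (\<lambda>n::nat. {a \<oplus> x [^] n \<otimes> y |a y. a \<in> T \<and> y \<in> ?B})"
    have AI: "a \<oplus> x [^] n \<otimes> y \<in> A n" if "a \<in> T" "y \<in> ?B" for a y n
      unfolding A_def using that by blast
    have AE: "\<exists>a\<in>T. \<exists>y\<in>?B. u = a \<oplus> x [^] n \<otimes> y" if "u \<in> A n" for u n
      using that unfolding A_def by blast
    have "U \<subseteq> A n" for n
    proof
      fix a assume "a \<in> U"
      then have a: "a \<in> T" using T by auto
      show "a \<in> A n" using AI[OF a BE(2), of n] xc subring_mem[OF T(1) a] by simp
    qed
    moreover have "subring (A n) R" for n
      unfolding A_def by (rule subring_plus_multiples[OF T(1) B TB subring_pow[OF B xB]])
    ultimately have "A n \<in> intermediate_rings U R" for n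
      unfolding intermediate_rings_def by simp
    moreover have "A (Suc n) \<subseteq> A n" for n
    proof
      fix u assume "u \<in> A (Suc n)"
      then obtain a y where u: "u = a \<oplus> x [^] Suc n \<otimes> y" "a \<in> T" "y \<in> ?B" using AE by blast
      have "u = a \<oplus> x [^] n \<otimes> (x \<otimes> y)"
        unfolding u using xc subring_mem[OF B u(3)] by (simp add: m_assoc)
      then show "u \<in> A n" using AI[OF u(2) BE(6)[OF xB u(3)]] by simp
    qed
    ultimately obtain n where n: "A (Suc n) = A n" using FCP_decreasing[OF FCP, of A] by blast
    have "integral_over T R t"
      using int t by (intro integral_over_mono[OF _ T(2)]) (simp add: integral_ext_def)
    then obtain d where d: "?B = poly_span T t d"
      using integral_over_iff_poly_span[OF T(1) t] simple_extension_integral[OF T(1) t] by blast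
    have "\<exists>u\<in>T. \<exists>b'\<in>poly_span T t d. x [^] n \<otimes> b = u \<oplus> x \<otimes> x [^] n \<otimes> b'"
      if b: "b \<in> poly_span T t d" for b
    proof -
      have b': "b \<in> ?B" using b d by simp
      have "x [^] n \<otimes> b \<in> A n"
        using AI[OF TE(2) b', of n] xc subring_mem[OF B b'] by simp
      then have "x [^] n \<otimes> b \<in> A (Suc n)" unfolding n .
      then obtain u b' where "u \<in> T" "b' \<in> ?B" "x [^] n \<otimes> b = u \<oplus> x [^] Suc n \<otimes> b'"
        using AE by blast
      moreover have "x [^] Suc n = x \<otimes> x [^] n" using xc by (simp add: m_comm)
      ultimately show ?thesis unfolding d by auto
    qed
    then obtain a where a: "a \<in> T" "\<forall>b\<in>?B. (\<one> \<ominus> x \<otimes> a) \<otimes> (x [^] n \<otimes> b) \<in> T"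
      using nakayama_poly_span[OF T(1) t subring_pow[OF T(1) xT] xT, of d] unfolding d by blast
    obtain N :: nat and q where q: "q \<in> carrier R" "\<forall>s\<in>T. x [^] N \<otimes> (\<one> \<ominus> x \<otimes> q) \<otimes> s \<in> U"
      using QT unfolding Q_def by blast
    note ac = subring_mem[OF T(1) a(1)]
    \<comment> \<open>The multipliers compose: \<open>x^n (1 - x a)\<close> moves
      \<open>T[t]\<close> into \<open>T\<close>, and \<open>x^N (1 - x q)\<close> moves
      \<open>T\<close> into \<open>U\<close>. The new \<open>q\<close> comes from expanding
      \<open>(1 - x q) (1 - x a)\<close>.\<close>
    have "x [^] (N + n) \<otimes> (\<one> \<ominus> x \<otimes> (q \<oplus> a \<ominus> x \<otimes> q \<otimes> a)) \<otimes> b \<in> U" if b: "b \<in> ?B" for b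
    proof -
      have bc: "b \<in> carrier R" using subring_mem[OF B b] .
      let ?f = "\<one> \<ominus> x \<otimes> q" and ?g = "\<one> \<ominus> x \<otimes> a"
      have f: "?f \<in> carrier R" "?g \<in> carrier R" using xc ac q(1) by auto
      have "\<one> \<ominus> x \<otimes> (q \<oplus> a \<ominus> x \<otimes> q \<otimes> a) = ?f \<otimes> ?g" using xc ac q(1) by algebra
      then have "x [^] (N + n) \<otimes> (\<one> \<ominus> x \<otimes> (q \<oplus> a \<ominus> x \<otimes> q \<otimes> a)) \<otimes> b
          = x [^] N \<otimes> ?f \<otimes> (?g \<otimes> (x [^] n \<otimes> b))"
        using xc bc f by (simp add: m_ac flip: nat_pow_mult)
      then show ?thesis using a(2) q(2) b by simp
    qed
    moreover have "q \<oplus> a \<ominus> x \<otimes> q \<otimes> a \<in> carrier R" using q(1) ac xc by simp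
    ultimately have "Q ?B" unfolding Q_def by (intro exI[of _ "N + n"] bexI ballI)
    then have "?B = T" by (rule max[OF B TB])
    then show ?thesis using tB by simp
  qed
  then have "T = carrier R" using subring_mem[OF T(1)] by auto
  then show ?thesis using QT unfolding Q_def by simp
qed

text \<open>\<open>e = P \<otimes> r\<close> is idempotent and \<open>r\<close> inverts
  \<open>P\<close> on its component. As for the inverse of a unit, multiplying an integral equation
  of \<open>r\<close> by powers of \<open>P\<close> cancels the powers of \<open>r\<close>; this
  puts first \<open>e\<close> and then \<open>r\<close> into \<open>K\<close>.\<close>

lemma integral_quasi_inverse_mem:
  assumes K: "subring K R" and r: "r \<in> carrier R" and int: "integral_over K R r" and P: "P \<in> K"
    and PPr: "P \<otimes> P \<otimes> r = P" and Prr: "P \<otimes> r \<otimes> r = r"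
  shows "r \<in> K"
proof -
  note KE = subringE[OF K] and K' = subring_mem[OF K] and S' = poly_span_carrier[OF K r]
  note Pc = K'[OF P]
  define e where "e = P \<otimes> r"
  have e: "e \<in> carrier R" using Pc r by (simp add: e_def)
  have Pe: "P \<otimes> e = P" using PPr Pc r by (simp add: e_def m_assoc)
  have er: "e \<otimes> r = r" using Prr by (simp add: e_def)
  have ee: "e \<otimes> e = e" using Prr Pc r by (simp add: e_def m_ac)
  have Pe_pow: "P \<otimes> e [^] (k::nat) = P" for k
    using Pc e Pe by (induction k) (simp_all flip: m_assoc)
  have e_pow: "e [^] Suc k = e" for k :: nat
    using e ee by (induction k) simp_all
  have P_r_pow: "P [^] k \<otimes> r [^] k = e [^] k" for k :: nat
    using nat_pow_distrib[OF Pc r] by (simp add: e_def)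
  obtain m0 :: nat where m0: "r [^] m0 \<in> poly_span K r m0"
    using int integral_over_iff_poly_span[OF K r] by blast
  \<comment> \<open>The degree is made positive, since \<open>e [^] m = e\<close> can fail for
    \<open>m = 0\<close>.\<close>
  define m where "m = Suc m0"
  have m: "r [^] m \<in> poly_span K r m"
    using poly_span_times_gen[OF K r m0] r by (simp add: m_def m_comm)
  have 1: "P [^] k \<otimes> y \<in> K" if "y \<in> poly_span K r k" for y and k :: nat
    using that
  proof (induction k arbitrary: y)
    case (Suc k)
    obtain a n where y: "a \<in> K" "n \<in> poly_span K r k" "y = a \<otimes> r [^] k \<oplus> n"
      using Suc.prems by (auto elim!: poly_span_SucE)
    note cs = K'[OF y(1)] S'[OF y(2)] Pc r
    have "P [^] Suc k \<otimes> y = a \<otimes> (P \<otimes> (P [^] k \<otimes> r [^] k)) \<oplus> P \<otimes> (P [^] k \<otimes> n)"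
      unfolding y using cs by (simp add: r_distr m_ac)
    also have "\<dots> = a \<otimes> P \<oplus> P \<otimes> (P [^] k \<otimes> n)" unfolding P_r_pow Pe_pow ..
    finally show ?case using KE(6,7) P y(1) Suc.IH[OF y(2)] by simp
  qed (use KE(2) in simp)
  have "e [^] m \<in> K" using 1[OF m] P_r_pow by simp
  then have eK: "e \<in> K" unfolding m_def e_pow .
  \<comment> \<open>Once \<open>e \<in> K\<close>, one more factor \<open>r\<close> is admissible:
    the top term contributes \<open>a \<otimes> e\<close>. For \<open>k = m\<close> and
    \<open>y = r^m\<close> the element in question is \<open>e r = r\<close>.\<close>
  have 2: "P [^] k \<otimes> r \<otimes> y \<in> K" if "y \<in> poly_span K r k" for y and k :: nat
    using that
  proof (induction k arbitrary: y)
    case (Suc k)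
    obtain a n where y: "a \<in> K" "n \<in> poly_span K r k" "y = a \<otimes> r [^] k \<oplus> n"
      using Suc.prems by (auto elim!: poly_span_SucE)
    note cs = K'[OF y(1)] S'[OF y(2)] Pc r
    have "P [^] Suc k \<otimes> r \<otimes> y =
        a \<otimes> (P [^] Suc k \<otimes> r [^] Suc k) \<oplus> P \<otimes> (P [^] k \<otimes> r \<otimes> n)"
      unfolding y using cs by (simp add: r_distr m_ac)
    also have "\<dots> = a \<otimes> e \<oplus> P \<otimes> (P [^] k \<otimes> r \<otimes> n)" unfolding P_r_pow e_pow ..
    finally show ?case using KE(6,7) P eK y(1) Suc.IH[OF y(2)] by simp
  qed (use KE(2) r in simp)
  have "P [^] m \<otimes> r \<otimes> r [^] m = (P [^] m \<otimes> r [^] m) \<otimes> r" using Pc r by (simp add: m_ac)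
  also have "\<dots> = r" unfolding P_r_pow m_def e_pow by (rule er)
  finally show ?thesis using 2[OF m] by simp
qed

text \<open>In the binomial expansion every term contains \<open>s^i\<close> or \<open>s'^j\<close>.
  The induction avoids the expansion by absorbing each factor split off into a multiplier
  \<open>z\<close>.\<close>

lemma pow_add_mem:
  assumes K: "subring K R" and H: "H \<subseteq> carrier R" "\<And>g h. g \<in> H \<Longrightarrow> h \<in> H \<Longrightarrow> g \<oplus> h \<in> H"
      "\<And>a h. a \<in> K \<Longrightarrow> h \<in> H \<Longrightarrow> a \<otimes> h \<in> H"
    and s: "s \<in> K" and s': "s' \<in> K"
    and "s [^] (i::nat) \<in> H" "s' [^] (j::nat) \<in> H"
  shows "(s \<oplus> s') [^] (i + j) \<in> H"
proof -
  note KE = subringE[OF K] and K' = subring_mem[OF K]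
  have "z \<otimes> (s \<oplus> s') [^] n \<in> H"
    if "i + j = n" "z \<in> K" "z \<otimes> s [^] i \<in> H" "z \<otimes> s' [^] j \<in> H" for z n and i j :: nat
    using that
  proof (induction n arbitrary: i j z)
    case (Suc n)
    note z = K'[OF \<open>z \<in> K\<close>] and sc = K'[OF s] K'[OF s']
    have ss: "s \<oplus> s' \<in> K" by (rule KE(7)[OF s s'])
    show ?case
    proof (cases "i = 0 \<or> j = 0")
      case True
      then have "z \<in> H" using Suc.prems(3,4) z by (elim disjE) simp_all
      then show ?thesis
        using H(3)[OF subring_pow[OF K ss, of "Suc n"]] m_comm[OF z, of "(s \<oplus> s') [^] Suc n"] sc
        by simp
    next
      case False
      then obtain i' j' where ij: "i = Suc i'" "j = Suc j'" by (cases i; cases j) auto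
      have n: "i' + j = n" "i + j' = n" using ij Suc.prems(1) by auto
      have "z \<otimes> s \<otimes> (s \<oplus> s') [^] n \<in> H"
      proof (rule Suc.IH[OF n(1)])
        show "z \<otimes> s \<in> K" using KE(6)[OF \<open>z \<in> K\<close> s] .
        show "z \<otimes> s \<otimes> s [^] i' \<in> H" using Suc.prems(3) ij z sc by (simp add: m_ac)
        show "z \<otimes> s \<otimes> s' [^] j \<in> H" using H(3)[OF s Suc.prems(4)] z sc by (simp add: m_ac)
      qed
      moreover have "z \<otimes> s' \<otimes> (s \<oplus> s') [^] n \<in> H"
      proof (rule Suc.IH[OF n(2)])
        show "z \<otimes> s' \<in> K" using KE(6)[OF \<open>z \<in> K\<close> s'] .
        show "z \<otimes> s' \<otimes> s' [^] j' \<in> H" using Suc.prems(4) ij z sc by (simp add: m_ac)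
        show "z \<otimes> s' \<otimes> s [^] i \<in> H" using H(3)[OF s' Suc.prems(3)] z sc by (simp add: m_ac)
      qed
      ultimately have "z \<otimes> s \<otimes> (s \<oplus> s') [^] n \<oplus> z \<otimes> s' \<otimes> (s \<oplus> s') [^] n \<in> H" by (rule H(2))
      moreover have "z \<otimes> (s \<oplus> s') [^] Suc n =
          z \<otimes> s \<otimes> (s \<oplus> s') [^] n \<oplus> z \<otimes> s' \<otimes> (s \<oplus> s') [^] n"
        using z sc by (simp add: l_distr r_distr m_ac)
      ultimately show ?thesis by simp
    qed
  qed simp
  from this[OF refl KE(3)] show ?thesis
    using assms(7,8) K'[OF s] K'[OF s'] by simp
qed

text \<open>Turns nilpotence of a polynomial value into a relation with leading coefficient
  \<open>x^j\<close>.\<close>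

lemma poly_span_leading_pow:
  assumes K: "subring K R" and t: "t \<in> carrier R" and x: "x \<in> K" and n: "n \<in> poly_span K t m"
  shows "\<exists>n'\<in>poly_span K t (m * j). (x \<otimes> t [^] m \<oplus> n) [^] j = x [^] j \<otimes> t [^] (m * j) \<oplus> n'"
proof (induction j)
  case 0
  then show ?case by simp
next
  case (Suc j)
  note K' = subring_mem[OF K] and S' = poly_span_carrier[OF K t]
  let ?y = "x \<otimes> t [^] m \<oplus> n"
  obtain n' where n': "n' \<in> poly_span K t (m * j)" "?y [^] j = x [^] j \<otimes> t [^] (m * j) \<oplus> n'"
    using Suc.IH by blast
  define l where "l = x [^] j \<otimes> (t [^] (m * j) \<otimes> n) \<oplus> n' \<otimes> ?y"
  have "t [^] (m * j) \<otimes> n \<in> poly_span K t (m * j + m)" by (rule poly_span_times_pow[OF K t n])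
  moreover have "n' \<otimes> ?y \<in> poly_span K t (m * j + m)"
    by (rule poly_span_mult[OF K t n'(1) poly_span_SucI[OF x n]])
  ultimately have l: "l \<in> poly_span K t (m * j + m)"
    unfolding l_def by (intro poly_span_add[OF K t] poly_span_smult[OF K t subring_pow[OF K x]])
  have cs: "x \<in> carrier R" "n \<in> carrier R" "n' \<in> carrier R" "t [^] m \<in> carrier R"
    "t [^] (m * j) \<in> carrier R" "x [^] j \<in> carrier R"
    using K'[OF x] S'[OF n] S'[OF n'(1)] t by auto
  have "?y [^] Suc j = (x [^] j \<otimes> t [^] (m * j) \<oplus> n') \<otimes> ?y" using n'(2) by simp
  also have "\<dots> = (x [^] j \<otimes> x) \<otimes> (t [^] (m * j) \<otimes> t [^] m) \<oplus> l"
    unfolding l_def using cs by (simp add: l_distr r_distr m_ac a_ac)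
  also have "\<dots> = x [^] Suc j \<otimes> t [^] (m * Suc j) \<oplus> l"
    using t by (simp add: nat_pow_mult add.commute)
  finally show ?case using l by (auto simp: add.commute)
qed

lemma pi_regular_integral:
  assumes K: "subring K R" and t: "t \<in> carrier R"
    and reg: "\<And>x. x \<in> K \<Longrightarrow> \<exists>n::nat. \<exists>r\<in>K. x [^] Suc n = x [^] Suc n \<otimes> x [^] Suc n \<otimes> r"
    and f: "set f \<subseteq> K" "\<ominus> \<one> \<in> set f" "eval f t = \<zero>"
  shows "integral_over K R t"
proof -
  note KE = subringE[OF K] and K' = subring_mem[OF K] and S' = poly_span_carrier[OF K t]
  define L where "L = {w \<in> K. \<exists>m::nat. w \<otimes> t [^] m \<in> poly_span K t m}"
  have LI: "w \<in> L" if "w \<in> K" "w \<otimes> t [^] m \<in> poly_span K t m" for w and m :: nat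
    unfolding L_def using that by blast
  have L_carrier: "L \<subseteq> carrier R" unfolding L_def using K' by blast
  have LK: "w \<in> K" if "w \<in> L" for w using that by (simp add: L_def)
  have L_smult: "a \<otimes> w \<in> L" if "a \<in> K" "w \<in> L" for a w
  proof -
    obtain m :: nat where m: "w \<otimes> t [^] m \<in> poly_span K t m" using \<open>w \<in> L\<close> by (auto simp: L_def)
    have "a \<otimes> w \<otimes> t [^] m = a \<otimes> (w \<otimes> t [^] m)" using K' LK that t by (simp add: m_assoc)
    then show ?thesis using poly_span_smult[OF K t \<open>a \<in> K\<close> m] LI KE(6) that LK by metis
  qed
  have L_add: "w \<oplus> w' \<in> L" if w: "w \<in> L" "w' \<in> L" for w w'
  proof -
    obtain m n :: nat where mn: "w \<otimes> t [^] m \<in> poly_span K t m" "w' \<otimes> t [^] n \<in> poly_span K t n"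
      using w by (auto simp: L_def)
    note wc = K'[OF LK[OF w(1)]] K'[OF LK[OF w(2)]]
    have "t [^] n \<otimes> (w \<otimes> t [^] m) \<in> poly_span K t (n + m)"
      "t [^] m \<otimes> (w' \<otimes> t [^] n) \<in> poly_span K t (m + n)"
      by (rule poly_span_times_pow[OF K t mn(1)], rule poly_span_times_pow[OF K t mn(2)])
    then have "t [^] n \<otimes> (w \<otimes> t [^] m) \<oplus> t [^] m \<otimes> (w' \<otimes> t [^] n) \<in> poly_span K t (n + m)"
      using poly_span_add[OF K t] by (simp add: add.commute)
    also have "t [^] n \<otimes> (w \<otimes> t [^] m) \<oplus> t [^] m \<otimes> (w' \<otimes> t [^] n) = (w \<oplus> w') \<otimes> t [^] (n + m)"
      using wc t by (simp add: l_distr r_distr m_ac flip: nat_pow_mult)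
    finally show ?thesis using KE(7) LK w by (intro LI) auto
  qed
  \<comment> \<open>The scalar \<open>s\<close>, and nilpotence in place of vanishing, make the
    claim inductive: after the leading term is dropped, what is known is that
    \<open>u s (eval g t)\<close> is nilpotent.\<close>
  have coeff: "\<exists>j::nat. (s \<otimes> a) [^] j \<in> L"
    if "set g \<subseteq> K" "s \<in> K" "(s \<otimes> eval g t) [^] (j::nat) = \<zero>" "a \<in> set g" for g s j a
    using that
  proof (induction g arbitrary: s j a)
    case (Cons b g)
    define m where "m = length g"
    define x where "x = s \<otimes> b"
    define y where "y = s \<otimes> eval (b # g) t"
    have g: "set g \<subseteq> K" "eval g t \<in> poly_span K t m" and b: "b \<in> K"
      using Cons.prems by (auto simp: m_def poly_span_def)
    note s = Cons.prems(2)
    have x: "x \<in> K" unfolding x_def by (rule KE(6)[OF s b])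
    define n where "n = s \<otimes> eval g t"
    have n: "n \<in> poly_span K t m" unfolding n_def by (rule poly_span_smult[OF K t s g(2)])
    note cs = K'[OF s] K'[OF b] K'[OF x] S'[OF n] t S'[OF g(2)]
    have y: "y = x \<otimes> t [^] m \<oplus> n"
      unfolding y_def n_def x_def using cs by (simp add: r_distr m_assoc m_def)
    have yc: "y \<in> carrier R" unfolding y using cs by simp
    have yj: "y [^] j = \<zero>" using Cons.prems(3) by (simp add: y_def)
    obtain n' where n': "n' \<in> poly_span K t (m * j)" "y [^] j = x [^] j \<otimes> t [^] (m * j) \<oplus> n'"
      using poly_span_leading_pow[OF K t x n, of j] unfolding y by blast
    have "x [^] j \<otimes> t [^] (m * j) = \<ominus> n'"
      using n'(2) yj cs S'[OF n'(1)] sum_zero_eq_neg[of "x [^] j \<otimes> t [^] (m * j)" n'] by simp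
    then have xj: "x [^] j \<in> L"
      using poly_span_neg[OF K t n'(1)] subring_pow[OF K x] by (intro LI[of _ "m * j"]) auto
    obtain k :: nat and r where r: "r \<in> K" "x [^] Suc k = x [^] Suc k \<otimes> x [^] Suc k \<otimes> r"
      using reg[OF x] by blast
    define P where "P = x [^] Suc k"
    have P: "P \<in> K" unfolding P_def by (rule subring_pow[OF K x])
    \<comment> \<open>\<open>P \<otimes> r\<close> is idempotent; its complement \<open>u\<close>
      kills \<open>P\<close>, so \<open>u \<otimes> x\<close> is nilpotent.\<close>
    define u where "u = \<one> \<ominus> P \<otimes> r"
    have u: "u \<in> K" unfolding u_def a_minus_def using P r(1) by (intro KE)
    note cs' = cs K'[OF P] K'[OF r(1)] K'[OF u]
    have "u \<otimes> P = P \<ominus> P \<otimes> P \<otimes> r" unfolding u_def a_minus_def using K'[OF P] K'[OF r(1)]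
      by (simp add: l_distr r_distr l_minus r_minus m_ac)
    then have uP: "u \<otimes> P = \<zero>"
      using r(2)[folded P_def, symmetric] K'[OF P] by (simp add: r_neg a_minus_def)
    have "(u \<otimes> x) [^] Suc k = u [^] Suc k \<otimes> P"
      unfolding P_def by (rule nat_pow_distrib[OF K'[OF u] K'[OF x]])
    also have "\<dots> = u [^] k \<otimes> (u \<otimes> P)" using cs' by (simp add: m_assoc)
    finally have ux: "(u \<otimes> x) [^] Suc k = \<zero>" using cs' uP by simp
    have nil: "(u \<otimes> n) [^] (j + Suc k) = \<zero>"
    proof -
      have "(u \<otimes> y) [^] j = \<zero>" using cs' yc yj by (simp add: nat_pow_distrib)
      moreover have "(\<ominus> (t [^] m) \<otimes> (u \<otimes> x)) [^] Suc k = \<zero>"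
        using cs' ux nat_pow_distrib[of "\<ominus> (t [^] m)" "u \<otimes> x" "Suc k"] by simp
      \<comment> \<open>A sum of two nilpotents is nilpotent, which is \<open>pow_add_mem\<close>
        for \<open>H = {\<zero>}\<close>.\<close>
      ultimately have "(u \<otimes> y \<oplus> \<ominus> (t [^] m) \<otimes> (u \<otimes> x)) [^] (j + Suc k) \<in> {\<zero>}"
        using cs' yc by (intro pow_add_mem[OF carrier_is_subring]) auto
      moreover have "u \<otimes> y \<oplus> \<ominus> (t [^] m) \<otimes> (u \<otimes> x) = u \<otimes> n"
      proof -
        have "u \<otimes> (x \<otimes> v \<oplus> n) \<oplus> \<ominus> v \<otimes> (u \<otimes> x) = u \<otimes> n" if "v \<in> carrier R" for v
          using cs'(3,4,9) that by algebra
        then show ?thesis unfolding y using t by simp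
      qed
      ultimately show ?thesis by simp
    qed
    show ?case
    proof (cases "a = b")
      case True
      then show ?thesis using xj unfolding x_def by blast
    next
      case False
      then have ag: "a \<in> set g" using Cons.prems by auto
      then have a: "a \<in> K" using g by auto
      have us: "u \<otimes> s \<in> K" by (rule KE(6)[OF u s])
      have "(u \<otimes> s \<otimes> eval g t) [^] (j + Suc k) = \<zero>"
        using nil cs' by (simp add: n_def m_assoc)
      then obtain i :: nat where i: "(u \<otimes> s \<otimes> a) [^] i \<in> L"
        using Cons.IH[OF g(1) us _ ag] by blast
      note ac = K'[OF a]
      \<comment> \<open>\<open>s a\<close> is the sum of \<open>u s a\<close>, covered by the
        induction hypothesis, and \<open>P r s a = z x\<close>, a multiple of \<open>x\<close> with
        \<open>x^j \<in> L\<close>.\<close>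
      define z where "z = x [^] k \<otimes> (r \<otimes> (s \<otimes> a))"
      have z: "z \<in> K" unfolding z_def using r(1) s a subring_pow[OF K x] by (intro KE)
      have "(z \<otimes> x) [^] j = z [^] j \<otimes> x [^] j" using K'[OF z] cs by (simp add: nat_pow_distrib)
      then have zx: "(z \<otimes> x) [^] j \<in> L" using L_smult[OF subring_pow[OF K z] xj] by simp
      have "(u \<otimes> s \<otimes> a \<oplus> z \<otimes> x) [^] (i + j) \<in> L"
        using i zx by (intro pow_add_mem[OF K L_carrier L_add L_smult])
          (use KE(6) us a z x in auto)
      moreover have "z \<otimes> x = P \<otimes> r \<otimes> (s \<otimes> a)"
        unfolding z_def P_def using cs' ac by (simp add: m_ac)
      moreover have "u \<otimes> s \<otimes> a \<oplus> P \<otimes> r \<otimes> (s \<otimes> a) = s \<otimes> a"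
        unfolding u_def a_minus_def using cs'(1,7,8) ac
        by (simp add: l_distr l_minus m_assoc a_assoc l_neg)
      ultimately show ?thesis by auto
    qed
  qed simp
  have "(\<one> \<otimes> eval f t) [^] (1::nat) = \<zero>" using f(3) by simp
  from coeff[OF f(1) KE(3) this f(2)] obtain j :: nat where j: "(\<ominus> \<one>) [^] j \<in> L" by auto
  have "(\<ominus> \<one>) [^] j \<otimes> (\<ominus> \<one>) [^] j = (\<ominus> \<one> \<otimes> \<ominus> \<one>) [^] j"
    by (subst nat_pow_distrib) auto
  also have "\<dots> = \<one>" by (simp add: l_minus nat_pow_one)
  finally have "\<one> \<in> L" using L_smult[OF subring_pow[OF K KE(5)[OF KE(3)]] j] by metis
  then obtain m :: nat where "\<one> \<otimes> t [^] m \<in> poly_span K t m" unfolding L_def by blast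
  then show ?thesis using integral_over_iff_poly_span[OF K t] t by auto
qed

lemma ideal_if_closed:
  assumes "I \<subseteq> carrier R" "\<zero> \<in> I" "\<And>a b. a \<in> I \<Longrightarrow> b \<in> I \<Longrightarrow> a \<oplus> b \<in> I"
    and mult: "\<And>a x. a \<in> I \<Longrightarrow> x \<in> carrier R \<Longrightarrow> x \<otimes> a \<in> I"
  shows "ideal I R"
proof (rule idealI[OF ring_axioms])
  have neg: "\<ominus> a \<in> I" if "a \<in> I" for a
    using mult[OF that, of "\<ominus> \<one>"] assms(1) that by (auto simp: l_minus)
  show "subgroup I (add_monoid R)"
    by (rule add.subgroupI) (use assms neg in \<open>auto simp flip: a_inv_def\<close>)
  show "x \<otimes> a \<in> I" "a \<otimes> x \<in> I" if "a \<in> I" "x \<in> carrier R" for a x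
    using mult[OF that] that assms(1) by (auto simp: m_comm subset_iff)
qed

end

lemma (in ring_hom_ring) integral_over_image:
  assumes "subring K R" "x \<in> carrier R" "integral_over K R x"
  shows "integral_over (h ` K) S (h x)"
proof -
  obtain p where p: "set p \<subseteq> K" "R.eval (\<one>\<^bsub>R\<^esub> # p) x = \<zero>\<^bsub>R\<^esub>"
    using assms(3) unfolding integral_over_def by blast
  have "set (\<one>\<^bsub>R\<^esub> # p) \<subseteq> carrier R" using p(1) subringE(1)[OF assms(1)] by auto
  from eval_hom'[OF assms(2) this] have "S.eval (\<one>\<^bsub>S\<^esub> # map h p) (h x) = \<zero>\<^bsub>S\<^esub>"
    using p(2) by (simp del: S.eval.simps R.eval.simps)
  then show ?thesis unfolding integral_over_def using p(1) by (intro exI[of _ "map h p"]) auto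
qed

section \<open>Reduction modulo the conductor of an intersection\<close>

context cring
begin

text \<open>Modulo the conductor of \<open>U \<inter> V\<close>, powers of elements of \<open>U \<inter> V\<close> have quasi-inverses. These are
  unique, and by integrality they lie in \<open>U\<close> as well as in \<open>V\<close>.\<close>

lemma integral_ext_Int:
  assumes U: "subring U R" and V: "subring V R" and FCP: "FCP (U \<inter> V) R"
    and intU: "integral_ext U R" and intV: "integral_ext V R"
  shows "integral_ext (U \<inter> V) R"
proof -
  define W where "W = U \<inter> V"
  note U' = subring_mem[OF U]
  have W: "subring W R"
    unfolding W_def by (rule subring_Int[OF U V])
  note WE = subringE[OF W] and W' = subring_mem[OF W]
  have FCP_UV: "FCP U R" "FCP V R" using FCP_mono[OF FCP] by auto
  \<comment> \<open>The conductor is an ideal of the whole ring inside \<open>W\<close>, so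
    membership in subrings above \<open>W\<close> can be tested modulo \<open>I\<close>.\<close>
  define I where "I = {s \<in> carrier R. \<forall>z\<in>carrier R. s \<otimes> z \<in> W}"
  have I: "ideal I R"
  proof (rule ideal_if_closed)
    show "I \<subseteq> carrier R" "\<zero> \<in> I" using WE(2) by (auto simp: I_def)
    show "a \<oplus> b \<in> I" if "a \<in> I" "b \<in> I" for a b
      using that WE(7) by (simp add: I_def l_distr)
    show "x \<otimes> a \<in> I" if "a \<in> I" "x \<in> carrier R" for a x
    proof -
      have "x \<otimes> a \<otimes> z = a \<otimes> (x \<otimes> z)" if "z \<in> carrier R" for z
        using that \<open>a \<in> I\<close> \<open>x \<in> carrier R\<close> by (simp add: I_def m_ac)
      then show ?thesis using that by (simp add: I_def)
    qed
  qed
  have IW: "s \<in> W" if "s \<in> I" for s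
    using that r_one[of s] unfolding I_def by (metis (mono_tags, lifting) mem_Collect_eq one_closed)
  define h where "h = (+>) I"
  define D where "D = R Quot I"
  interpret D: cring D unfolding D_def by (rule ideal.quotient_is_cring[OF I is_cring])
  interpret h: ring_hom_ring R D h
    unfolding D_def h_def by (rule ideal.rcos_ring_hom_ring[OF I])
  have h_eq: "h a = h b \<longleftrightarrow> a \<ominus> b \<in> I" if "a \<in> carrier R" "b \<in> carrier R" for a b
    unfolding h_def using quotient_eq_iff_same_a_r_cos[OF I that] by simp
  have h_mem: "a \<in> A" if "subring A R" "W \<subseteq> A" "b \<in> A" "a \<in> carrier R" "h a = h b" for a b A
  proof -
    have b: "b \<in> carrier R" using subring_mem that by blast
    have "a \<ominus> b \<in> A" using h_eq[OF that(4) b] that IW by auto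
    then have "(a \<ominus> b) \<oplus> b \<in> A" using subringE(7)[OF that(1)] that by blast
    moreover have "(a \<ominus> b) \<oplus> b = a" using that b by (simp add: a_minus_def a_assoc l_neg)
    ultimately show ?thesis by simp
  qed
  have hW: "subring (h ` W) D" by (rule h.img_is_subring[OF W])
  have regular: "\<exists>n::nat. \<exists>r\<in>h ` W. y [^]\<^bsub>D\<^esub> Suc n = y [^]\<^bsub>D\<^esub> Suc n \<otimes>\<^bsub>D\<^esub> y [^]\<^bsub>D\<^esub> Suc n \<otimes>\<^bsub>D\<^esub> r"
    if y: "y \<in> h ` W" for y
  proof -
    obtain x where x: "x \<in> W" "y = h x" using y by blast
    have xUV: "x \<in> U" "x \<in> V" and xc: "x \<in> carrier R" using x(1) U' by (auto simp: W_def)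
    obtain N q where q: "q \<in> carrier R" "\<forall>s\<in>carrier R. x [^] (N::nat) \<otimes> (\<one> \<ominus> x \<otimes> q) \<otimes> s \<in> U"
      using FCP_integral_conductor[OF U FCP_UV(1) intU xUV(1)] by blast
    obtain N' q' where q': "q' \<in> carrier R" "\<forall>s\<in>carrier R. x [^] (N'::nat) \<otimes> (\<one> \<ominus> x \<otimes> q') \<otimes> s \<in> V"
      using FCP_integral_conductor[OF V FCP_UV(2) intV xUV(2)] by blast
    \<comment> \<open>\<open>c\<close> moves the whole ring into \<open>U\<close> and
      \<open>c'\<close> into \<open>V\<close>, so \<open>c \<otimes> c'\<close> lies in the
      conductor. In the quotient this reads \<open>y^M = y^(M+1) (h Q)\<close>.\<close>
    define c where "c = x [^] N \<otimes> (\<one> \<ominus> x \<otimes> q)"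
    define c' where "c' = x [^] N' \<otimes> (\<one> \<ominus> x \<otimes> q')"
    have cc: "c \<in> carrier R" "c' \<in> carrier R" using xc q(1) q'(1) by (auto simp: c_def c'_def)
    have "c \<otimes> c' \<otimes> z \<in> W" if "z \<in> carrier R" for z
    proof -
      have "c \<otimes> c' \<otimes> z = c \<otimes> (c' \<otimes> z)" "c \<otimes> c' \<otimes> z = c' \<otimes> (c \<otimes> z)" using cc that by (simp_all add: m_ac)
      moreover have "c \<otimes> (c' \<otimes> z) \<in> U" "c' \<otimes> (c \<otimes> z) \<in> V"
        using q(2) q'(2) cc that unfolding c_def[symmetric] c'_def[symmetric] by auto
      ultimately show ?thesis unfolding W_def by (metis IntI)
    qed
    then have "c \<otimes> c' \<in> I" using cc by (simp add: I_def)
    define M where "M = N + N'"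
    define Q where "Q = q \<oplus> q' \<ominus> x \<otimes> q \<otimes> q'"
    have Q: "Q \<in> carrier R" using q(1) q'(1) xc by (simp add: Q_def)
    have "(\<one> \<ominus> x \<otimes> q) \<otimes> (\<one> \<ominus> x \<otimes> q') = \<one> \<ominus> x \<otimes> Q"
      unfolding Q_def using q(1) q'(1) xc by algebra
    moreover have "c \<otimes> c' = x [^] M \<otimes> ((\<one> \<ominus> x \<otimes> q) \<otimes> (\<one> \<ominus> x \<otimes> q'))"
    proof -
      have "\<one> \<ominus> x \<otimes> q \<in> carrier R" "\<one> \<ominus> x \<otimes> q' \<in> carrier R" using q(1) q'(1) xc by auto
      then show ?thesis unfolding c_def c'_def M_def using xc by (simp add: m_ac flip: nat_pow_mult)
    qed
    ultimately have "c \<otimes> c' = x [^] M \<ominus> x [^] Suc M \<otimes> Q"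
      using xc Q by (simp add: a_minus_def r_distr r_minus m_assoc)
    then have "h (x [^] M) = h (x [^] Suc M \<otimes> Q)"
      using \<open>c \<otimes> c' \<in> I\<close> h_eq[of "x [^] M" "x [^] Suc M \<otimes> Q"] xc Q
      by (metis m_closed nat_pow_closed)
    then have step: "y [^]\<^bsub>D\<^esub> M = y [^]\<^bsub>D\<^esub> Suc M \<otimes>\<^bsub>D\<^esub> h Q"
      using xc Q x(2) by (simp add: h.hom_nat_pow)
    have yc: "y \<in> carrier D" "h Q \<in> carrier D" using x(2) xc Q by auto
    have iter: "y [^]\<^bsub>D\<^esub> M = y [^]\<^bsub>D\<^esub> (M + k) \<otimes>\<^bsub>D\<^esub> h Q [^]\<^bsub>D\<^esub> k" for k
    proof (induction k)
      case (Suc k)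
      have "y [^]\<^bsub>D\<^esub> (M + k) = y [^]\<^bsub>D\<^esub> M \<otimes>\<^bsub>D\<^esub> y [^]\<^bsub>D\<^esub> k"
        by (rule D.nat_pow_mult[OF yc(1), symmetric])
      also have "\<dots> = (y [^]\<^bsub>D\<^esub> Suc M \<otimes>\<^bsub>D\<^esub> h Q) \<otimes>\<^bsub>D\<^esub> y [^]\<^bsub>D\<^esub> k" by (simp only: step)
      also have "\<dots> = (y [^]\<^bsub>D\<^esub> Suc M \<otimes>\<^bsub>D\<^esub> y [^]\<^bsub>D\<^esub> k) \<otimes>\<^bsub>D\<^esub> h Q" using yc by (simp add: D.m_ac)
      also have "y [^]\<^bsub>D\<^esub> Suc M \<otimes>\<^bsub>D\<^esub> y [^]\<^bsub>D\<^esub> k = y [^]\<^bsub>D\<^esub> (M + Suc k)"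
        using D.nat_pow_mult[OF yc(1), of "Suc M" k] by simp
      finally have e: "y [^]\<^bsub>D\<^esub> (M + k) = y [^]\<^bsub>D\<^esub> (M + Suc k) \<otimes>\<^bsub>D\<^esub> h Q" .
      have "y [^]\<^bsub>D\<^esub> M = (y [^]\<^bsub>D\<^esub> (M + Suc k) \<otimes>\<^bsub>D\<^esub> h Q) \<otimes>\<^bsub>D\<^esub> h Q [^]\<^bsub>D\<^esub> k"
        by (subst Suc.IH, subst e, rule refl)
      also have "\<dots> = y [^]\<^bsub>D\<^esub> (M + Suc k) \<otimes>\<^bsub>D\<^esub> h Q [^]\<^bsub>D\<^esub> Suc k"
        using yc by (simp add: D.m_ac)
      finally show ?case .
    qed (use yc in simp)
    define P where "P = y [^]\<^bsub>D\<^esub> Suc M"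
    define Z where "Z = h Q [^]\<^bsub>D\<^esub> Suc M"
    \<comment> \<open>Iteration gives \<open>P P Z = P\<close>; passing to \<open>P Z Z\<close>
      keeps this identity and adds \<open>P r r = r\<close>, the second property of a
      quasi-inverse.\<close>
    define r where "r = P \<otimes>\<^bsub>D\<^esub> Z \<otimes>\<^bsub>D\<^esub> Z"
    have PZ: "P \<in> carrier D" "Z \<in> carrier D" "r \<in> carrier D"
      using yc by (auto simp: P_def Z_def r_def)
    have PPZ: "P \<otimes>\<^bsub>D\<^esub> P \<otimes>\<^bsub>D\<^esub> Z = P"
    proof -
      have "P = y \<otimes>\<^bsub>D\<^esub> y [^]\<^bsub>D\<^esub> M" using yc by (simp add: P_def D.m_comm)
      also have "\<dots> = y \<otimes>\<^bsub>D\<^esub> y [^]\<^bsub>D\<^esub> (M + Suc M) \<otimes>\<^bsub>D\<^esub> Z"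
        unfolding Z_def iter[of "Suc M"] using yc by (intro D.m_assoc[symmetric] D.nat_pow_closed)
      also have "y \<otimes>\<^bsub>D\<^esub> y [^]\<^bsub>D\<^esub> (M + Suc M) = P \<otimes>\<^bsub>D\<^esub> P"
        unfolding P_def using yc D.nat_pow_mult[of y "Suc M" "Suc M"] by (simp add: D.m_comm)
      finally show ?thesis by simp
    qed
    have "P \<otimes>\<^bsub>D\<^esub> P \<otimes>\<^bsub>D\<^esub> r = P \<otimes>\<^bsub>D\<^esub> (P \<otimes>\<^bsub>D\<^esub> P \<otimes>\<^bsub>D\<^esub> Z) \<otimes>\<^bsub>D\<^esub> Z"
      unfolding r_def using PZ by (simp add: D.m_ac)
    then have PPr: "P \<otimes>\<^bsub>D\<^esub> P \<otimes>\<^bsub>D\<^esub> r = P" by (simp only: PPZ)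
    have "P \<otimes>\<^bsub>D\<^esub> r \<otimes>\<^bsub>D\<^esub> r = (P \<otimes>\<^bsub>D\<^esub> (P \<otimes>\<^bsub>D\<^esub> P \<otimes>\<^bsub>D\<^esub> Z) \<otimes>\<^bsub>D\<^esub> Z) \<otimes>\<^bsub>D\<^esub> Z \<otimes>\<^bsub>D\<^esub> Z"
      unfolding r_def using PZ by (simp add: D.m_ac)
    then have Prr: "P \<otimes>\<^bsub>D\<^esub> r \<otimes>\<^bsub>D\<^esub> r = r" by (simp only: PPZ r_def)
    define r0 where "r0 = x [^] Suc M \<otimes> Q [^] Suc M \<otimes> Q [^] Suc M"
    have r0: "r0 \<in> carrier R" "h r0 = r"
      using xc Q by (auto simp: r0_def r_def P_def Z_def x(2) h.hom_nat_pow)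
    \<comment> \<open>The kernel \<open>I\<close> lies in \<open>A\<close>, so a lift of
      \<open>r\<close> belongs to \<open>A\<close> as soon as \<open>r\<close> belongs to the image
      of \<open>A\<close>. In this way the same \<open>r0\<close> is found in \<open>U\<close> and
      in \<open>V\<close>.\<close>
    have mem: "r0 \<in> A" if A: "subring A R" "W \<subseteq> A" "integral_ext A R" for A
    proof -
      have "P \<in> h ` A" unfolding P_def
        using that x D.subring_pow[OF h.img_is_subring[OF A(1)]] by blast
      moreover have "integral_over (h ` A) D r"
        using h.integral_over_image[OF A(1) r0(1)] A(3) r0 by (simp add: integral_ext_def)
      ultimately have "r \<in> h ` A"
        using D.integral_quasi_inverse_mem[OF h.img_is_subring[OF A(1)] PZ(3) _ _ PPr Prr] by blast
      then show ?thesis using h_mem[OF A(1,2) _ r0(1)] r0(2) by auto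
    qed
    have "r0 \<in> W" using mem[OF U _ intU] mem[OF V _ intV] by (auto simp: W_def)
    then have "r \<in> h ` W" using r0(2) by blast
    then show ?thesis using PPr unfolding P_def by metis
  qed
  have "integral_over W R t" if t: "t \<in> carrier R" for t
  proof -
    obtain f where f: "set f \<subseteq> W" "\<ominus> \<one> \<in> set f" "eval f t = \<zero>"
      using FCP_relation[OF W FCP[folded W_def] t] by blast
    have "D.eval (map h f) (h t) = \<zero>\<^bsub>D\<^esub>"
      using h.eval_hom'[OF t, of f] f WE(1) by auto
    moreover have "\<ominus>\<^bsub>D\<^esub> \<one>\<^bsub>D\<^esub> \<in> set (map h f)"
    proof -
      have "h (\<ominus> \<one>) = \<ominus>\<^bsub>D\<^esub> \<one>\<^bsub>D\<^esub>" by simp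
      then show ?thesis using f(2) by (simp add: rev_image_eqI)
    qed
    ultimately have "integral_over (h ` W) D (h t)"
      using f(1) t by (intro D.pi_regular_integral[OF hW _ regular, of _ "map h f"]) auto
    then obtain m0 :: nat where m0: "h t [^]\<^bsub>D\<^esub> m0 \<in> D.poly_span (h ` W) (h t) m0"
      using D.integral_over_iff_poly_span[OF hW, of "h t"] t by auto
    \<comment> \<open>Positivity of \<open>m\<close> gives
      \<open>W \<subseteq> poly_span W t m\<close>; the error in \<open>I\<close> that arises on
      lifting the equation is absorbed there.\<close>
    define m where "m = Suc m0"
    have "h t [^]\<^bsub>D\<^esub> m \<in> D.poly_span (h ` W) (h t) m"
      using D.poly_span_times_gen[OF hW _ m0] t by (simp add: m_def D.m_comm)
    then obtain p' where p': "set p' \<subseteq> h ` W" "length p' = m" "h t [^]\<^bsub>D\<^esub> m = D.eval p' (h t)"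
      by (auto simp: D.poly_span_def)
    obtain p where p: "set p \<subseteq> W" "p' = map h p"
    proof (rule that)
      show "set (map (inv_into W h) p') \<subseteq> W" using p'(1) by (auto intro: inv_into_into)
      show "p' = map h (map (inv_into W h) p')"
        using p'(1) by (auto intro!: map_idI[symmetric] simp: f_inv_into_f subset_iff)
    qed
    have e: "eval p t \<in> poly_span W t m" using p p'(2) by (auto simp: poly_span_def)
    have ec: "eval p t \<in> carrier R" by (rule poly_span_carrier[OF W t e])
    have "h (t [^] m) = h (eval p t)"
      using p'(3) h.eval_hom'[OF t, of p] p WE(1) t by (auto simp: h.hom_nat_pow)
    then have "t [^] m \<ominus> eval p t \<in> W" using h_eq[of "t [^] m" "eval p t"] t ec IW by auto
    then have "t [^] m \<ominus> eval p t \<in> poly_span W t m"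
      using poly_span_1[OF W t] poly_span_mono[OF W t, of 1 m] by (auto simp: m_def)
    then have "(t [^] m \<ominus> eval p t) \<oplus> eval p t \<in> poly_span W t m"
      by (rule poly_span_add[OF W t _ e])
    moreover have "(t [^] m \<ominus> eval p t) \<oplus> eval p t = t [^] m"
      using ec t by (simp add: a_minus_def a_assoc l_neg)
    ultimately show ?thesis using integral_over_iff_poly_span[OF W t] by auto
  qed
  then show ?thesis unfolding integral_ext_def W_def by blast
qed

end

section \<open>Integral epimorphisms\<close>

definition (in ring) commutant :: "'a set \<Rightarrow> 'a set"
  where "commutant A = {a \<in> carrier R. \<forall>x\<in>A. a \<otimes> x = x \<otimes> a}"

lemma (in ring) commutant_subring:
  assumes "A \<subseteq> carrier R"
  shows "subring (commutant A) R"
proof (rule subringI)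
  have A: "x \<in> carrier R" if "x \<in> A" for x using that assms by auto
  show "commutant A \<subseteq> carrier R" "\<one> \<in> commutant A" using A by (auto simp: commutant_def)
  show "\<ominus> a \<in> commutant A" if "a \<in> commutant A" for a
    using that A by (simp add: commutant_def l_minus r_minus)
  fix a b assume ab: "a \<in> commutant A" "b \<in> commutant A"
  show "a \<oplus> b \<in> commutant A" using ab A by (simp add: commutant_def l_distr r_distr)
  show "a \<otimes> b \<in> commutant A"
    unfolding commutant_def
  proof (intro CollectI conjI ballI)
    show "a \<otimes> b \<in> carrier R" using ab by (simp add: commutant_def)
    fix x assume x: "x \<in> A"
    have "a \<otimes> b \<otimes> x = a \<otimes> (x \<otimes> b)" using ab x A by (simp add: commutant_def m_assoc)
    also have "\<dots> = a \<otimes> x \<otimes> b"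
      using ab x A by (intro m_assoc[symmetric]) (auto simp: commutant_def)
    also have "a \<otimes> x = x \<otimes> a" using ab x by (simp add: commutant_def)
    also have "x \<otimes> a \<otimes> b = x \<otimes> (a \<otimes> b)" using ab x A by (simp add: commutant_def m_assoc)
    finally show "a \<otimes> b \<otimes> x = x \<otimes> (a \<otimes> b)" .
  qed
qed

text \<open>A commuting set lies in its commutant, so its bicommutant lies there too and is
  commutative. It serves as a commutative target inside a noncommutative endomorphism ring.\<close>

lemma (in ring) bicommutant_cring:
  assumes A: "A \<subseteq> carrier R" and comm: "\<And>x y. x \<in> A \<Longrightarrow> y \<in> A \<Longrightarrow> x \<otimes> y = y \<otimes> x"
  shows "cring (R\<lparr>carrier := commutant (commutant A)\<rparr>)" "A \<subseteq> commutant (commutant A)"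
proof -
  let ?C = "commutant (commutant A)"
  have C: "subring ?C R" by (rule commutant_subring) (auto simp: commutant_def)
  show "A \<subseteq> ?C" using A by (auto simp: commutant_def)
  have "A \<subseteq> commutant A" using A comm by (auto simp: commutant_def)
  then have "?C \<subseteq> commutant A" by (auto simp: commutant_def)
  then have "a \<otimes> b = b \<otimes> a" if "a \<in> ?C" "b \<in> ?C" for a b
    using that by (auto simp: commutant_def)
  then have "subcring ?C R" using C by (simp add: subcring_def subcring_axioms_def)
  then show "cring (R\<lparr>carrier := ?C\<rparr>)"
    using subcring_iff[OF subringE(1)[OF C]] by simp
qed

text \<open>Functions are extensional, so that an endomorphism is determined by its values on the
  carrier.\<close>

definition endo_ring :: "('e, 'x) ring_scheme \<Rightarrow> ('e \<Rightarrow> 'e) ring"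
  where "endo_ring G =
    \<lparr>carrier = {\<phi> \<in> carrier G \<rightarrow>\<^sub>E carrier G.
       \<forall>x\<in>carrier G. \<forall>y\<in>carrier G. \<phi> (x \<oplus>\<^bsub>G\<^esub> y) = \<phi> x \<oplus>\<^bsub>G\<^esub> \<phi> y},
     monoid.mult = compose (carrier G), one = (\<lambda>x\<in>carrier G. x),
     ring.zero = (\<lambda>x\<in>carrier G. \<zero>\<^bsub>G\<^esub>), add = (\<lambda>\<phi> \<psi>. \<lambda>x\<in>carrier G. \<phi> x \<oplus>\<^bsub>G\<^esub> \<psi> x)\<rparr>"

lemma endo_ringD:
  assumes "\<phi> \<in> carrier (endo_ring G)"
  shows "x \<in> carrier G \<Longrightarrow> \<phi> x \<in> carrier G" "\<phi> \<in> extensional (carrier G)"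
    "x \<in> carrier G \<Longrightarrow> y \<in> carrier G \<Longrightarrow> \<phi> (x \<oplus>\<^bsub>G\<^esub> y) = \<phi> x \<oplus>\<^bsub>G\<^esub> \<phi> y"
  using assms by (auto simp: endo_ring_def PiE_def)

lemma endo_ringI:
  assumes "\<And>x. x \<in> carrier G \<Longrightarrow> \<phi> x \<in> carrier G" "\<phi> \<in> extensional (carrier G)"
    "\<And>x y. x \<in> carrier G \<Longrightarrow> y \<in> carrier G \<Longrightarrow> \<phi> (x \<oplus>\<^bsub>G\<^esub> y) = \<phi> x \<oplus>\<^bsub>G\<^esub> \<phi> y"
  shows "\<phi> \<in> carrier (endo_ring G)"
  using assms by (auto simp: endo_ring_def PiE_def)

lemma endo_ring_eqI:
  assumes "\<phi> \<in> extensional (carrier G)" "\<psi> \<in> extensional (carrier G)"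
    "\<And>x. x \<in> carrier G \<Longrightarrow> \<phi> x = \<psi> x"
  shows "\<phi> = \<psi>"
  using assms by (rule extensionalityI)

lemma endo_ring_ops:
  "x \<in> carrier G \<Longrightarrow> (\<phi> \<otimes>\<^bsub>endo_ring G\<^esub> \<psi>) x = \<phi> (\<psi> x)"
  "x \<in> carrier G \<Longrightarrow> (\<phi> \<oplus>\<^bsub>endo_ring G\<^esub> \<psi>) x = \<phi> x \<oplus>\<^bsub>G\<^esub> \<psi> x"
  "x \<in> carrier G \<Longrightarrow> \<one>\<^bsub>endo_ring G\<^esub> x = x"
  "x \<in> carrier G \<Longrightarrow> \<zero>\<^bsub>endo_ring G\<^esub> x = \<zero>\<^bsub>G\<^esub>"
  "(\<phi> \<otimes>\<^bsub>endo_ring G\<^esub> \<psi>) \<in> extensional (carrier G)"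
  "(\<phi> \<oplus>\<^bsub>endo_ring G\<^esub> \<psi>) \<in> extensional (carrier G)"
  "\<one>\<^bsub>endo_ring G\<^esub> \<in> extensional (carrier G)"
  "\<zero>\<^bsub>endo_ring G\<^esub> \<in> extensional (carrier G)"
  by (auto simp: endo_ring_def compose_def)

lemma endo_ring_ring:
  assumes "abelian_group G"
  shows "ring (endo_ring G)"
proof -
  interpret G: abelian_group G by fact
  let ?E = "endo_ring G"
  note D = endo_ringD and ops = endo_ring_ops
  have cl: "\<phi> \<otimes>\<^bsub>?E\<^esub> \<psi> \<in> carrier ?E" "\<phi> \<oplus>\<^bsub>?E\<^esub> \<psi> \<in> carrier ?E"
    if "\<phi> \<in> carrier ?E" "\<psi> \<in> carrier ?E" for \<phi> \<psi>
    by (rule endo_ringI; use that in \<open>simp add: ops D G.a_ac\<close>)+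
  have one: "\<one>\<^bsub>?E\<^esub> \<in> carrier ?E" "\<zero>\<^bsub>?E\<^esub> \<in> carrier ?E"
    by (rule endo_ringI; simp add: ops)+
  show ?thesis
  proof (rule ringI)
    show "abelian_group ?E"
    proof (rule abelian_groupI)
      fix \<phi> assume \<phi>: "\<phi> \<in> carrier ?E"
      let ?n = "\<lambda>x\<in>carrier G. \<ominus>\<^bsub>G\<^esub> \<phi> x"
      have "?n \<in> carrier ?E" by (rule endo_ringI) (use \<phi> in \<open>simp_all add: D G.minus_add\<close>)
      moreover have "?n \<oplus>\<^bsub>?E\<^esub> \<phi> = \<zero>\<^bsub>?E\<^esub>"
        by (rule endo_ring_eqI[of _ G]) (use \<phi> in \<open>simp_all add: ops D G.l_neg\<close>)
      ultimately show "\<exists>\<psi>\<in>carrier ?E. \<psi> \<oplus>\<^bsub>?E\<^esub> \<phi> = \<zero>\<^bsub>?E\<^esub>" by blast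
      show "\<zero>\<^bsub>?E\<^esub> \<oplus>\<^bsub>?E\<^esub> \<phi> = \<phi>" by (rule endo_ring_eqI[of _ G]) (use \<phi> in \<open>simp_all add: ops D\<close>)
    next
      fix \<phi> \<psi> assume "\<phi> \<in> carrier ?E" "\<psi> \<in> carrier ?E"
      then show "\<phi> \<oplus>\<^bsub>?E\<^esub> \<psi> = \<psi> \<oplus>\<^bsub>?E\<^esub> \<phi>" by (intro endo_ring_eqI[of _ G]) (simp_all add: ops D G.a_comm)
    next
      fix \<phi> \<psi> \<chi> assume "\<phi> \<in> carrier ?E" "\<psi> \<in> carrier ?E" "\<chi> \<in> carrier ?E"
      then show "\<phi> \<oplus>\<^bsub>?E\<^esub> \<psi> \<oplus>\<^bsub>?E\<^esub> \<chi> = \<phi> \<oplus>\<^bsub>?E\<^esub> (\<psi> \<oplus>\<^bsub>?E\<^esub> \<chi>)"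
        by (intro endo_ring_eqI[of _ G]) (simp_all add: ops D G.a_assoc)
    qed (use cl one in auto)
    show "monoid ?E"
    proof (rule monoidI)
      fix \<phi> \<psi> \<chi> assume "\<phi> \<in> carrier ?E" "\<psi> \<in> carrier ?E" "\<chi> \<in> carrier ?E"
      then show "\<phi> \<otimes>\<^bsub>?E\<^esub> \<psi> \<otimes>\<^bsub>?E\<^esub> \<chi> = \<phi> \<otimes>\<^bsub>?E\<^esub> (\<psi> \<otimes>\<^bsub>?E\<^esub> \<chi>)"
        by (intro endo_ring_eqI[of _ G]) (simp_all add: ops D)
    next
      fix \<phi> assume "\<phi> \<in> carrier ?E"
      then show "\<one>\<^bsub>?E\<^esub> \<otimes>\<^bsub>?E\<^esub> \<phi> = \<phi>" "\<phi> \<otimes>\<^bsub>?E\<^esub> \<one>\<^bsub>?E\<^esub> = \<phi>"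
        by (intro endo_ring_eqI[of _ G]; simp add: ops D)+
    qed (use cl one in auto)
    fix \<phi> \<psi> \<chi> assume "\<phi> \<in> carrier ?E" "\<psi> \<in> carrier ?E" "\<chi> \<in> carrier ?E"
    then show "(\<phi> \<oplus>\<^bsub>?E\<^esub> \<psi>) \<otimes>\<^bsub>?E\<^esub> \<chi> = \<phi> \<otimes>\<^bsub>?E\<^esub> \<chi> \<oplus>\<^bsub>?E\<^esub> \<psi> \<otimes>\<^bsub>?E\<^esub> \<chi>"
      "\<chi> \<otimes>\<^bsub>?E\<^esub> (\<phi> \<oplus>\<^bsub>?E\<^esub> \<psi>) = \<chi> \<otimes>\<^bsub>?E\<^esub> \<phi> \<oplus>\<^bsub>?E\<^esub> \<chi> \<otimes>\<^bsub>?E\<^esub> \<psi>"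
      by (intro endo_ring_eqI[of _ G]; simp add: ops D)+
  qed
qed

text \<open>Forms vanish outside \<open>B \<times> B\<close>, so that pointwise operations make them an abelian group.\<close>

definition balanced_forms ::
    "'a set \<Rightarrow> ('a, 'b) ring_scheme \<Rightarrow> ('d, 'e) ring_scheme \<Rightarrow> ('a \<Rightarrow> 'a \<Rightarrow> 'd) ring"
  where "balanced_forms K B D =
    \<lparr>carrier = {\<beta>. (\<forall>y z. \<beta> y z \<in> carrier D) \<and>
       (\<forall>y z. y \<notin> carrier B \<or> z \<notin> carrier B \<longrightarrow> \<beta> y z = \<zero>\<^bsub>D\<^esub>) \<and>
       (\<forall>x\<in>carrier B. \<forall>y\<in>carrier B. \<forall>z\<in>carrier B. \<beta> (x \<oplus>\<^bsub>B\<^esub> y) z = \<beta> x z \<oplus>\<^bsub>D\<^esub> \<beta> y z) \<and>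
       (\<forall>x\<in>carrier B. \<forall>y\<in>carrier B. \<forall>z\<in>carrier B. \<beta> x (y \<oplus>\<^bsub>B\<^esub> z) = \<beta> x y \<oplus>\<^bsub>D\<^esub> \<beta> x z) \<and>
       (\<forall>a\<in>K. \<forall>y\<in>carrier B. \<forall>z\<in>carrier B. \<beta> (a \<otimes>\<^bsub>B\<^esub> y) z = \<beta> y (a \<otimes>\<^bsub>B\<^esub> z))},
     monoid.mult = undefined, one = undefined,
     ring.zero = (\<lambda>y z. \<zero>\<^bsub>D\<^esub>), add = (\<lambda>\<beta> \<gamma> y z. \<beta> y z \<oplus>\<^bsub>D\<^esub> \<gamma> y z)\<rparr>"

lemma balanced_formsD:
  assumes "\<beta> \<in> carrier (balanced_forms K B D)"
  shows "\<beta> y z \<in> carrier D"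
    "y \<notin> carrier B \<or> z \<notin> carrier B \<Longrightarrow> \<beta> y z = \<zero>\<^bsub>D\<^esub>"
    "x \<in> carrier B \<Longrightarrow> y \<in> carrier B \<Longrightarrow> z \<in> carrier B \<Longrightarrow> \<beta> (x \<oplus>\<^bsub>B\<^esub> y) z = \<beta> x z \<oplus>\<^bsub>D\<^esub> \<beta> y z"
    "x \<in> carrier B \<Longrightarrow> y \<in> carrier B \<Longrightarrow> z \<in> carrier B \<Longrightarrow> \<beta> x (y \<oplus>\<^bsub>B\<^esub> z) = \<beta> x y \<oplus>\<^bsub>D\<^esub> \<beta> x z"
    "a \<in> K \<Longrightarrow> y \<in> carrier B \<Longrightarrow> z \<in> carrier B \<Longrightarrow> \<beta> (a \<otimes>\<^bsub>B\<^esub> y) z = \<beta> y (a \<otimes>\<^bsub>B\<^esub> z)"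
  using assms by (simp_all add: balanced_forms_def)

lemma balanced_formsI:
  assumes "\<And>y z. \<beta> y z \<in> carrier D"
    "\<And>y z. y \<notin> carrier B \<or> z \<notin> carrier B \<Longrightarrow> \<beta> y z = \<zero>\<^bsub>D\<^esub>"
    "\<And>x y z. x \<in> carrier B \<Longrightarrow> y \<in> carrier B \<Longrightarrow> z \<in> carrier B \<Longrightarrow>
      \<beta> (x \<oplus>\<^bsub>B\<^esub> y) z = \<beta> x z \<oplus>\<^bsub>D\<^esub> \<beta> y z"
    "\<And>x y z. x \<in> carrier B \<Longrightarrow> y \<in> carrier B \<Longrightarrow> z \<in> carrier B \<Longrightarrow>
      \<beta> x (y \<oplus>\<^bsub>B\<^esub> z) = \<beta> x y \<oplus>\<^bsub>D\<^esub> \<beta> x z"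
    "\<And>a y z. a \<in> K \<Longrightarrow> y \<in> carrier B \<Longrightarrow> z \<in> carrier B \<Longrightarrow> \<beta> (a \<otimes>\<^bsub>B\<^esub> y) z = \<beta> y (a \<otimes>\<^bsub>B\<^esub> z)"
  shows "\<beta> \<in> carrier (balanced_forms K B D)"
  unfolding balanced_forms_def using assms by simp

lemma balanced_forms_ops:
  "\<beta> \<oplus>\<^bsub>balanced_forms K B D\<^esub> \<gamma> = (\<lambda>y z. \<beta> y z \<oplus>\<^bsub>D\<^esub> \<gamma> y z)"
  "\<zero>\<^bsub>balanced_forms K B D\<^esub> = (\<lambda>y z. \<zero>\<^bsub>D\<^esub>)"
  by (simp_all add: balanced_forms_def)

lemma balanced_forms_abelian_group:
  assumes B: "cring B" and D: "abelian_group D"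
  shows "abelian_group (balanced_forms K B D)"
proof -
  interpret B: cring B by fact
  interpret D: abelian_group D by fact
  let ?G = "balanced_forms K B D"
  note F = balanced_formsD and ops = balanced_forms_ops
  show ?thesis
  proof (rule abelian_groupI)
    fix \<beta> \<gamma> assume \<beta>: "\<beta> \<in> carrier ?G" and \<gamma>: "\<gamma> \<in> carrier ?G"
    show "\<beta> \<oplus>\<^bsub>?G\<^esub> \<gamma> \<in> carrier ?G"
      unfolding ops
      by (rule balanced_formsI)
        (auto simp: F(1,2)[OF \<beta>] F(1,2)[OF \<gamma>] F(3-5)[OF \<beta>] F(3-5)[OF \<gamma>] D.a_ac)
    show "\<beta> \<oplus>\<^bsub>?G\<^esub> \<gamma> = \<gamma> \<oplus>\<^bsub>?G\<^esub> \<beta>" unfolding ops using F(1)[OF \<beta>] F(1)[OF \<gamma>] by (simp add: D.a_comm)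
    show "\<zero>\<^bsub>?G\<^esub> \<oplus>\<^bsub>?G\<^esub> \<beta> = \<beta>" unfolding ops using F(1)[OF \<beta>] by simp
    have "(\<lambda>y z. \<ominus>\<^bsub>D\<^esub> \<beta> y z) \<in> carrier ?G"
      by (rule balanced_formsI) (auto simp: F(1,2)[OF \<beta>] F(3-5)[OF \<beta>] D.minus_add)
    moreover have "(\<lambda>y z. \<ominus>\<^bsub>D\<^esub> \<beta> y z) \<oplus>\<^bsub>?G\<^esub> \<beta> = \<zero>\<^bsub>?G\<^esub>"
      unfolding ops using F(1)[OF \<beta>] by (simp add: D.l_neg)
    ultimately show "\<exists>\<gamma>\<in>carrier ?G. \<gamma> \<oplus>\<^bsub>?G\<^esub> \<beta> = \<zero>\<^bsub>?G\<^esub>" by blast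
    fix \<delta> assume \<delta>: "\<delta> \<in> carrier ?G"
    show "\<beta> \<oplus>\<^bsub>?G\<^esub> \<gamma> \<oplus>\<^bsub>?G\<^esub> \<delta> = \<beta> \<oplus>\<^bsub>?G\<^esub> (\<gamma> \<oplus>\<^bsub>?G\<^esub> \<delta>)"
      unfolding ops using F(1)[OF \<beta>] F(1)[OF \<gamma>] F(1)[OF \<delta>] by (simp add: D.a_assoc)
  next
    show "\<zero>\<^bsub>?G\<^esub> \<in> carrier ?G" unfolding ops by (rule balanced_formsI) auto
  qed
qed

text \<open>Multiplication in the left and in the right argument of balanced forms are two homomorphisms
  from \<open>B\<close> into a commutative ring that agree on \<open>K\<close>.\<close>

lemma epi_ext_balanced:
  fixes B :: "('a, 'b) ring_scheme" and D :: "('d, 'e) ring_scheme"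
  assumes B: "cring B" and epi: "epi_ext K B" and D: "abelian_group D" and K: "K \<subseteq> carrier B"
    and \<beta>: "\<beta> \<in> carrier (balanced_forms K B D)"
    and b: "b \<in> carrier B" and y: "y \<in> carrier B" and z: "z \<in> carrier B"
  shows "\<beta> (b \<otimes>\<^bsub>B\<^esub> y) z = \<beta> y (b \<otimes>\<^bsub>B\<^esub> z)"
proof -
  interpret B: cring B by fact
  interpret D: abelian_group D by fact
  let ?G = "balanced_forms K B D"
  let ?E = "endo_ring ?G"
  note F = balanced_formsD and ops = balanced_forms_ops and Eops = endo_ring_ops
  have G: "abelian_group ?G" by (rule balanced_forms_abelian_group[OF B D])
  interpret E: ring ?E by (rule endo_ring_ring[OF G])
  have Kc: "a \<in> carrier B" if "a \<in> K" for a using K that by auto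
  define L where "L = (\<lambda>b. \<lambda>\<beta>\<in>carrier ?G. \<lambda>y z.
    if y \<in> carrier B \<and> z \<in> carrier B then \<beta> (b \<otimes>\<^bsub>B\<^esub> y) z else \<zero>\<^bsub>D\<^esub>)"
  define M where "M = (\<lambda>b. \<lambda>\<beta>\<in>carrier ?G. \<lambda>y z.
    if y \<in> carrier B \<and> z \<in> carrier B then \<beta> y (b \<otimes>\<^bsub>B\<^esub> z) else \<zero>\<^bsub>D\<^esub>)"
  have LM_ext: "L b \<in> extensional (carrier ?G)" "M b \<in> extensional (carrier ?G)" for b
    by (auto simp: L_def M_def)
  have Lcl: "L b \<beta> \<in> carrier ?G" if b: "b \<in> carrier B" and \<beta>: "\<beta> \<in> carrier ?G" for b \<beta>
    unfolding L_def restrict_apply'[OF \<beta>]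
    by (rule balanced_formsI)
      (auto simp: F(1)[OF \<beta>] F(3-5)[OF \<beta>] b Kc B.r_distr B.m_lcomm[of b])
  have Mcl: "M b \<beta> \<in> carrier ?G" if b: "b \<in> carrier B" and \<beta>: "\<beta> \<in> carrier ?G" for b \<beta>
    unfolding M_def restrict_apply'[OF \<beta>]
    by (rule balanced_formsI)
      (auto simp: F(1)[OF \<beta>] F(3-5)[OF \<beta>] b Kc B.r_distr B.m_lcomm[of b])
  have LE: "L b \<in> carrier ?E" if b: "b \<in> carrier B" for b
  proof (rule endo_ringI[OF Lcl[OF b] LM_ext(1)])
    fix \<beta> \<gamma> assume "\<beta> \<in> carrier ?G" "\<gamma> \<in> carrier ?G"
    then show "L b (\<beta> \<oplus>\<^bsub>?G\<^esub> \<gamma>) = L b \<beta> \<oplus>\<^bsub>?G\<^esub> L b \<gamma>"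
      using abelian_group.axioms(1)[OF G, THEN abelian_monoid.a_closed]
      by (auto simp: L_def ops fun_eq_iff)
  qed
  have ME: "M b \<in> carrier ?E" if b: "b \<in> carrier B" for b
  proof (rule endo_ringI[OF Mcl[OF b] LM_ext(2)])
    fix \<beta> \<gamma> assume "\<beta> \<in> carrier ?G" "\<gamma> \<in> carrier ?G"
    then show "M b (\<beta> \<oplus>\<^bsub>?G\<^esub> \<gamma>) = M b \<beta> \<oplus>\<^bsub>?G\<^esub> M b \<gamma>"
      using abelian_group.axioms(1)[OF G, THEN abelian_monoid.a_closed]
      by (auto simp: M_def ops fun_eq_iff)
  qed
  have Lap: "L b \<beta> y z = \<beta> (b \<otimes>\<^bsub>B\<^esub> y) z" if "\<beta> \<in> carrier ?G" "y \<in> carrier B" "z \<in> carrier B" for b \<beta> y z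
    using that by (simp add: L_def)
  have Map: "M b \<beta> y z = \<beta> y (b \<otimes>\<^bsub>B\<^esub> z)" if "\<beta> \<in> carrier ?G" "y \<in> carrier B" "z \<in> carrier B" for b \<beta> y z
    using that by (simp add: M_def)
  have form_eqI: "\<beta> = \<gamma>" if "\<beta> \<in> carrier ?G" "\<gamma> \<in> carrier ?G"
    "\<And>y z. y \<in> carrier B \<Longrightarrow> z \<in> carrier B \<Longrightarrow> \<beta> y z = \<gamma> y z" for \<beta> \<gamma>
  proof (intro ext)
    fix y z
    show "\<beta> y z = \<gamma> y z"
      using that(3) F(2)[OF that(1), of y z] F(2)[OF that(2), of y z]
      by (cases "y \<in> carrier B \<and> z \<in> carrier B") auto
  qed
  have E_eqI: "\<phi> = \<psi>" if "\<phi> \<in> carrier ?E" "\<psi> \<in> carrier ?E"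
    "\<And>\<beta> y z. \<beta> \<in> carrier ?G \<Longrightarrow> y \<in> carrier B \<Longrightarrow> z \<in> carrier B \<Longrightarrow> \<phi> \<beta> y z = \<psi> \<beta> y z" for \<phi> \<psi>
  proof (rule endo_ring_eqI[OF endo_ringD(2)[OF that(1)] endo_ringD(2)[OF that(2)]])
    fix \<beta> assume \<beta>: "\<beta> \<in> carrier ?G"
    show "\<phi> \<beta> = \<psi> \<beta>"
      by (rule form_eqI[OF endo_ringD(1)[OF that(1) \<beta>] endo_ringD(1)[OF that(2) \<beta>] that(3)[OF \<beta>]])
  qed
  note mems = LE ME E.m_closed E.a_closed E.one_closed
  have L_mult: "L (b \<otimes>\<^bsub>B\<^esub> c) = L b \<otimes>\<^bsub>?E\<^esub> L c" "M (b \<otimes>\<^bsub>B\<^esub> c) = M b \<otimes>\<^bsub>?E\<^esub> M c"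
    "L b \<otimes>\<^bsub>?E\<^esub> L c = L c \<otimes>\<^bsub>?E\<^esub> L b" "M b \<otimes>\<^bsub>?E\<^esub> M c = M c \<otimes>\<^bsub>?E\<^esub> M b"
    "L b \<otimes>\<^bsub>?E\<^esub> M c = M c \<otimes>\<^bsub>?E\<^esub> L b"
    if "b \<in> carrier B" "c \<in> carrier B" for b c
    by (rule E_eqI; use that in \<open>simp add: mems Eops Lcl Mcl Lap Map B.m_ac\<close>)+
  have L_add: "L (b \<oplus>\<^bsub>B\<^esub> c) = L b \<oplus>\<^bsub>?E\<^esub> L c" "M (b \<oplus>\<^bsub>B\<^esub> c) = M b \<oplus>\<^bsub>?E\<^esub> M c"
    if "b \<in> carrier B" "c \<in> carrier B" for b c
    by (rule E_eqI; use that in \<open>simp add: mems Eops Lcl Mcl Lap Map ops B.l_distr F(3,4)[where K = K and D = D]\<close>)+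
  have L_one: "L \<one>\<^bsub>B\<^esub> = \<one>\<^bsub>?E\<^esub>" "M \<one>\<^bsub>B\<^esub> = \<one>\<^bsub>?E\<^esub>"
    by (rule E_eqI; simp add: mems Eops Lap Map)+
  define A where "A = L ` carrier B \<union> M ` carrier B"
  have A: "A \<subseteq> carrier ?E" using LE ME by (auto simp: A_def)
  have comm: "\<phi> \<otimes>\<^bsub>?E\<^esub> \<psi> = \<psi> \<otimes>\<^bsub>?E\<^esub> \<phi>" if "\<phi> \<in> A" "\<psi> \<in> A" for \<phi> \<psi>
    using that unfolding A_def by (auto simp: L_mult(3-5)[symmetric] intro: L_mult(3-5))
  let ?C = "?E\<lparr>carrier := E.commutant (E.commutant A)\<rparr>"
  have C: "cring ?C" and AC: "A \<subseteq> carrier ?C" using E.bicommutant_cring[OF A comm] by auto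
  have "L \<in> ring_hom B ?C" "M \<in> ring_hom B ?C"
    using AC L_mult(1,2) L_add L_one by (auto simp: ring_hom_def A_def)
  moreover have "L a = M a" if "a \<in> K" for a
    by (rule E_eqI) (use that in \<open>simp_all add: mems Kc Lap Map F(5)[where K = K and D = D]\<close>)
  \<comment> \<open>The elements of \<open>?C\<close> are endomorphisms of forms, not of the type
    tested in \<open>epi_ext\<close>, hence the appeal to \<open>epi_ext_eq\<close>.\<close>
  ultimately have "L b = M b" using epi_ext_eq[OF B epi C] b by blast
  then show ?thesis using Lap[OF \<beta> y z, of b] Map[OF \<beta> y z, of b] by simp
qed

section \<open>Finite simple epimorphic extensions are equalities\<close>

context cring
begin

lemma subring_is_cring: "subring K R \<Longrightarrow> cring (R\<lparr>carrier := K\<rparr>)"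
  using subcring_iff[OF subringE(1)] subcringI' by blast

lemma subring_of_subring:
  assumes "subring K R" "subring B R" "K \<subseteq> B"
  shows "subring K (R\<lparr>carrier := B\<rparr>)"
  using ring.subring_iff[OF subring_is_ring[OF assms(2)], of K] subring_is_ring[OF assms(1)] assms(3)
  by simp

lemma integral_over_consistent:
  assumes "subring B R"
  shows "integral_over K (R\<lparr>carrier := B\<rparr>) x = integral_over K R x"
  unfolding integral_over_def eval_consistent[OF assms] by simp

text \<open>With \<open>B = N + K g\<close> for a proper submodule \<open>N\<close> containing \<open>K\<close> and \<open>I = (N : g)\<close>, the projection
  \<open>\<lambda> : B \<rightarrow> B / N \<cong> K / I\<close> gives the balanced form \<open>\<lambda> y * \<lambda> z\<close>, which vanishes on \<open>(1, g * g)\<close>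
  but not on \<open>(g, g)\<close>.\<close>

lemma epi_ext_integral_mem:
  assumes K: "subring K R" and t: "t \<in> carrier R" and gen: "carrier R = simple_extension K t"
    and int: "integral_over K R t" and epi: "epi_ext K R"
  shows "t \<in> K"
proof (rule ccontr)
  assume tK: "t \<notin> K"
  note KE = subringE[OF K] and K' = subring_mem[OF K] and S' = poly_span_carrier[OF K t]
  let ?S = "poly_span K t"
  obtain m :: nat where m: "t [^] m \<in> ?S m" using int integral_over_iff_poly_span[OF K t] by blast
  \<comment> \<open>With \<open>n = Suc i\<close> least, \<open>N = poly_span K t i\<close> is
    proper and the ring is \<open>N + K g\<close> for \<open>g = t^i\<close>. As \<open>t\<close> is
    not in \<open>K\<close>, \<open>i\<close> is positive, whence
    \<open>K \<subseteq> N\<close>.\<close>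
  define n where "n = (LEAST n. carrier R \<subseteq> ?S n)"
  have "carrier R \<subseteq> ?S m" unfolding gen simple_extension_integral[OF K t m] ..
  then have n: "carrier R \<subseteq> ?S n" unfolding n_def by (rule LeastI)
  have least: "\<not> carrier R \<subseteq> ?S k" if "k < n" for k using not_less_Least that unfolding n_def by blast
  have "n \<noteq> 0"
  proof
    assume "n = 0"
    then show False using n t tK KE(2) by auto
  qed
  then obtain i where i: "n = Suc i" using not0_implies_Suc by blast
  have "i \<noteq> 0"
  proof
    assume "i = 0"
    then show False using n t tK poly_span_1[OF K t] i by auto
  qed
  then have KS: "a \<in> ?S i" if "a \<in> K" for a
    using that poly_span_1[OF K t] poly_span_mono[OF K t, of 1 i] by auto
  have ti: "t [^] i \<notin> ?S i"
    using least[of i] i simple_extension_integral[OF K t, of i] gen by auto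
  define I where "I = {r \<in> K. r \<otimes> t [^] i \<in> ?S i}"
  let ?K = "R\<lparr>carrier := K\<rparr>"
  interpret KR: cring ?K by (rule subring_is_cring[OF K])
  have I: "ideal I ?K"
  proof (rule KR.ideal_if_closed)
    show "I \<subseteq> carrier ?K" "\<zero>\<^bsub>?K\<^esub> \<in> I" using KE(2) poly_span_zero[OF K t] t by (auto simp: I_def)
    show "a \<oplus>\<^bsub>?K\<^esub> b \<in> I" if "a \<in> I" "b \<in> I" for a b
      using that KE(7) poly_span_add[OF K t] K' t by (simp add: I_def l_distr)
    show "x \<otimes>\<^bsub>?K\<^esub> a \<in> I" if "a \<in> I" "x \<in> carrier ?K" for a x
      using that KE(6) poly_span_smult[OF K t] K' t by (simp add: I_def m_assoc)
  qed
  define D where "D = ?K Quot I"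
  define h where "h = (+>\<^bsub>?K\<^esub>) I"
  interpret D: cring D unfolding D_def by (rule ideal.quotient_is_cring[OF I KR.is_cring])
  interpret h: ring_hom_ring ?K D h unfolding D_def h_def by (rule ideal.rcos_ring_hom_ring[OF I])
  have h0: "h a = \<zero>\<^bsub>D\<^esub> \<longleftrightarrow> a \<in> I" if "a \<in> K" for a
    unfolding h_def D_def FactRing_def
    using that ideal.rcos_const_imp_mem[OF I, of a] KR.a_rcos_zero[OF I, of a] by auto
  have hh: "h (a \<oplus> b) = h a \<oplus>\<^bsub>D\<^esub> h b" "h (a \<otimes> b) = h a \<otimes>\<^bsub>D\<^esub> h b" "h a \<in> carrier D"
    if "a \<in> K" "b \<in> K" for a b
    using that h.hom_add[of a b] h.hom_mult[of a b] h.hom_closed[of a] by auto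
  have "\<exists>a\<in>K. y \<ominus> a \<otimes> t [^] i \<in> ?S i" if y: "y \<in> carrier R" for y
  proof -
    have "y \<in> ?S (Suc i)" using n y i by auto
    then obtain a k where a: "a \<in> K" "k \<in> ?S i" "y = a \<otimes> t [^] i \<oplus> k" by (rule poly_span_SucE)
    have "y \<ominus> a \<otimes> t [^] i = k"
      unfolding a(3) using K'[OF a(1)] S'[OF a(2)] t by (simp add: a_minus_def a_ac r_neg)
    then have "y \<ominus> a \<otimes> t [^] i \<in> ?S i" using a(2) by (simp only:)
    then show ?thesis using a(1) by (rule bexI)
  qed
  \<comment> \<open>\<open>l y\<close> is a chosen coefficient of \<open>t^i\<close> in
    \<open>y\<close>. Two choices differ by an element of \<open>I\<close>, so
    \<open>p = h \<circ> l\<close> is the well-defined projection, linear over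
    \<open>K\<close>.\<close>
  then obtain l where l: "\<And>y. y \<in> carrier R \<Longrightarrow> l y \<in> K"
    "\<And>y. y \<in> carrier R \<Longrightarrow> y \<ominus> l y \<otimes> t [^] i \<in> ?S i" by metis
  define p where "p = (\<lambda>y. h (l y))"
  have pD: "p y \<in> carrier D" if "y \<in> carrier R" for y
    using hh(3)[OF l(1)[OF that] l(1)[OF that]] by (simp add: p_def)
  have p_eq: "p y = h a" if y: "y \<in> carrier R" and a: "a \<in> K" "y \<ominus> a \<otimes> t [^] i \<in> ?S i" for y a
  proof -
    note ly = l[OF y]
    note cs = y K'[OF a(1)] K'[OF ly(1)]
    have d: "l y \<ominus> a \<in> K" unfolding a_minus_def using ly(1) a(1) by (intro KE)
    have "(l y \<ominus> a) \<otimes> v = (y \<ominus> a \<otimes> v) \<ominus> (y \<ominus> l y \<otimes> v)" if "v \<in> carrier R" for v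
      using cs that by algebra
    then have "(l y \<ominus> a) \<otimes> t [^] i \<in> ?S i"
      using poly_span_minus[OF K t a(2) ly(2)] t by simp
    then have "h (l y \<ominus> a) = \<zero>\<^bsub>D\<^esub>" using h0[OF d] d by (simp add: I_def)
    then have "h ((l y \<ominus> a) \<oplus> a) = h a" using hh[OF d a(1)] hh[OF a(1) a(1)] by simp
    moreover have "(l y \<ominus> a) \<oplus> a = l y" using cs by (simp add: a_minus_def a_assoc l_neg)
    ultimately show ?thesis by (simp add: p_def)
  qed
  have p_add: "p (y \<oplus> z) = p y \<oplus>\<^bsub>D\<^esub> p z" if yz: "y \<in> carrier R" "z \<in> carrier R" for y z
  proof -
    note ly = l[OF yz(1)] and lz = l[OF yz(2)]
    note cs = yz K'[OF ly(1)] K'[OF lz(1)]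
    have "(y \<oplus> z) \<ominus> (l y \<oplus> l z) \<otimes> v = (y \<ominus> l y \<otimes> v) \<oplus> (z \<ominus> l z \<otimes> v)" if "v \<in> carrier R" for v
      using cs that by algebra
    then have "(y \<oplus> z) \<ominus> (l y \<oplus> l z) \<otimes> t [^] i \<in> ?S i"
      using poly_span_add[OF K t ly(2) lz(2)] t by simp
    then have "p (y \<oplus> z) = h (l y \<oplus> l z)" using KE(7)[OF ly(1) lz(1)] yz by (intro p_eq) auto
    then show ?thesis using hh[OF ly(1) lz(1)] by (simp add: p_def)
  qed
  have p_smult: "p (a \<otimes> y) = h a \<otimes>\<^bsub>D\<^esub> p y" if a: "a \<in> K" and y: "y \<in> carrier R" for a y
  proof -
    note ly = l[OF y]
    note cs = y K'[OF a] K'[OF ly(1)]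
    have "a \<otimes> y \<ominus> (a \<otimes> l y) \<otimes> v = a \<otimes> (y \<ominus> l y \<otimes> v)" if "v \<in> carrier R" for v
      using cs that by algebra
    then have "a \<otimes> y \<ominus> (a \<otimes> l y) \<otimes> t [^] i \<in> ?S i"
      using poly_span_smult[OF K t a ly(2)] t by simp
    then have "p (a \<otimes> y) = h (a \<otimes> l y)" using KE(6)[OF a ly(1)] cs by (intro p_eq) auto
    then show ?thesis using hh[OF a ly(1)] by (simp add: p_def)
  qed
  define \<beta> where "\<beta> = (\<lambda>y z. if y \<in> carrier R \<and> z \<in> carrier R then p y \<otimes>\<^bsub>D\<^esub> p z else \<zero>\<^bsub>D\<^esub>)"
  have hK: "h a \<in> carrier D" if "a \<in> K" for a using hh(3)[OF that that] .
  have \<beta>: "\<beta> \<in> carrier (balanced_forms K R D)"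
    by (rule balanced_formsI)
      (auto simp: \<beta>_def pD p_add p_smult D.l_distr D.r_distr D.m_ac hK K')
  have "t [^] i \<in> carrier R" using t by simp
  \<comment> \<open>Moving \<open>t^i\<close> across the form compares
    \<open>p (t^i) p (t^i) = \<one>\<close> with a product containing
    \<open>p \<one> = \<zero>\<close>. Hence \<open>D\<close> is trivial and
    \<open>t^i \<in> N\<close>, a contradiction.\<close>
  then have "\<beta> (t [^] i \<otimes> \<one>) (t [^] i) = \<beta> \<one> (t [^] i \<otimes> t [^] i)"
    using epi_ext_balanced[OF is_cring epi D.abelian_group_axioms KE(1) \<beta>] by blast
  moreover have "p \<one> = h \<zero>"
    using KS[OF KE(3)] KE(2) t by (intro p_eq) (auto simp: a_minus_def)
  then have "p \<one> = \<zero>\<^bsub>D\<^esub>" using h.hom_zero by simp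
  moreover have "p (t [^] i) = h \<one>"
    using poly_span_zero[OF K t] KE(3) t by (intro p_eq) (auto simp: a_minus_def r_neg)
  then have "p (t [^] i) = \<one>\<^bsub>D\<^esub>" using h.hom_one by simp
  ultimately have "\<one>\<^bsub>D\<^esub> = \<zero>\<^bsub>D\<^esub>" using t pD by (simp add: \<beta>_def)
  then have "\<one> \<in> I" using h0[OF KE(3)] h.hom_one by simp
  then show False using ti t by (simp add: I_def)
qed

text \<open>\<open>K \<subseteq> K[t]\<close> is an epimorphism because
  \<open>K[t] \<subseteq> T\<close>. Homomorphisms on \<open>U[t]\<close> agreeing on
  \<open>U\<close> agree on \<open>K\<close>, hence at \<open>t\<close>; so
  \<open>U \<subseteq> U[t]\<close> is an epimorphism too, and \<open>epi_ext_integral_mem\<close>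
  applies to it.\<close>

lemma pruefer_integral_mem:
  assumes K: "subring K R" and T: "subring T R" and "K \<subseteq> T" and pr: "pruefer_ext K (R\<lparr>carrier := T\<rparr>)"
    and U: "subring U R" and "K \<subseteq> U" and tT: "t \<in> T" and int: "integral_over U R t"
  shows "t \<in> U"
proof -
  have t: "t \<in> carrier R" by (rule subring_mem[OF T tT])
  let ?V = "simple_extension K t" and ?B = "simple_extension U t"
  note V = simple_extension_subring[OF K t] and B = simple_extension_subring[OF U t]
  have "?V \<subseteq> T" by (rule simple_extension_subring_incl[OF T \<open>K \<subseteq> T\<close> tT])
  then have "?V \<in> intermediate_rings K (R\<lparr>carrier := T\<rparr>)"
    unfolding intermediate_rings_def
    using subring_of_subring[OF V T] simple_extension_incl[OF subringE(1)[OF K] t] by blast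
  then have epi: "epi_ext K (R\<lparr>carrier := ?V\<rparr>)"
    using pr unfolding pruefer_ext_def flat_epi_ext_def by auto
  have VB: "?V \<subseteq> ?B" by (rule mono_simple_extension[OF \<open>K \<subseteq> U\<close>])
  have UB: "U \<subseteq> ?B" by (rule simple_extension_incl[OF subringE(1)[OF U] t])
  note tV = simple_extension_mem[OF K t] and tB = simple_extension_mem[OF U t]
  have epiB: "epi_ext U (R\<lparr>carrier := ?B\<rparr>)"
    unfolding epi_ext_def
  proof (intro allI impI)
    fix C :: "('a \<times> 'a) list ring" and f g
    assume C: "cring C" and f: "f \<in> ring_hom (R\<lparr>carrier := ?B\<rparr>) C"
      and g: "g \<in> ring_hom (R\<lparr>carrier := ?B\<rparr>) C" and eq: "\<forall>x\<in>U. f x = g x"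
    have "f \<in> ring_hom (R\<lparr>carrier := ?V\<rparr>) C" "g \<in> ring_hom (R\<lparr>carrier := ?V\<rparr>) C"
      using f g VB by (auto simp: ring_hom_def subset_iff)
    moreover have "\<forall>x\<in>K. f x = g x" using eq \<open>K \<subseteq> U\<close> by blast
    ultimately have ft: "f t = g t" using epi C tV unfolding epi_ext_def by auto
    show "\<forall>x\<in>carrier (R\<lparr>carrier := ?B\<rparr>). f x = g x"
    proof
      fix x assume "x \<in> carrier (R\<lparr>carrier := ?B\<rparr>)"
      then have "x \<in> ?B" by simp
      then show "f x = g x"
      proof (induction rule: simple_extension.induct)
        case zero
        show ?case using eq subringE(2)[OF U] by blast
      next
        case (lin y a)
        have "y \<otimes> t \<in> ?B" "a \<in> ?B" using lin tB UB subringE(6)[OF B] by auto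
        then show ?case
          using lin tB ft eq ring_hom_add[OF f, of "y \<otimes> t" a] ring_hom_add[OF g, of "y \<otimes> t" a]
            ring_hom_mult[OF f, of y t] ring_hom_mult[OF g, of y t] by simp
      qed
    qed
  qed
  interpret B: cring "R\<lparr>carrier := ?B\<rparr>" by (rule subring_is_cring[OF B])
  show ?thesis
  proof (rule B.epi_ext_integral_mem[OF subring_of_subring[OF U B UB] _ _ _ epiB])
    show "integral_over U (R\<lparr>carrier := ?B\<rparr>) t" using int integral_over_consistent[OF B] by simp
    show "carrier (R\<lparr>carrier := ?B\<rparr>) = B.simple_extension U t"
      unfolding simple_extension_consistent[OF B] by simp
  qed (use tB in simp)
qed

end

section \<open>Pruefer extensions and the Pruefer hull\<close>

context cring
begin

lemma poly_span_scale:
  assumes K: "subring K R" and t: "t \<in> carrier R" and c: "c \<in> K"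
  shows "y \<in> poly_span K t m \<Longrightarrow> c [^] m \<otimes> y \<in> poly_span K (c \<otimes> t) m"
proof (induction m arbitrary: y)
  case (Suc m)
  have ct: "c \<otimes> t \<in> carrier R" using subring_mem[OF K c] t by simp
  obtain a n where y: "a \<in> K" "n \<in> poly_span K t m" "y = a \<otimes> t [^] m \<oplus> n"
    using Suc.prems by (rule poly_span_SucE)
  have cs: "a \<in> carrier R" "n \<in> carrier R" "c \<in> carrier R"
    using subring_mem[OF K] y c poly_span_carrier[OF K t] by auto
  have "c [^] Suc m \<otimes> y = (c \<otimes> a) \<otimes> (c \<otimes> t) [^] m \<oplus> c \<otimes> (c [^] m \<otimes> n)"
    unfolding y using cs t by (simp add: r_distr m_ac nat_pow_distrib)
  then show ?case
    using poly_span_SucI[OF subringE(6)[OF K c y(1)] poly_span_smult[OF K ct c Suc.IH[OF y(2)]]] by simp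
qed (use subring_mem[OF K c] t in simp)

text \<open>Degree at most \<open>m\<close> asks only for \<open>c^m\<close>. In a relation
  \<open>c t^(m+1) + ... = 0\<close> the leading \<open>c\<close> then supplies the last factor of
  \<open>(c t)^(m+1)\<close>.\<close>

lemma poly_span_scale_Suc:
  assumes K: "subring K R" and t: "t \<in> carrier R" and c: "c \<in> K"
  shows "y \<in> poly_span K t (Suc m) \<Longrightarrow> c [^] m \<otimes> y \<in> poly_span K (c \<otimes> t) (Suc m)"
proof -
  assume "y \<in> poly_span K t (Suc m)"
  then obtain a n where y: "a \<in> K" "n \<in> poly_span K t m" "y = a \<otimes> t [^] m \<oplus> n" by (rule poly_span_SucE)
  have cs: "a \<in> carrier R" "n \<in> carrier R" "c \<in> carrier R"
    using subring_mem[OF K] y c poly_span_carrier[OF K t] by auto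
  have "c [^] m \<otimes> y = a \<otimes> (c \<otimes> t) [^] m \<oplus> c [^] m \<otimes> n"
    unfolding y using cs t by (simp add: r_distr m_ac nat_pow_distrib)
  then show ?thesis using poly_span_SucI[OF y(1) poly_span_scale[OF K t c y(2)]] by simp
qed

lemma integral_over_smult:
  assumes K: "subring K R" and t: "t \<in> carrier R" and c: "c \<in> K" and int: "integral_over K R t"
  shows "integral_over K R (c \<otimes> t)"
proof -
  have cc: "c \<in> carrier R" by (rule subring_mem[OF K c])
  obtain m :: nat where "t [^] m \<in> poly_span K t m" using int integral_over_iff_poly_span[OF K t] by blast
  from poly_span_scale[OF K t c this] have "(c \<otimes> t) [^] m \<in> poly_span K (c \<otimes> t) m"
    using cc t by (simp add: nat_pow_distrib)
  then show ?thesis using integral_over_iff_poly_span[OF K] cc t by blast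
qed

text \<open>Multiplying a relation of degree \<open>n\<close> by \<open>c^(n-1)\<close> makes it
  monic in \<open>c t\<close>.\<close>

lemma integral_over_leading_coeff:
  assumes K: "subring K R" and t: "t \<in> carrier R" and c: "c \<in> K" and g: "set g \<subseteq> K" "g \<noteq> []"
    and ev: "eval (c # g) t = \<zero>"
  shows "integral_over K R (c \<otimes> t)"
proof -
  have cc: "c \<in> carrier R" by (rule subring_mem[OF K c])
  then have ct: "c \<otimes> t \<in> carrier R" using t by simp
  obtain m where m: "length g = Suc m" using g(2) by (cases g) auto
  have e: "eval g t \<in> poly_span K t (Suc m)" using g m by (auto simp: poly_span_def)
  note ec = poly_span_carrier[OF K t e]
  have "c \<otimes> t [^] Suc m = \<ominus> eval g t"
    using ev m cc t ec sum_zero_eq_neg[of "c \<otimes> t [^] Suc m" "eval g t"] by simp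
  moreover have "(c \<otimes> t) [^] Suc m = c [^] m \<otimes> (c \<otimes> t [^] Suc m)"
    using cc t by (simp add: nat_pow_distrib m_ac)
  ultimately have "(c \<otimes> t) [^] Suc m \<in> poly_span K (c \<otimes> t) (Suc m)"
    using poly_span_scale_Suc[OF K t c poly_span_neg[OF K t e]] by metis
  then show ?thesis using integral_over_iff_poly_span[OF K ct] by blast
qed

text \<open>In a relation \<open>a\<^sub>n t\<^sup>n + \<dots> + a\<^sub>0 = 0\<close> the Horner coefficients \<open>b\<^sub>n = a\<^sub>n\<close>, \<open>b\<^sub>i = b\<^sub>i\<^sub>+\<^sub>1 t + a\<^sub>i\<close> are
  successively seen to be denominators of \<open>t\<close>, as \<open>b\<^sub>i t\<close> is integral.\<close>

lemma integrally_closed_denominators: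
  assumes K: "subring K R" and FCP: "FCP K R" and T: "subring T R" and KT: "K \<subseteq> T"
    and closed: "\<And>s. s \<in> T \<Longrightarrow> integral_over K R s \<Longrightarrow> s \<in> K" and tT: "t \<in> T"
    and H: "\<And>a b. a \<in> H \<Longrightarrow> b \<in> H \<Longrightarrow> a \<oplus> b \<in> H" "\<And>a. a \<in> H \<Longrightarrow> \<ominus> a \<in> H"
      "\<And>a. a \<in> H \<Longrightarrow> a \<otimes> t \<in> H"
    and den: "{r \<in> K. r \<otimes> t \<in> K} \<subseteq> H"
  shows "\<one> \<in> H"
proof -
  note KE = subringE[OF K] and K' = subring_mem[OF K]
  have t: "t \<in> carrier R" by (rule subring_mem[OF T tT])
  have coeffs: "set (c # g) \<subseteq> H" if "c \<in> K" "set g \<subseteq> K" "eval (c # g) t = \<zero>" for c g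
    using that
  proof (induction g arbitrary: c)
    case Nil
    then have "c = \<zero>" using K' by simp
    moreover have "\<zero> \<in> H" using den KE(2) t by auto
    ultimately show ?case by simp
  next
    case (Cons a g)
    have cs: "c \<in> carrier R" "a \<in> carrier R" "set g \<subseteq> carrier R" using Cons.prems K' by auto
    have "integral_over K R (c \<otimes> t)"
      using Cons.prems by (intro integral_over_leading_coeff[OF K t, of _ "a # g"]) auto
    moreover have "c \<otimes> t \<in> T" using subringE(6)[OF T] Cons.prems(1) KT tT by blast
    ultimately have ct: "c \<otimes> t \<in> K" by (intro closed)
    have cH: "c \<in> H" using den Cons.prems(1) ct by auto
    \<comment> \<open>Horner's rule folds the leading term into the next coefficient, which stays in
      \<open>K\<close> because \<open>c t\<close> does. Afterwards \<open>a\<close> is recovered as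
      the difference of \<open>c t + a\<close> and \<open>c t\<close>, both in
      \<open>H\<close>.\<close>
    have "eval ((c \<otimes> t \<oplus> a) # g) t = eval (c # a # g) t"
      using cs t eval_in_carrier[OF cs(3) t] by (simp add: l_distr r_distr m_ac a_assoc)
    then have "set ((c \<otimes> t \<oplus> a) # g) \<subseteq> H"
      using Cons.prems ct KE(7) by (intro Cons.IH) auto
    then have "c \<otimes> t \<oplus> a \<in> H" "set g \<subseteq> H" by auto
    moreover have "(c \<otimes> t \<oplus> a) \<oplus> \<ominus> (c \<otimes> t) = a"
      using cs t by (simp add: a_ac r_neg)
    ultimately show ?case using cH H(1)[OF _ H(2)[OF H(3)[OF cH]], of "c \<otimes> t \<oplus> a"] by auto
  qed
  obtain f where f: "set f \<subseteq> K" "\<ominus> \<one> \<in> set f" "eval f t = \<zero>"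
    using FCP_relation[OF K FCP t] by blast
  then obtain c g where "f = c # g" by (cases f) auto
  then have "\<ominus> \<one> \<in> H" using coeffs[of c g] f by auto
  then show ?thesis using H(2) by fastforce
qed

end

text \<open>The denominator ideals \<open>(K : s)\<close> extend to the unit ideal of
  \<open>S\<close>, a standard criterion for flat epimorphisms. Quantifying over the ideals
  \<open>H\<close> above \<open>(K : s)\<close> avoids speaking of generated ideals.\<close>

definition dense_denominators :: "'a set \<Rightarrow> ('a, 'b) ring_scheme \<Rightarrow> bool"
  where "dense_denominators K S \<longleftrightarrow>
    (\<forall>s\<in>carrier S. \<forall>H. ideal H S \<longrightarrow> {r \<in> K. r \<otimes>\<^bsub>S\<^esub> s \<in> K} \<subseteq> H \<longrightarrow> \<one>\<^bsub>S\<^esub> \<in> H)"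

text \<open>For a denominator \<open>r\<close> of \<open>s\<close>,
  \<open>f r f s = f (r s) = g (r s) = f r g s\<close>, so \<open>f r\<close> kills
  \<open>f s - g s\<close>. The elements with this property form an ideal, which by density contains
  \<open>\<one>\<close>.\<close>

lemma dense_denominators_epi:
  assumes S: "cring S" and K: "subring K S" and dense: "dense_denominators K S"
  shows "epi_ext K S"
  unfolding epi_ext_def
proof (intro allI impI ballI)
  fix C :: "('a \<times> 'a) list ring" and f g s
  assume C: "cring C" and f: "f \<in> ring_hom S C" and g: "g \<in> ring_hom S C"
    and eq: "\<forall>x\<in>K. f x = g x" and s: "s \<in> carrier S"
  interpret S: cring S by fact
  interpret C: cring C by fact
  interpret f: ring_hom_cring S C f by unfold_locales (rule f)
  interpret g: ring_hom_cring S C g by unfold_locales (rule g)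
  define d where "d = f s \<ominus>\<^bsub>C\<^esub> g s"
  have d: "d \<in> carrier C" using s by (simp add: d_def)
  define H where "H = {h \<in> carrier S. f h \<otimes>\<^bsub>C\<^esub> d = \<zero>\<^bsub>C\<^esub>}"
  have "ideal H S"
    by (rule S.ideal_if_closed) (use d in \<open>auto simp: H_def C.l_distr C.m_assoc\<close>)
  moreover have "{r \<in> K. r \<otimes>\<^bsub>S\<^esub> s \<in> K} \<subseteq> H"
  proof
    fix r assume r: "r \<in> {r \<in> K. r \<otimes>\<^bsub>S\<^esub> s \<in> K}"
    then have rc: "r \<in> carrier S" using S.subring_mem[OF K] by auto
    have "f r \<otimes>\<^bsub>C\<^esub> f s = f r \<otimes>\<^bsub>C\<^esub> g s"
      using r eq rc s f.hom_mult[of r s] g.hom_mult[of r s] by auto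
    then have "f r \<otimes>\<^bsub>C\<^esub> d = \<zero>\<^bsub>C\<^esub>"
      unfolding d_def using rc s by (simp add: C.r_distr a_minus_def C.r_minus C.r_neg)
    then show "r \<in> H" using rc by (simp add: H_def)
  qed
  ultimately have "\<one>\<^bsub>S\<^esub> \<in> H" using dense s unfolding dense_denominators_def by blast
  then have "d = \<zero>\<^bsub>C\<^esub>" using d by (simp add: H_def)
  then show "f s = g s" using s by (simp add: d_def)
qed

lemma free_Abelian_group_hom:
  assumes N: "abelian_group N" and h: "h \<in> hom (free_Abelian_group A) (add_monoid N)"
  shows "h 0 = \<zero>\<^bsub>N\<^esub>"
    and "Poly_Mapping.keys x \<subseteq> A \<Longrightarrow> h x \<in> carrier N"
    and "Poly_Mapping.keys x \<subseteq> A \<Longrightarrow> Poly_Mapping.keys y \<subseteq> A \<Longrightarrow> h (x + y) = h x \<oplus>\<^bsub>N\<^esub> h y"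
    and "Poly_Mapping.keys x \<subseteq> A \<Longrightarrow> h (- x) = \<ominus>\<^bsub>N\<^esub> h x"
    and "Poly_Mapping.keys x \<subseteq> A \<Longrightarrow> Poly_Mapping.keys y \<subseteq> A \<Longrightarrow> h (x - y) = h x \<ominus>\<^bsub>N\<^esub> h y"
proof -
  interpret N: abelian_group N by fact
  interpret h: group_hom "free_Abelian_group A" "add_monoid N" h
    by (simp add: group_hom_def group_hom_axioms_def h N.a_group)
  show "h 0 = \<zero>\<^bsub>N\<^esub>" using h.hom_one by simp
  show car: "h x \<in> carrier N" if "Poly_Mapping.keys x \<subseteq> A" for x using h.hom_closed[of x] that by simp
  show add: "h (x + y) = h x \<oplus>\<^bsub>N\<^esub> h y"
    if "Poly_Mapping.keys x \<subseteq> A" "Poly_Mapping.keys y \<subseteq> A" for x y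
    using h.hom_mult[of x y] that by simp
  show neg: "h (- x) = \<ominus>\<^bsub>N\<^esub> h x" if "Poly_Mapping.keys x \<subseteq> A" for x
    using h.hom_inv[of x] that by (simp add: a_inv_def)
  show "h (x - y) = h x \<ominus>\<^bsub>N\<^esub> h y" if "Poly_Mapping.keys x \<subseteq> A" "Poly_Mapping.keys y \<subseteq> A"
    using add[of x "- y"] neg[of y] that by (simp add: a_minus_def)
qed

lemma ring_module_module:
  assumes "cring S" "subring K S"
  shows "module (S\<lparr>carrier := K\<rparr>) (ring_module S)"
proof -
  interpret S: cring S by fact
  note K' = S.subring_mem[OF assms(2)]
  have "abelian_group (ring_module S)"
    by (rule abelian_groupI) (auto simp: ring_module_def S.a_ac intro: S.add.l_inv_ex)
  then show ?thesis
    by (rule moduleI[OF S.subring_is_cring[OF assms(2)]])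
      (auto simp: ring_module_def K' S.l_distr S.r_distr S.m_assoc)
qed

lemma ring_module_simps [simp]:
  "carrier (ring_module S) = carrier S" "add (ring_module S) = add S"
  "smult (ring_module S) = monoid.mult S"
  by (simp_all add: ring_module_def)

text \<open>\<open>frag_map_right S b\<close> represents the action of \<open>b\<close> on \<open>M \<otimes> S\<close>.\<close>

definition frag_map_right :: "('a, 'b) ring_scheme \<Rightarrow> 'a \<Rightarrow> ('m \<times> 'a \<Rightarrow>\<^sub>0 int) \<Rightarrow> ('m \<times> 'a \<Rightarrow>\<^sub>0 int)"
  where "frag_map_right S b = frag_extend (\<lambda>(m, s). frag_of (m, b \<otimes>\<^bsub>S\<^esub> s))"

lemma frag_map_right_simps [simp]:
  "frag_map_right S b 0 = 0"
  "frag_map_right S b (frag_of (m, s)) = frag_of (m, b \<otimes>\<^bsub>S\<^esub> s)"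
  "frag_map_right S b (x + y) = frag_map_right S b x + frag_map_right S b y"
  "frag_map_right S b (- x) = - frag_map_right S b x"
  "frag_map_right S b (x - y) = frag_map_right S b x - frag_map_right S b y"
  by (simp_all add: frag_map_right_def frag_extend_add frag_extend_minus frag_extend_diff)

lemma frag_map_right_kernel:
  assumes S: "cring S" and K: "subring K S" and M: "module (S\<lparr>carrier := K\<rparr>) M" and b: "b \<in> carrier S"
    and k: "k \<in> tensor_kernel (S\<lparr>carrier := K\<rparr>) M (ring_module S)"
  shows "frag_map_right S b k \<in> tensor_kernel (S\<lparr>carrier := K\<rparr>) M (ring_module S)"
proof -
  interpret S: cring S by fact
  let ?K = "S\<lparr>carrier := K\<rparr>" and ?T = "ring_module S"
  note T = ring_module_module[OF S K] and K' = S.subring_mem[OF K]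
  note cl = tensor_kernel_closed[OF M T]
  have rel: "frag_map_right S b h \<in> tensor_relators ?K M ?T" if "h \<in> tensor_relators ?K M ?T" for h
    using that
  proof (cases rule: tensor_relators_cases)
    case (add_left x x' y)
    then show ?thesis
      using tensor_relatorsI(1)[of x M x' "b \<otimes>\<^bsub>S\<^esub> y" ?T ?K] b by simp
  next
    case (add_right x y y')
    then show ?thesis
      using tensor_relatorsI(2)[of x M "b \<otimes>\<^bsub>S\<^esub> y" ?T "b \<otimes>\<^bsub>S\<^esub> y'" ?K] b by (simp add: S.r_distr)
  next
    case (smult a x y)
    then show ?thesis
      using tensor_relatorsI(3)[of a ?K x M "b \<otimes>\<^bsub>S\<^esub> y" ?T] b K' by (simp add: S.m_lcomm)
  qed
  show ?thesis using M T k
    by (induction rule: tensor_kernel_induct) (use rel cl in auto)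
qed

text \<open>If \<open>a\<close> is a common denominator of the second components, then \<open>a x = m \<otimes> 1\<close> in \<open>M \<otimes> S\<close> for some
  \<open>m\<close>; the homomorphisms \<open>ev a\<close> below compute this \<open>m\<close>.\<close>

lemma dense_denominators_flat:
  assumes S: "cring S" and K: "subring K S" and dense: "dense_denominators K S"
  shows "flat_module (S\<lparr>carrier := K\<rparr>) (ring_module S)"
proof -
  interpret S: cring S by fact
  let ?K = "S\<lparr>carrier := K\<rparr>" and ?T = "ring_module S"
  note T = ring_module_module[OF S K] and K' = S.subring_mem[OF K] and KE = subringE[OF K]
  \<comment> \<open>Sets of denominators that generate the unit ideal of \<open>S\<close>. Stability
    under \<open>K\<close> gives \<open>J J' \<subseteq> J \<inter> J'\<close>, and with it closure
    under finite intersections.\<close>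
  define dn where "dn = (\<lambda>J. J \<subseteq> K \<and> (\<forall>a\<in>K. \<forall>j\<in>J. a \<otimes>\<^bsub>S\<^esub> j \<in> J) \<and>
    (\<forall>H. ideal H S \<longrightarrow> J \<subseteq> H \<longrightarrow> \<one>\<^bsub>S\<^esub> \<in> H))"
  define den where "den = (\<lambda>s. {r \<in> K. r \<otimes>\<^bsub>S\<^esub> s \<in> K})"
  have dn_den: "dn (den s)" if s: "s \<in> carrier S" for s
    unfolding dn_def
  proof (intro conjI ballI)
    show "den s \<subseteq> K" by (auto simp: den_def)
    show "a \<otimes>\<^bsub>S\<^esub> j \<in> den s" if "a \<in> K" "j \<in> den s" for a j
      using that s K' KE(6) by (simp add: den_def S.m_assoc)
    show "\<forall>H. ideal H S \<longrightarrow> den s \<subseteq> H \<longrightarrow> \<one>\<^bsub>S\<^esub> \<in> H"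
      using dense s unfolding dense_denominators_def den_def by blast
  qed
  have dn_Int: "dn (J \<inter> J')" if J: "dn J" and J': "dn J'" for J J'
    unfolding dn_def
  proof (intro conjI ballI allI impI)
    show "J \<inter> J' \<subseteq> K" using J by (auto simp: dn_def)
    show "a \<otimes>\<^bsub>S\<^esub> j \<in> J \<inter> J'" if "a \<in> K" "j \<in> J \<inter> J'" for a j
      using that J J' by (auto simp: dn_def)
    fix H assume H: "ideal H S" and sub: "J \<inter> J' \<subseteq> H"
    interpret H: ideal H S by (rule H)
    have Jc: "j \<in> carrier S" "j' \<in> carrier S" if "j \<in> J" "j' \<in> J'" for j j'
      using J J' that K' by (auto simp: dn_def)
    have J'c: "j' \<in> carrier S" if "j' \<in> J'" for j' using J' that K' by (auto simp: dn_def)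
    \<comment> \<open>\<open>H' = (H : J')\<close> contains \<open>J\<close>, hence
      \<open>\<one>\<close>; so \<open>J' \<subseteq> H\<close>, and then
      \<open>\<one> \<in> H\<close>.\<close>
    define H' where "H' = {h \<in> carrier S. \<forall>j'\<in>J'. h \<otimes>\<^bsub>S\<^esub> j' \<in> H}"
    have "ideal H' S"
      by (rule S.ideal_if_closed)
        (auto simp: H'_def S.l_distr S.m_assoc J'c H.I_l_closed H.zero_closed)
    moreover have "J \<subseteq> H'"
    proof
      fix j assume j: "j \<in> J"
      have "j \<otimes>\<^bsub>S\<^esub> j' \<in> J \<inter> J'" if j': "j' \<in> J'" for j'
      proof -
        have "j \<otimes>\<^bsub>S\<^esub> j' \<in> J'" "j' \<otimes>\<^bsub>S\<^esub> j \<in> J" using j j' J J' by (auto simp: dn_def)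
        then show ?thesis using S.m_comm[OF Jc[OF j j']] by (metis IntI)
      qed
      then show "j \<in> H'" using sub j J K' by (auto simp: H'_def dn_def)
    qed
    ultimately have "\<one>\<^bsub>S\<^esub> \<in> H'" using J by (auto simp: dn_def)
    then have "J' \<subseteq> H" using J'c by (auto simp: H'_def)
    then show "\<one>\<^bsub>S\<^esub> \<in> H" using J' H by (auto simp: dn_def)
  qed
  have dn_K: "dn K" unfolding dn_def using KE(3,6) by auto
  have dn_finite: "\<exists>J. dn J \<and> (\<forall>a\<in>J. \<forall>s\<in>A. a \<otimes>\<^bsub>S\<^esub> s \<in> K)" if "finite A" "A \<subseteq> carrier S" for A
    using that
  proof (induction rule: finite_induct)
    case empty
    show ?case using dn_K by auto
  next
    case (insert s A)
    then obtain J where J: "dn J" "\<forall>a\<in>J. \<forall>s\<in>A. a \<otimes>\<^bsub>S\<^esub> s \<in> K" by auto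
    show ?case
      using dn_Int[OF J(1) dn_den[of s]] J(2) insert.prems
      by (intro exI[of _ "J \<inter> den s"]) (auto simp: den_def)
  qed
  \<comment> \<open>The intended value at \<open>m \<otimes> s\<close> is \<open>(a s) m\<close>.
    The default \<open>\<zero>\<close> makes it total on generators, so that the universal property
    of the free group applies for every \<open>a\<close>.\<close>
  define val where "val = (\<lambda>(M :: ('a, 'a list) module) a (m, s).
    if a \<otimes>\<^bsub>S\<^esub> s \<in> K then (a \<otimes>\<^bsub>S\<^esub> s) \<odot>\<^bsub>M\<^esub> m else \<zero>\<^bsub>M\<^esub>)"
  define is_ev where "is_ev = (\<lambda>(M :: ('a, 'a list) module) ev. \<forall>a.
    ev a \<in> hom (free_Abelian_group (carrier M \<times> carrier S)) (add_monoid M) \<and>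
    (\<forall>u\<in>carrier M \<times> carrier S. ev a (frag_of u) = val M a u))"
  have ev_ex: "\<exists>ev. is_ev M ev" if M: "module ?K M" for M :: "('a, 'a list) module"
  proof -
    interpret M: module ?K M by fact
    have "\<exists>h. h \<in> hom (free_Abelian_group (carrier M \<times> carrier S)) (add_monoid M) \<and>
      (\<forall>u\<in>carrier M \<times> carrier S. h (frag_of u) = val M a u)" for a
    proof -
      have "val M a ` (carrier M \<times> carrier S) \<subseteq> carrier (add_monoid M)"
        using M.smult_closed by (auto simp: val_def)
      from comm_group.free_Abelian_group_universal[OF M.a_comm_group this] show ?thesis by metis
    qed
    then show ?thesis unfolding is_ev_def by metis
  qed
  \<comment> \<open>Because of the default value, \<open>ev a\<close> need not respect every
    relation. But each relator is killed for all \<open>a\<close> in some dense set, and an element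
    of the kernel involves finitely many relators.\<close>
  have ev_kernel: "\<exists>J. dn J \<and> (\<forall>a\<in>J. ev a k = \<zero>\<^bsub>N\<^esub>)"
    if N: "module ?K N" and ev: "is_ev N ev" and k: "k \<in> tensor_kernel ?K N ?T"
    for N :: "('a, 'a list) module" and ev k
  proof -
    interpret N: module ?K N by fact
    let ?A = "carrier N \<times> carrier S"
    have ev1: "ev a \<in> hom (free_Abelian_group ?A) (add_monoid N)"
      and ev2: "n \<in> carrier N \<Longrightarrow> s \<in> carrier S \<Longrightarrow> a \<otimes>\<^bsub>S\<^esub> s \<in> K \<Longrightarrow>
        ev a (frag_of (n, s)) = (a \<otimes>\<^bsub>S\<^esub> s) \<odot>\<^bsub>N\<^esub> n" for a n s
      using ev by (auto simp: is_ev_def val_def)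
    note evh = free_Abelian_group_hom[OF N.abelian_group_axioms ev1]
    have sub: "Poly_Mapping.keys (u - v) \<subseteq> ?A"
      if "Poly_Mapping.keys u \<subseteq> ?A" "Poly_Mapping.keys v \<subseteq> ?A" for u v :: "'a list \<times> 'a \<Rightarrow>\<^sub>0 int"
      using that keys_diff[of u v] by blast
    have rel: "\<exists>J. dn J \<and> (\<forall>a\<in>J. ev a h = \<zero>\<^bsub>N\<^esub>)" if "h \<in> tensor_relators ?K N ?T" for h
      using that
    proof (cases rule: tensor_relators_cases)
      case (add_left n n' s)
      have "ev a h = \<zero>\<^bsub>N\<^esub>" if "a \<in> den s" for a
        using that add_left
        by (simp add: den_def evh(5) sub ev2 N.smult_r_distr a_minus_def N.minus_add N.a_ac N.r_neg)
      then show ?thesis using dn_den[of s] add_left by auto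
    next
      case (add_right n s s')
      have "ev a h = \<zero>\<^bsub>N\<^esub>" if "a \<in> den s \<inter> den s'" for a
        using that add_right K' KE(7)
        by (simp add: den_def evh(5) sub ev2 S.r_distr N.smult_l_distr[simplified] a_minus_def N.minus_add
            N.a_ac N.r_neg)
      then show ?thesis using dn_Int[OF dn_den dn_den] add_right by (metis ring_module_simps(1))
    next
      case (smult b n s)
      have "ev a h = \<zero>\<^bsub>N\<^esub>" if a: "a \<in> den s" for a
      proof -
        have eq: "a \<otimes>\<^bsub>S\<^esub> (b \<otimes>\<^bsub>S\<^esub> s) = (a \<otimes>\<^bsub>S\<^esub> s) \<otimes>\<^bsub>S\<^esub> b"
          using a smult K' by (simp add: den_def S.m_ac)
        then show ?thesis
          using a smult K' KE(6)
          by (simp add: den_def evh(5) ev2 a_minus_def N.smult_assoc1[simplified] N.r_neg)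
      qed
      then show ?thesis using dn_den[of s] smult by auto
    qed
    have "Poly_Mapping.keys k \<subseteq> ?A \<and> (\<exists>J. dn J \<and> (\<forall>a\<in>J. ev a k = \<zero>\<^bsub>N\<^esub>))"
      using N T k
    proof (induction rule: tensor_kernel_induct)
      case zero
      show ?case using dn_K evh(1) by auto
    next
      case (rel h)
      then show ?case using \<open>\<And>h. h \<in> tensor_relators ?K N ?T \<Longrightarrow> _\<close> tensor_relators_keys[OF N T rel] by simp
    next
      case (neg h)
      have keys: "Poly_Mapping.keys h \<subseteq> ?A" using tensor_relators_keys[OF N T neg] by simp
      obtain J where "dn J" "\<forall>a\<in>J. ev a h = \<zero>\<^bsub>N\<^esub>" using rel[OF neg] by blast
      then show ?case using keys by (auto simp: evh(4)[OF keys])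
    next
      case (add x y)
      then obtain J J' where J: "dn J" "\<forall>a\<in>J. ev a x = \<zero>\<^bsub>N\<^esub>" "dn J'" "\<forall>a\<in>J'. ev a y = \<zero>\<^bsub>N\<^esub>" by blast
      have keys: "Poly_Mapping.keys x \<subseteq> ?A" "Poly_Mapping.keys y \<subseteq> ?A" using add by auto
      then have "Poly_Mapping.keys (x + y) \<subseteq> ?A" using keys_add[of x y] by blast
      moreover have "\<forall>a\<in>J \<inter> J'. ev a (x + y) = \<zero>\<^bsub>N\<^esub>" using J evh(3)[OF keys] by auto
      ultimately show ?case using dn_Int[OF J(1,3)] by blast
    qed
    then show ?thesis ..
  qed
  show ?thesis
    unfolding flat_module_def
  proof (intro conjI T allI impI)
    fix M N :: "('a, 'a list) module" and f
    assume M: "module ?K M" and N: "module ?K N" and f: "f \<in> module_homs ?K M N"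
      and inj: "inj_on f (carrier M)"
    interpret M: module ?K M by fact
    interpret N: module ?K N by fact
    note fD = module_homsD[OF f]
    note cl = tensor_kernel_closed[OF M T]
    let ?A = "carrier M \<times> carrier S"
    have f0: "f \<zero>\<^bsub>M\<^esub> = \<zero>\<^bsub>N\<^esub>"
      using fD(2)[of "\<zero>\<^bsub>M\<^esub>" "\<zero>\<^bsub>M\<^esub>"] fD(1)[of "\<zero>\<^bsub>M\<^esub>"] by simp
    have f_minus: "f (u \<ominus>\<^bsub>M\<^esub> v) = f u \<ominus>\<^bsub>N\<^esub> f v" if "u \<in> carrier M" "v \<in> carrier M" for u v
    proof -
      have "f (u \<ominus>\<^bsub>M\<^esub> v) \<oplus>\<^bsub>N\<^esub> f v = f u"
        using that fD(2)[of "u \<ominus>\<^bsub>M\<^esub> v" v] by (simp add: a_minus_def M.a_assoc M.l_neg)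
      then have "f u \<ominus>\<^bsub>N\<^esub> f v = f (u \<ominus>\<^bsub>M\<^esub> v) \<oplus>\<^bsub>N\<^esub> f v \<ominus>\<^bsub>N\<^esub> f v" by simp
      also have "\<dots> = f (u \<ominus>\<^bsub>M\<^esub> v)" using that fD(1) by (simp add: a_minus_def N.a_assoc N.r_neg)
      finally show ?thesis by simp
    qed
    show "inj_on (tensor_map ?K N ?T f) (carrier (tensor_product ?K M ?T))"
      unfolding tensor_map_inj_iff[OF M N T f]
    proof (intro allI impI)
      fix x assume "Poly_Mapping.keys x \<subseteq> carrier M \<times> carrier ?T"
        and fx: "frag_map_left f x \<in> tensor_kernel ?K N ?T"
      then have x: "Poly_Mapping.keys x \<subseteq> ?A" by simp
      let ?ker = "tensor_kernel ?K M ?T"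
      \<comment> \<open>The annihilator of the class of \<open>x\<close> in
        \<open>M \<otimes> S\<close>. It is an ideal, so it contains \<open>\<one>\<close>, and
        \<open>x\<close> vanishes, once a dense set of denominators lies in it.\<close>
      define H where "H = {h \<in> carrier S. frag_map_right S h x \<in> ?ker}"
      have H_add: "frag_map_right S (a \<oplus>\<^bsub>S\<^esub> b) x - frag_map_right S a x - frag_map_right S b x \<in> ?ker"
        if ab: "a \<in> carrier S" "b \<in> carrier S" for a b
        using x
      proof (induction rule: frag_induction)
        case (one u)
        then show ?case
          using cl(2)[OF tensor_relatorsI(2)[of "fst u" M "a \<otimes>\<^bsub>S\<^esub> snd u" ?T "b \<otimes>\<^bsub>S\<^esub> snd u" ?K]] ab
          by (cases u) (auto simp: S.l_distr)
      next
        case (diff u v)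
        then show ?case using cl(6)[OF diff] by (simp add: algebra_simps)
      qed (use cl(1) in simp)
      have H_mult: "frag_map_right S (a \<otimes>\<^bsub>S\<^esub> b) x = frag_map_right S a (frag_map_right S b x)"
        if ab: "a \<in> carrier S" "b \<in> carrier S" for a b
        using x by (induction rule: frag_induction) (auto simp: ab S.m_assoc)
      have H_one: "frag_map_right S \<one>\<^bsub>S\<^esub> x = x"
        using x by (induction rule: frag_induction) auto
      have H: "ideal H S"
      proof (rule S.ideal_if_closed)
        show "H \<subseteq> carrier S" by (auto simp: H_def)
        show "\<zero>\<^bsub>S\<^esub> \<in> H" using cl(4)[OF H_add[of "\<zero>\<^bsub>S\<^esub>" "\<zero>\<^bsub>S\<^esub>"]] by (simp add: H_def)
        show "a \<oplus>\<^bsub>S\<^esub> b \<in> H" if "a \<in> H" "b \<in> H" for a b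
        proof -
          have ab: "a \<in> carrier S" "b \<in> carrier S" using that by (auto simp: H_def)
          have "frag_map_right S (a \<oplus>\<^bsub>S\<^esub> b) x - frag_map_right S a x - frag_map_right S b x
              + (frag_map_right S a x + frag_map_right S b x) \<in> ?ker"
            using that by (intro cl(5) H_add[OF ab]) (auto simp: H_def)
          then show ?thesis using ab by (simp add: H_def)
        qed
        show "b \<otimes>\<^bsub>S\<^esub> a \<in> H" if "a \<in> H" "b \<in> carrier S" for a b
          using that frag_map_right_kernel[OF S K M that(2)] by (auto simp: H_def H_mult)
      qed
      obtain evM evN where evM: "is_ev M evM" and evN: "is_ev N evN" using ev_ex[OF M] ev_ex[OF N] by blast
      have evM1: "evM a \<in> hom (free_Abelian_group ?A) (add_monoid M)" for a
        using evM by (auto simp: is_ev_def)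
      have evN1: "evN a \<in> hom (free_Abelian_group (carrier N \<times> carrier S)) (add_monoid N)" for a
        using evN by (auto simp: is_ev_def)
      have evM2: "evM a (frag_of u) = val M a u" if "u \<in> ?A" for a u
        using evM that by (auto simp: is_ev_def)
      have evN2: "evN a (frag_of u) = val N a u" if "u \<in> carrier N \<times> carrier S" for a u
        using evN that by (auto simp: is_ev_def)
      note hM = free_Abelian_group_hom[OF M.abelian_group_axioms evM1]
      note hN = free_Abelian_group_hom[OF N.abelian_group_axioms evN1]
      obtain J where J: "dn J" "\<forall>a\<in>J. evN a (frag_map_left f x) = \<zero>\<^bsub>N\<^esub>"
        using ev_kernel[OF N evN fx] by blast
      have "finite (snd ` Poly_Mapping.keys x)" "snd ` Poly_Mapping.keys x \<subseteq> carrier S" using x by auto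
      then obtain J' where J': "dn J'" "\<forall>a\<in>J'. \<forall>s\<in>snd ` Poly_Mapping.keys x. a \<otimes>\<^bsub>S\<^esub> s \<in> K"
        using dn_finite by blast
      have "J \<inter> J' \<subseteq> H"
      proof
        fix a assume a: "a \<in> J \<inter> J'"
        then have ac: "a \<in> carrier S" using J(1) K' by (auto simp: dn_def)
        let ?A' = "{(m, s). m \<in> carrier M \<and> s \<in> carrier S \<and> a \<otimes>\<^bsub>S\<^esub> s \<in> K}"
        have xA': "Poly_Mapping.keys x \<subseteq> ?A'" using x J'(2) a by fastforce
        \<comment> \<open>Naturality of the evaluations in the module: \<open>f (evM a x)\<close> is
          the evaluation of the image of \<open>x\<close>, which is zero for
          \<open>a \<in> J\<close>. Injectivity of \<open>f\<close> then gives
          \<open>evM a x = \<zero>\<close>.\<close>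
        have "Poly_Mapping.keys x \<subseteq> ?A \<and> f (evM a x) = evN a (frag_map_left f x) \<and>
          Poly_Mapping.keys (frag_map_left f x) \<subseteq> carrier N \<times> carrier S"
          using x
        proof (induction rule: frag_induction)
          case zero
          show ?case using hM(1) hN(1) f0 by simp
        next
          case (one u)
          then obtain m s where u: "u = (m, s)" "m \<in> carrier M" "s \<in> carrier S" by auto
          then show ?case
            using evM2[of u a] evN2[of "(f m, s)" a] fD(1,3) f0 by (simp add: val_def)
        next
          case (diff u v)
          then have ku: "Poly_Mapping.keys u \<subseteq> ?A" "Poly_Mapping.keys v \<subseteq> ?A"
            and kf: "Poly_Mapping.keys (frag_map_left f u) \<subseteq> carrier N \<times> carrier S"
              "Poly_Mapping.keys (frag_map_left f v) \<subseteq> carrier N \<times> carrier S"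
            and e: "f (evM a u) = evN a (frag_map_left f u)" "f (evM a v) = evN a (frag_map_left f v)"
            by auto
          have "f (evM a (u - v)) = evN a (frag_map_left f (u - v))"
            using f_minus[OF hM(2)[OF ku(1)] hM(2)[OF ku(2)]] e by (simp add: hM(5)[OF ku] hN(5)[OF kf])
          then show ?case
            using ku kf keys_diff[of u v] keys_diff[of "frag_map_left f u" "frag_map_left f v"] by auto
        qed
        then have "f (evM a x) = f \<zero>\<^bsub>M\<^esub>" using J(2) a f0 by auto
        then have ev0: "evM a x = \<zero>\<^bsub>M\<^esub>" using inj_onD[OF inj] hM(2)[OF x] by blast
        have M_minus: "frag_of (u \<ominus>\<^bsub>M\<^esub> v, \<one>\<^bsub>S\<^esub>) - frag_of (u, \<one>\<^bsub>S\<^esub>) + frag_of (v, \<one>\<^bsub>S\<^esub>) \<in> ?ker"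
          if uv: "u \<in> carrier M" "v \<in> carrier M" for u v
        proof -
          have "u \<ominus>\<^bsub>M\<^esub> v \<oplus>\<^bsub>M\<^esub> v = u" using uv by (simp add: a_minus_def M.a_assoc M.l_neg)
          then have "frag_of (u, \<one>\<^bsub>S\<^esub>) - frag_of (u \<ominus>\<^bsub>M\<^esub> v, \<one>\<^bsub>S\<^esub>) - frag_of (v, \<one>\<^bsub>S\<^esub>) \<in> ?ker"
            using cl(2)[OF tensor_relatorsI(1)[of "u \<ominus>\<^bsub>M\<^esub> v" M v "\<one>\<^bsub>S\<^esub>" ?T ?K]] uv by simp
          from cl(4)[OF this] show ?thesis by (simp add: algebra_simps)
        qed
        have zero: "frag_of (\<zero>\<^bsub>M\<^esub>, \<one>\<^bsub>S\<^esub>) \<in> ?ker"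
          using M_minus[of "\<zero>\<^bsub>M\<^esub>" "\<zero>\<^bsub>M\<^esub>"] M.r_neg[OF M.zero_closed] unfolding a_minus_def by simp
        \<comment> \<open>Since \<open>a\<close> is a common denominator, \<open>a x\<close> is the
          class of \<open>evM a x \<otimes> 1\<close>; on generators this moves the scalar
          \<open>a s\<close> across the tensor sign.\<close>
        have "Poly_Mapping.keys x \<subseteq> ?A \<and> frag_map_right S a x - frag_of (evM a x, \<one>\<^bsub>S\<^esub>) \<in> ?ker"
          using xA'
        proof (induction rule: frag_induction)
          case zero
          show ?case using cl(4)[OF \<open>frag_of (\<zero>\<^bsub>M\<^esub>, \<one>\<^bsub>S\<^esub>) \<in> ?ker\<close>] hM(1) by simp
        next
          case (one u)
          then obtain m s where u: "u = (m, s)" "m \<in> carrier M" "s \<in> carrier S" "a \<otimes>\<^bsub>S\<^esub> s \<in> K" by auto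
          have "frag_of ((a \<otimes>\<^bsub>S\<^esub> s) \<odot>\<^bsub>M\<^esub> m, \<one>\<^bsub>S\<^esub>) - frag_of (m, a \<otimes>\<^bsub>S\<^esub> s) \<in> ?ker"
            using cl(2)[OF tensor_relatorsI(3)[of "a \<otimes>\<^bsub>S\<^esub> s" ?K m M "\<one>\<^bsub>S\<^esub>" ?T]] u K' by simp
          from cl(4)[OF this] show ?case using u evM2[of u a] by (simp add: val_def)
        next
          case (diff u v)
          then have ku: "Poly_Mapping.keys u \<subseteq> ?A" "Poly_Mapping.keys v \<subseteq> ?A"
            and e: "frag_map_right S a u - frag_of (evM a u, \<one>\<^bsub>S\<^esub>) \<in> ?ker"
              "frag_map_right S a v - frag_of (evM a v, \<one>\<^bsub>S\<^esub>) \<in> ?ker" by auto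
          have "frag_map_right S a (u - v) - frag_of (evM a (u - v), \<one>\<^bsub>S\<^esub>) \<in> ?ker"
            using cl(6)[OF cl(6)[OF e] M_minus[OF hM(2)[OF ku(1), of a] hM(2)[OF ku(2), of a]]]
            by (simp add: hM(5)[OF ku] algebra_simps)
          then show ?case using ku keys_diff[of u v] by auto
        qed
        then have "frag_map_right S a x - frag_of (evM a x, \<one>\<^bsub>S\<^esub>) \<in> ?ker" ..
        from cl(5)[OF this zero] have "frag_map_right S a x \<in> ?ker" by (simp add: ev0)
        then show "a \<in> H" using ac by (simp add: H_def)
      qed
      then have "\<one>\<^bsub>S\<^esub> \<in> H" using dn_Int[OF J(1) J'(1)] H by (auto simp: dn_def)
      then show "x \<in> ?ker" using H_one by (simp add: H_def)
    qed
  qed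
qed

section \<open>Integrally closed subextensions and existence of the hull\<close>

context cring
begin

lemma subring_trans:
  assumes "subring T R" "subring V (R\<lparr>carrier := T\<rparr>)"
  shows "subring V R"
proof -
  have V: "V \<subseteq> T" using subringE(1)[OF assms(2)] by simp
  have "ring (R\<lparr>carrier := V\<rparr>)"
    using ring.subring_is_ring[OF subring_is_ring[OF assms(1)] assms(2)] by simp
  then show ?thesis using subring_iff[of V] V subringE(1)[OF assms(1)] by auto
qed

lemma ideal_subringD:
  assumes B: "subring B R" and H: "ideal H (R\<lparr>carrier := B\<rparr>)"
  shows "H \<subseteq> B" "\<zero> \<in> H" "a \<in> H \<Longrightarrow> b \<in> H \<Longrightarrow> a \<oplus> b \<in> H"
    "a \<in> H \<Longrightarrow> x \<in> B \<Longrightarrow> x \<otimes> a \<in> H" "a \<in> H \<Longrightarrow> x \<in> B \<Longrightarrow> a \<otimes> x \<in> H" "a \<in> H \<Longrightarrow> \<ominus> a \<in> H"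
proof -
  interpret H: ideal H "R\<lparr>carrier := B\<rparr>" by (rule H)
  show sub: "H \<subseteq> B" using H.a_subset by simp
  show "\<zero> \<in> H" using additive_subgroup.zero_closed[OF ideal.axioms(1)[OF H]] by simp
  show "a \<in> H \<Longrightarrow> b \<in> H \<Longrightarrow> a \<oplus> b \<in> H"
    using additive_subgroup.a_closed[OF ideal.axioms(1)[OF H]] by simp
  show l: "a \<in> H \<Longrightarrow> x \<in> B \<Longrightarrow> x \<otimes> a \<in> H" for a x using H.I_l_closed by simp
  show "a \<in> H \<Longrightarrow> x \<in> B \<Longrightarrow> a \<otimes> x \<in> H" using H.I_r_closed by simp
  show "\<ominus> a \<in> H" if a: "a \<in> H"
    using l[OF a subringE(5)[OF B subringE(3)[OF B]]] subring_mem[OF B subsetD[OF sub a]]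
    by (simp add: l_minus)
qed

text \<open>One direction is \<open>pruefer_integral_mem\<close> for \<open>U = K\<close>.
  Conversely, \<open>integrally_closed_denominators\<close> makes denominators dense in every
  \<open>V\<close> between \<open>K\<close> and \<open>T\<close>, which yields flatness and the
  epimorphism property.\<close>

lemma pruefer_ext_iff_integrally_closed:
  assumes K: "subring K R" and FCP: "FCP K R" and T: "subring T R" and KT: "K \<subseteq> T"
  shows "pruefer_ext K (R\<lparr>carrier := T\<rparr>) \<longleftrightarrow> (\<forall>s\<in>T. integral_over K R s \<longrightarrow> s \<in> K)"
proof
  assume "pruefer_ext K (R\<lparr>carrier := T\<rparr>)"
  then show "\<forall>s\<in>T. integral_over K R s \<longrightarrow> s \<in> K"
    using pruefer_integral_mem[OF K T KT _ K subset_refl] by blast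
next
  assume closed: "\<forall>s\<in>T. integral_over K R s \<longrightarrow> s \<in> K"
  have "flat_epi_ext K (R\<lparr>carrier := V\<rparr>)" if V: "V \<in> intermediate_rings K (R\<lparr>carrier := T\<rparr>)" for V
  proof -
    have VT: "subring V (R\<lparr>carrier := T\<rparr>)" and KV: "K \<subseteq> V" using V by (auto simp: intermediate_rings_def)
    have V: "subring V R" by (rule subring_trans[OF T VT])
    have "V \<subseteq> T" using subringE(1)[OF VT] by simp
    let ?V = "R\<lparr>carrier := V\<rparr>"
    have "\<one> \<in> H" if s: "s \<in> V" and H: "ideal H ?V" and den: "{r \<in> K. r \<otimes> s \<in> K} \<subseteq> H" for s H
      using closed s \<open>V \<subseteq> T\<close> ideal_subringD[OF V H]
      by (intro integrally_closed_denominators[OF K FCP T KT _ _ _ _ _ den]) auto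
    then have dense: "dense_denominators K ?V" unfolding dense_denominators_def by simp
    note KV' = subring_is_cring[OF V] subring_of_subring[OF K V KV]
    show ?thesis
      using dense_denominators_epi[OF KV' dense] dense_denominators_flat[OF KV' dense]
      unfolding flat_epi_ext_def by simp
  qed
  then show "pruefer_ext K (R\<lparr>carrier := T\<rparr>)" unfolding pruefer_ext_def by simp
qed

text \<open>\<open>G\<close> consists of the elements that the ideal of their denominators with respect to \<open>T'\<close>, which
  generates the unit ideal of \<open>T\<close>, moves into \<open>T'\<close>.\<close>

lemma integrally_closed_compositum:
  assumes K: "subring K R" and FCP: "FCP K R" and T: "subring T R" and KT: "K \<subseteq> T"
    and T': "subring T' R" and KT': "K \<subseteq> T'"
    and closed: "\<And>s. s \<in> T \<Longrightarrow> integral_over K R s \<Longrightarrow> s \<in> K"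
    and closed': "\<And>s. s \<in> T' \<Longrightarrow> integral_over K R s \<Longrightarrow> s \<in> K"
  shows "\<exists>G. subring G R \<and> T \<subseteq> G \<and> T' \<subseteq> G \<and> (\<forall>s\<in>G. integral_over K R s \<longrightarrow> s \<in> K)"
proof -
  note KE = subringE[OF K] and TE = subringE[OF T] and TE' = subringE[OF T']
  note K' = subring_mem[OF K]
  let ?T = "R\<lparr>carrier := T\<rparr>"
  interpret TR: cring ?T by (rule subring_is_cring[OF T])
  define den where "den = (\<lambda>s. {r \<in> K. r \<otimes> s \<in> T'})"
  define G where "G = {s \<in> carrier R. \<forall>H. ideal H ?T \<longrightarrow> den s \<subseteq> H \<longrightarrow> \<one> \<in> H}"
  \<comment> \<open>Products from \<open>den s\<close> and \<open>den s'\<close> are denominators of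
    \<open>u\<close>, and the ideal \<open>(H : den s')\<close> shows that they generate the unit
    ideal. The closure properties of \<open>G\<close> reduce to this criterion.\<close>
  have GI: "u \<in> G" if s: "s \<in> G" and s': "s' \<in> G" and u: "u \<in> carrier R"
    and prod: "\<And>j j'. j \<in> den s \<Longrightarrow> j' \<in> den s' \<Longrightarrow> j \<otimes> j' \<otimes> u \<in> T'" for s s' u
    unfolding G_def
  proof (intro CollectI conjI u allI impI)
    fix H assume H: "ideal H ?T" and sub: "den u \<subseteq> H"
    note HD = ideal_subringD[OF T H]
    have denT: "j \<in> T" "j \<in> K" if "j \<in> den v" for j v using that KT by (auto simp: den_def)
    define H' where "H' = {h \<in> T. \<forall>j\<in>den s'. h \<otimes> j \<in> H}"
    have "ideal H' ?T"
    proof (rule TR.ideal_if_closed)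
      show "H' \<subseteq> carrier ?T" by (auto simp: H'_def)
      show "\<zero>\<^bsub>?T\<^esub> \<in> H'" using TE(2) HD(2) K' denT by (auto simp: H'_def)
      show "a \<oplus>\<^bsub>?T\<^esub> b \<in> H'" if "a \<in> H'" "b \<in> H'" for a b
        using that TE(7) HD(3) K' denT(2) subring_mem[OF T] by (simp add: H'_def l_distr)
      show "x \<otimes>\<^bsub>?T\<^esub> a \<in> H'" if "a \<in> H'" "x \<in> carrier ?T" for a x
        using that TE(6) HD(4) K' denT(2) subring_mem[OF T] by (simp add: H'_def m_assoc)
    qed
    moreover have "den s \<subseteq> H'"
    proof
      fix j assume j: "j \<in> den s"
      have "j \<otimes> j' \<in> H" if j': "j' \<in> den s'" for j'
        using prod[OF j j'] KE(6)[OF denT(2)[OF j] denT(2)[OF j']] sub by (auto simp: den_def)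
      then show "j \<in> H'" using denT(1)[OF j] by (simp add: H'_def)
    qed
    ultimately have "\<one> \<in> H'" using s by (auto simp: G_def)
    then have "den s' \<subseteq> H" using K' denT(2) by (auto simp: H'_def)
    then show "\<one> \<in> H" using s' H by (auto simp: G_def)
  qed
  have "T' \<subseteq> G"
  proof
    fix s assume s: "s \<in> T'"
    have "\<one> \<in> den s" using s KE(3) subring_mem[OF T' s] by (simp add: den_def)
    then show "s \<in> G" using subring_mem[OF T' s] by (auto simp: G_def)
  qed
  moreover have "T \<subseteq> G"
  proof
    fix s assume s: "s \<in> T"
    have "\<one> \<in> H" if H: "ideal H ?T" "den s \<subseteq> H" for H
    proof -
      have den: "{r \<in> K. r \<otimes> s \<in> K} \<subseteq> H" using H(2) KT' by (auto simp: den_def)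
      show ?thesis
        using ideal_subringD[OF T H(1)] s closed
        by (intro integrally_closed_denominators[OF K FCP T KT _ s _ _ _ den]) auto
    qed
    then show "s \<in> G" using subring_mem[OF T s] by (auto simp: G_def)
  qed
  moreover have "subring G R"
  proof (rule subringI)
    show "G \<subseteq> carrier R" by (auto simp: G_def)
    show "\<one> \<in> G" using \<open>T' \<subseteq> G\<close> TE'(3) by auto
    have Gc: "s \<in> carrier R" if "s \<in> G" for s using that by (simp add: G_def)
    have dc: "j \<in> carrier R" "j \<in> T'" "j \<otimes> s \<in> T'" if "j \<in> den s" for j s
      using that K' KT' by (auto simp: den_def)
    show "\<ominus> s \<in> G" if s: "s \<in> G" for s
    proof (rule GI[OF s s])
      show "\<ominus> s \<in> carrier R" using Gc[OF s] by simp
      fix j j' assume j: "j \<in> den s" "j' \<in> den s"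
      have "j \<otimes> j' \<otimes> (\<ominus> s) = \<ominus> (j \<otimes> (j' \<otimes> s))"
        using Gc[OF s] dc(1)[OF j(1)] dc(1)[OF j(2)] by (simp add: r_minus m_assoc)
      then show "j \<otimes> j' \<otimes> (\<ominus> s) \<in> T'" using TE'(5,6) dc[OF j(1)] dc[OF j(2)] by simp
    qed
    fix s s' assume s: "s \<in> G" "s' \<in> G"
    note sc = Gc[OF s(1)] Gc[OF s(2)]
    show "s \<oplus> s' \<in> G"
    proof (rule GI[OF s])
      show "s \<oplus> s' \<in> carrier R" using sc by simp
      fix j j' assume j: "j \<in> den s" "j' \<in> den s'"
      have "j \<otimes> j' \<otimes> (s \<oplus> s') = j' \<otimes> (j \<otimes> s) \<oplus> j \<otimes> (j' \<otimes> s')"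
        using sc dc(1)[OF j(1)] dc(1)[OF j(2)] by (simp add: r_distr m_ac)
      then show "j \<otimes> j' \<otimes> (s \<oplus> s') \<in> T'" using TE'(6,7) dc[OF j(1)] dc[OF j(2)] by simp
    qed
    show "s \<otimes> s' \<in> G"
    proof (rule GI[OF s])
      show "s \<otimes> s' \<in> carrier R" using sc by simp
      fix j j' assume j: "j \<in> den s" "j' \<in> den s'"
      have "j \<otimes> j' \<otimes> (s \<otimes> s') = (j \<otimes> s) \<otimes> (j' \<otimes> s')"
        using sc dc(1)[OF j(1)] dc(1)[OF j(2)] by (simp add: m_ac)
      then show "j \<otimes> j' \<otimes> (s \<otimes> s') \<in> T'" using TE'(6) dc[OF j(1)] dc[OF j(2)] by simp
    qed
  qed
  moreover have "s \<in> K" if sG: "s \<in> G" and int: "integral_over K R s" for s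
  proof -
    have s: "s \<in> carrier R" using sG by (simp add: G_def)
    \<comment> \<open>For a denominator \<open>j\<close> of \<open>s\<close>, \<open>j s\<close> is
      an integral element of \<open>T'\<close>, hence lies in \<open>K\<close>. So
      \<open>den s\<close> is contained in the ideal \<open>(T : s)\<close>, and
      \<open>s \<in> G\<close> yields \<open>s \<in> T\<close>.\<close>
    define H where "H = {h \<in> T. h \<otimes> s \<in> T}"
    have "ideal H ?T"
    proof (rule TR.ideal_if_closed)
      show "H \<subseteq> carrier ?T" "\<zero>\<^bsub>?T\<^esub> \<in> H" using TE(2) s by (auto simp: H_def)
      show "a \<oplus>\<^bsub>?T\<^esub> b \<in> H" if "a \<in> H" "b \<in> H" for a b
        using that TE(7) subring_mem[OF T] s by (simp add: H_def l_distr)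
      show "x \<otimes>\<^bsub>?T\<^esub> a \<in> H" if "a \<in> H" "x \<in> carrier ?T" for a x
        using that TE(6) subring_mem[OF T] s by (simp add: H_def m_assoc)
    qed
    moreover have "den s \<subseteq> H"
    proof
      fix j assume "j \<in> den s"
      then have j: "j \<in> K" "j \<otimes> s \<in> T'" by (auto simp: den_def)
      have "j \<otimes> s \<in> K" using closed'[OF j(2) integral_over_smult[OF K s j(1) int]] .
      then show "j \<in> H" using j(1) KT by (auto simp: H_def)
    qed
    ultimately have "\<one> \<in> H" using sG by (auto simp: G_def)
    then have "s \<in> T" using s by (simp add: H_def)
    then show ?thesis using closed int by blast
  qed
  ultimately show ?thesis by blast
qed

text \<open>FCP supplies a maximal Pruefer subextension \<open>M\<close>. For any other one
  \<open>T\<close>, the ring \<open>G\<close> above both is again Pruefer over \<open>K\<close>,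
  which forces \<open>T \<subseteq> M\<close>; this determines the value of
  \<open>GREATEST\<close>.\<close>

lemma pruefer_hull_greatest:
  assumes K: "subring K R" and FCP: "FCP K R"
  shows "pruefer_hull K R \<in> intermediate_rings K R"
    "pruefer_ext K (R\<lparr>carrier := pruefer_hull K R\<rparr>)"
proof -
  let ?P = "\<lambda>T. T \<in> intermediate_rings K R \<and> pruefer_ext K (R\<lparr>carrier := T\<rparr>)"
  have P_iff: "?P T \<longleftrightarrow> subring T R \<and> K \<subseteq> T \<and> (\<forall>s\<in>T. integral_over K R s \<longrightarrow> s \<in> K)" for T
    unfolding intermediate_rings_def using pruefer_ext_iff_integrally_closed[OF K FCP] by blast
  have "K \<in> Collect ?P" using P_iff[of K] K by simp
  then obtain M where M: "?P M" and max: "\<And>T. ?P T \<Longrightarrow> M \<subseteq> T \<Longrightarrow> T = M"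
    using FCP_maximal[OF FCP, of "Collect ?P"] by auto
  have "T \<subseteq> M" if T: "?P T" for T
  proof -
    have Tc: "subring T R" "K \<subseteq> T" "\<And>s. s \<in> T \<Longrightarrow> integral_over K R s \<Longrightarrow> s \<in> K"
      and Mc: "subring M R" "K \<subseteq> M" "\<And>s. s \<in> M \<Longrightarrow> integral_over K R s \<Longrightarrow> s \<in> K"
      using T M unfolding P_iff by blast+
    obtain G where G: "subring G R" "T \<subseteq> G" "M \<subseteq> G" "\<forall>s\<in>G. integral_over K R s \<longrightarrow> s \<in> K"
      using integrally_closed_compositum[OF K FCP Tc(1,2) Mc(1,2) Tc(3) Mc(3)] by blast
    then have "?P G" unfolding P_iff using Tc(2) by blast
    then show ?thesis using max G(2,3) by blast
  qed
  then have "pruefer_hull K R = M"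
    unfolding pruefer_hull_def using M by (intro Greatest_equality) auto
  then show "pruefer_hull K R \<in> intermediate_rings K R"
    "pruefer_ext K (R\<lparr>carrier := pruefer_hull K R\<rparr>)"
    using M by auto
qed

end

section \<open>The least ring over which \<open>S\<close> is integral, and the hull inside
  it\<close>

theorem theorem3p5:
  fixes S :: "('a, 'b) ring_scheme" and R :: "'a set"
  assumes "cring S" and "subring R S" and "R \<subset> carrier S" and "FCP R S"
  shows "(\<exists>T \<in> intermediate_rings R S. integral_ext T S \<and>
            (\<forall>U \<in> intermediate_rings R S. integral_ext U S \<longrightarrow> T \<subseteq> U)) \<and>
         co_integral_closure R S = \<Inter> {U \<in> intermediate_rings R S. integral_ext U S} \<and>
         pruefer_hull R S \<subseteq> co_integral_closure R S"
proof -
  interpret S: cring S by fact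
  let ?A = "{U \<in> intermediate_rings R S. integral_ext U S}"
  \<comment> \<open>The monic polynomial \<open>X - x\<close> shows that \<open>S\<close> is
    integral over itself, so the family \<open>?A\<close> is nonempty.\<close>
  have "integral_over (carrier S) S x" if "x \<in> carrier S" for x
    unfolding integral_over_def using that
    by (intro exI[of _ "[\<ominus>\<^bsub>S\<^esub> x]"]) (simp add: S.r_neg)
  then have "carrier S \<in> ?A"
    using S.carrier_is_subring assms(3) by (auto simp: intermediate_rings_def integral_ext_def)
  then have "?A \<noteq> {}" by blast
  moreover have "?A \<subseteq> intermediate_rings R S" by auto
  ultimately obtain T where T: "T \<in> ?A" and min: "\<forall>U\<in>?A. U \<subseteq> T \<longrightarrow> U = T"
    using FCP_minimal[OF assms(4), of ?A] by blast
  \<comment> \<open>Integrality passes to \<open>T \<inter> U\<close>, so the minimal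
    \<open>T\<close> equals this intersection; thus minimal becomes least.\<close>
  have least: "T \<subseteq> U" if U: "U \<in> ?A" for U
  proof -
    have TU: "subring T S" "R \<subseteq> T" "integral_ext T S" "subring U S" "R \<subseteq> U" "integral_ext U S"
      using T U by (auto simp: intermediate_rings_def)
    have "integral_ext (T \<inter> U) S"
      using TU FCP_mono[OF assms(4), of "T \<inter> U"] by (intro S.integral_ext_Int) auto
    moreover have "subring (T \<inter> U) S" by (rule S.subring_Int[OF TU(1,4)])
    ultimately have "T \<inter> U \<in> ?A" using TU by (simp add: intermediate_rings_def)
    then show ?thesis using min by blast
  qed
  have "co_integral_closure R S = T"
    unfolding co_integral_closure_def using T least by (intro Least_equality) auto
  moreover have "\<Inter> ?A = T" using T least by blast
  moreover have "pruefer_hull R S \<subseteq> T"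
  proof
    fix t assume t: "t \<in> pruefer_hull R S"
    let ?P = "pruefer_hull R S"
    have P: "subring ?P S" "R \<subseteq> ?P" "pruefer_ext R (S\<lparr>carrier := ?P\<rparr>)"
      using S.pruefer_hull_greatest[OF assms(2,4)] by (auto simp: intermediate_rings_def)
    \<comment> \<open>\<open>S\<close> is integral over \<open>T\<close>, in particular each element
      of the hull is; in a Pruefer subextension such elements already lie in
      \<open>T\<close>.\<close>
    have T': "subring T S" "R \<subseteq> T" "integral_over T S t"
      using T subringE(1)[OF P(1)] t by (auto simp: intermediate_rings_def integral_ext_def)
    show "t \<in> T" by (rule S.pruefer_integral_mem[OF assms(2) P(1,2,3) T'(1,2) t T'(3)])
  qed
  ultimately show ?thesis using T least by auto
qed

end
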